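(* Let $\lambda\ge0$, $T>0$, let $u_0,g$ satisfy hypotheses (H) of the context, let $u$ be the constructed weak solution (as defined in the context), and let $(f^*,W^* )$ be its induced pair, $$W^*(t,k)=k^{-3}u(t,x(k)),\qquad f^*(t,p)=h(p)+\partial_pu(t,p-\lambda),$$ with $x(k)=(k^{-2}+\lambda^2)^{1/2}-\lambda$ for $k\in(0,\infty)$ and $h(p)=-\int_p^\infty g(p'-\lambda)\,dp'$ for $p>\lambda$. Then: (i) for a.e. $t\in(0,T)$ the map $k\mapsto k^3W^*(t,k)$ lies in $L^q\big((0,\infty);\frac{dk}{1+\lambda^2k^2}\big)$ for every $q\in[1,3]$, uniformly in $t$, and additionally for $q=\delta$ when $\lambda=0$; moreover $k^3W^*$ admits a weak derivative in $k$, square integrable against $k^2\sqrt{1+\lambda^2k^2}\,dk\,dt$; (ii) $f^*-h=\partial_xu|_{x=p-\lambda}\in L^2((0,T)\times(\lambda,\infty))$; in particular $f^*(t,\cdot)-h$ is a function for a.e. $t$, even when the induced initial distribution $f_0^*=h+\partial_pu_0$ is only a distribution.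
   Context: $\Omega=(0,\infty)$, $Q_T=(0,T)\times\Omega$, $\rho_\lambda(x)=x^{1/2}(x+\lambda)(x+2\lambda)^{1/2}$ (so $\rho_0(x)=x^2$), $d\nu_\lambda=\rho_\lambda(x)^{-1}dx$. Functions of $x\in\Omega$ and of $p=x+\lambda\in(\lambda,\infty)$ are identified, so $\partial_pu_0$ is the distributional derivative of $p\mapsto u_0(p-\lambda)$. (H): $\rho_\lambda g\in L^\infty(\Omega)$; $u_0\ge0$; if $\lambda=0$, $u_0\in L^\delta(\Omega;d\nu_0)\cap L^3(\Omega;d\nu_0)$ for some $\delta\in(0,1)$; if $\lambda>0$, $u_0\in L^1(\Omega;d\nu_\lambda)\cap L^3(\Omega;d\nu_\lambda)$ (then $\nu_\lambda$ is finite, $u_0\in L^\delta(d\nu_\lambda)$ for all $\delta\in(0,1)$, and any such $\delta$ may be fixed). The scalar problem is $\partial_tu=\rho_\lambda u\,\partial_x^2u+\rho_\lambda gu$ in $(0,T)\times\Omega$, $u(t,0)=0$, $u(0,\cdot)=u_0$. Weak solution: a nonnegative $u:Q_T\to\mathbb R$ with $u^2\in L^{3/2}(0,T;V_0^{3/2}(\Omega))$, $\partial_xu^2\in L^2(Q_T)$, $\partial_xu\in L^2_{loc}(Q_T)$, such that for all $\phi\in C_c^\infty([0,T)\times\Omega)$ $$-\int_{Q_T}u\,\partial_t\phi\,dt\,d\nu_\lambda+\int_{Q_T}\partial_x\Big(\frac{u^2}{2}\Big)\partial_x\phi+\int_{Q_T}|\partial_xu|^2\phi=\int_\Omega u_0\,\phi(0,\cdot)\,d\nu_\lambda+\int_{Q_T}\phi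 u g ,$$ where $V_0^p(\Omega)$ is the closure of $C_c^\infty(\Omega)$ under $\|f\|_{L^p(\Omega;d\nu_\lambda)}+\|\partial_xf\|_{L^2(\Omega)}$. Regularized solutions: for each $n\in\mathbb N$ choose $\Omega_n=(a_n,b_n)$ with $a_{n+1}<a_n$, $b_n<b_{n+1}$, $a_n\to0$, $b_n\to\infty$, $\frac1n\nu_\lambda(\Omega_n)\to0$; $r_n>0$ with $r_n\to0$, $r_nn^\delta\to\infty$; and data with $\rho_\lambda g_n\in C_c^\infty(\Omega_n)$, $0\le u_{0,n}\in C_c^{2+\beta}(\Omega_n)$ for some $\beta\in(0,1)$, $u_{0,n}\to u_0$ in $L^p(\Omega;d\nu_\lambda)$ for $p\in[\delta,3]$, $\rho_\lambda g_n\to\rho_\lambda g$ in $L^p_{loc}(\Omega)$ and a.e., $\operatorname{ess\,inf}_{\Omega_n}\rho_\lambda g_n\ge\operatorname{ess\,inf}_\Omega\rho_\lambda g$, $\|\rho_\lambda g_n\|_{L^\infty}\le\|\rho_\lambda g\|_{L^\infty}$, and $\operatorname{supp}u_{0,n}\cup\operatorname{supp}(\rho_\lambda g_n)\subset[a_n+r_n,b_n-r_n]$. Let $u_n\in C^{1+\beta/2,2+\beta}([0,T]\times\overline{\Omega_n})$ be the unique classical solution of $\partial_tu_n=\rho_\lambda(u_n+\frac1n)\partial_x^2u_n+\rho_\lambda g_n(u_n+\frac1n)$ on $(0,T)\times\Omega_n$, $u_n(0,\cdot)=u_{0,n}$, $u_n(t,a_n)=u_n(t,b_n)=0$, extended by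 zero to $Q_T$. Constructed weak solution: the weak solution $u$, with $\partial_xu\in L^2(Q_T)$ and $u\in L^\infty(0,T;L^p(\Omega;d\nu_\lambda))$ for $p\in[1,3]$ (and $p=\delta$ if $\lambda=0$), obtained as the limit of a subsequence of such regularized solutions $(u_n)$ in the senses: $u_n\to u$ in $L^q_{loc}(Q_T;dt\times d\nu_\lambda)$ for all $q\in(\delta,3)$ and a.e.; $\partial_xu_n\rightharpoonup\partial_xu$ and $\partial_xu_n^2\rightharpoonup\partial_xu^2$ weakly in $L^2(Q_T)$; $\partial_xu_n\to\partial_xu$ in $L^2_{loc}(Q_T)$ and a.e. At positive times $u$ is identified with its continuous representative on $(0,T]\times\Omega$, which is locally Hölder continuous and locally Lipschitz in $x$. *)

theory Defs
  imports "HOL-Probability.Essential_Supremum"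
begin

section \<open>Test functions, Lebesgue spaces, weak derivatives\<close>

definition pd :: "'a::euclidean_space \<Rightarrow> ('a \<Rightarrow> real) \<Rightarrow> 'a \<Rightarrow> real" where
  "pd i f z = frechet_derivative f (at z) i"

primrec Ck :: "nat \<Rightarrow> ('a::euclidean_space \<Rightarrow> real) \<Rightarrow> bool" where
  "Ck 0 f \<longleftrightarrow> continuous_on UNIV f"
| "Ck (Suc n) f \<longleftrightarrow> f differentiable_on UNIV \<and> (\<forall>i\<in>Basis. Ck n (pd i f))"

definition supp :: "('a::euclidean_space \<Rightarrow> real) \<Rightarrow> 'a set" where
  "supp f = closure {z. f z \<noteq> 0}"

text \<open>\<open>C\<^sub>c\<^sup>\<infinity>(U)\<close>, each function being extended by zero to the whole space.\<close>

definition Cc_inf :: "'a::euclidean_space set \<Rightarrow> ('a \<Rightarrow> real) set" where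
  "Cc_inf U = {\<phi>. (\<forall>n. Ck n \<phi>) \<and> compact (supp \<phi>) \<and> supp \<phi> \<subseteq> U}"

definition hoelder_on :: "real \<Rightarrow> 'a::metric_space set \<Rightarrow> ('a \<Rightarrow> real) \<Rightarrow> bool" where
  "hoelder_on \<alpha> S f \<longleftrightarrow> (\<exists>C. \<forall>x\<in>S. \<forall>y\<in>S. \<bar>f x - f y\<bar> \<le> C * dist x y powr \<alpha>)"

definition Cc_2_hoelder :: "real \<Rightarrow> real set \<Rightarrow> (real \<Rightarrow> real) set" where
  "Cc_2_hoelder \<beta> U =
     {f. Ck 2 f \<and> hoelder_on \<beta> UNIV (pd 1 (pd 1 f)) \<and> compact (supp f) \<and> supp f \<subseteq> U}"

definition Lp :: "'a measure \<Rightarrow> real \<Rightarrow> ('a \<Rightarrow> real) set" where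
  "Lp M p = {f. f \<in> borel_measurable M \<and> integrable M (\<lambda>x. \<bar>f x\<bar> powr p)}"

definition lp_norm :: "'a measure \<Rightarrow> real \<Rightarrow> ('a \<Rightarrow> real) \<Rightarrow> real" where
  "lp_norm M p f = (LINT x|M. \<bar>f x\<bar> powr p) powr (1 / p)"

definition linf_norm :: "'a measure \<Rightarrow> ('a \<Rightarrow> real) \<Rightarrow> ereal" where
  "linf_norm M f = esssup M (\<lambda>x. ereal \<bar>f x\<bar>)"

definition ess_inf :: "'a measure \<Rightarrow> ('a \<Rightarrow> real) \<Rightarrow> ereal" where
  "ess_inf M f = - esssup M (\<lambda>x. ereal (- f x))"

definition Lp_loc :: "'a::euclidean_space set \<Rightarrow> real \<Rightarrow> ('a \<Rightarrow> real) set" where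
  "Lp_loc U p = {f. \<forall>K. compact K \<and> K \<subseteq> U \<longrightarrow> f \<in> Lp (lebesgue_on K) p}"

definition Lp_tendsto :: "'a measure \<Rightarrow> real \<Rightarrow> (nat \<Rightarrow> 'a \<Rightarrow> real) \<Rightarrow> ('a \<Rightarrow> real) \<Rightarrow> bool" where
  "Lp_tendsto M p fn f \<longleftrightarrow>
     (\<forall>\<^sub>F n in sequentially. (\<lambda>x. fn n x - f x) \<in> Lp M p) \<and>
     (\<lambda>n. lp_norm M p (\<lambda>x. fn n x - f x)) \<longlonglongrightarrow> 0"

definition L2_weak_tendsto :: "'a measure \<Rightarrow> (nat \<Rightarrow> 'a \<Rightarrow> real) \<Rightarrow> ('a \<Rightarrow> real) \<Rightarrow> bool" where
  "L2_weak_tendsto M fn f \<longleftrightarrow>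
     (\<forall>\<^sub>F n in sequentially. fn n \<in> Lp M 2) \<and> f \<in> Lp M 2 \<and>
     (\<forall>\<psi>\<in>Lp M 2. (\<lambda>n. LINT x|M. fn n x * \<psi> x) \<longlonglongrightarrow> (LINT x|M. f x * \<psi> x))"

definition has_wpd ::
  "'a::euclidean_space \<Rightarrow> 'a set \<Rightarrow> ('a \<Rightarrow> real) \<Rightarrow> ('a \<Rightarrow> real) \<Rightarrow> bool" where
  "has_wpd i U f v \<longleftrightarrow> f \<in> Lp_loc U 1 \<and> v \<in> Lp_loc U 1 \<and>
     (\<forall>\<phi>\<in>Cc_inf U. (LINT z|lebesgue_on U. f z * pd i \<phi> z) = - (LINT z|lebesgue_on U. v z * \<phi> z))"

text \<open>A fixed representative of the weak derivative, which is unique up to null sets; it is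
  meaningful only when some weak derivative exists.\<close>

definition wpd :: "'a::euclidean_space \<Rightarrow> 'a set \<Rightarrow> ('a \<Rightarrow> real) \<Rightarrow> 'a \<Rightarrow> real" where
  "wpd i U f = (SOME v. has_wpd i U f v)"

definition weakly_diff :: "'a::euclidean_space \<Rightarrow> 'a set \<Rightarrow> ('a \<Rightarrow> real) \<Rightarrow> bool" where
  "weakly_diff i U f \<longleftrightarrow> (\<exists>v. has_wpd i U f v)"


section \<open>Distributions on open subsets of the line\<close>

definition is_distribution :: "real set \<Rightarrow> ((real \<Rightarrow> real) \<Rightarrow> real) \<Rightarrow> bool" where
  "is_distribution U F \<longleftrightarrow>
     (\<forall>\<phi>\<in>Cc_inf U. \<forall>\<psi>\<in>Cc_inf U. \<forall>c d. F (\<lambda>x. c * \<phi> x + d * \<psi> x) = c * F \<phi> + d * F \<psi>) \<and>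
     (\<forall>K. compact K \<and> K \<subseteq> U \<longrightarrow>
        (\<exists>C m. \<forall>\<phi>\<in>Cc_inf U. supp \<phi> \<subseteq> K \<longrightarrow> \<bar>F \<phi>\<bar> \<le> C * (\<Sum>j\<le>m. SUP x. \<bar>(pd 1 ^^ j) \<phi> x\<bar>)))"

definition reg_distr :: "real set \<Rightarrow> (real \<Rightarrow> real) \<Rightarrow> (real \<Rightarrow> real) \<Rightarrow> real" where
  "reg_distr U f \<phi> = (LINT x|lebesgue_on U. f x * \<phi> x)"

definition distr_deriv :: "((real \<Rightarrow> real) \<Rightarrow> real) \<Rightarrow> (real \<Rightarrow> real) \<Rightarrow> real" where
  "distr_deriv F \<phi> = - F (pd 1 \<phi>)"

definition distr_is_function :: "real set \<Rightarrow> ((real \<Rightarrow> real) \<Rightarrow> real) \<Rightarrow> (real \<Rightarrow> real) \<Rightarrow> bool" where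
  "distr_is_function U F f \<longleftrightarrow> f \<in> Lp_loc U 1 \<and> (\<forall>\<phi>\<in>Cc_inf U. F \<phi> = reg_distr U f \<phi>)"


section \<open>The scalar problem\<close>

definition QT :: "real \<Rightarrow> (real \<times> real) set" where
  "QT T = {0<..<T} \<times> {0<..}"

definition rho :: "real \<Rightarrow> real \<Rightarrow> real" where
  "rho lam x = sqrt x * (x + lam) * sqrt (x + 2 * lam)"

definition nu :: "real \<Rightarrow> real measure" where
  "nu lam = density (lebesgue_on {0<..}) (\<lambda>x. ennreal (1 / rho lam x))"

text \<open>The measure \<open>dt \<times> d\<nu>\<close> on a set of points \<open>(t, x)\<close>.\<close>

definition dt_nu :: "real \<Rightarrow> (real \<times> real) set \<Rightarrow> (real \<times> real) measure" where
  "dt_nu lam S = density (lebesgue_on S) (\<lambda>z. ennreal (1 / rho lam (snd z)))"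

definition hyp_H :: "real \<Rightarrow> real \<Rightarrow> (real \<Rightarrow> real) \<Rightarrow> (real \<Rightarrow> real) \<Rightarrow> bool" where
  "hyp_H lam \<delta> u0 g \<longleftrightarrow>
     0 < \<delta> \<and> \<delta> < 1 \<and>
     g \<in> borel_measurable (lebesgue_on {0<..}) \<and>
     linf_norm (lebesgue_on {0<..}) (\<lambda>x. rho lam x * g x) < \<infinity> \<and>
     (AE x in lebesgue_on {0<..}. 0 \<le> u0 x) \<and>
     (if lam = 0 then u0 \<in> Lp (nu lam) \<delta> \<inter> Lp (nu lam) 3
      else u0 \<in> Lp (nu lam) 1 \<inter> Lp (nu lam) 3)"

definition V0_norm :: "real \<Rightarrow> real \<Rightarrow> (real \<Rightarrow> real) \<Rightarrow> real" where
  "V0_norm lam p f = lp_norm (nu lam) p f + lp_norm (lebesgue_on {0<..}) 2 (wpd 1 {0<..} f)"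

definition V0 :: "real \<Rightarrow> real \<Rightarrow> (real \<Rightarrow> real) set" where
  "V0 lam p = {f. f \<in> Lp (nu lam) p \<and>
     weakly_diff 1 {0<..} f \<and> wpd 1 {0<..} f \<in> Lp (lebesgue_on {0<..}) 2 \<and>
     (\<exists>\<phi>. (\<forall>n. \<phi> n \<in> Cc_inf {0<..}) \<and> (\<lambda>n::nat. V0_norm lam p (\<lambda>x. f x - \<phi> n x)) \<longlonglongrightarrow> 0)}"

text \<open>The Bochner space \<open>L\<^sup>q(0,T; V\<^sub>0\<^sup>p)\<close>. The space \<open>V\<^sub>0\<^sup>p\<close> is separable, so joint measurability
  yields strong measurability.\<close>

definition Lq_V0 :: "real \<Rightarrow> real \<Rightarrow> real \<Rightarrow> real \<Rightarrow> (real \<times> real \<Rightarrow> real) set" where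
  "Lq_V0 lam T q p = {f. f \<in> borel_measurable (lebesgue_on (QT T)) \<and>
     (AE t in lebesgue_on {0<..<T}. (\<lambda>x. f (t, x)) \<in> V0 lam p) \<and>
     (\<lambda>t. V0_norm lam p (\<lambda>x. f (t, x))) \<in> Lp (lebesgue_on {0<..<T}) q}"

definition Linf_Lp :: "real \<Rightarrow> real \<Rightarrow> real \<Rightarrow> (real \<times> real \<Rightarrow> real) set" where
  "Linf_Lp lam T p = {f. f \<in> borel_measurable (lebesgue_on (QT T)) \<and>
     (\<exists>C. AE t in lebesgue_on {0<..<T}.
        (\<lambda>x. f (t, x)) \<in> Lp (nu lam) p \<and> lp_norm (nu lam) p (\<lambda>x. f (t, x)) \<le> C)}"

text \<open>Points of \<open>QT T\<close> are pairs \<open>(t, x)\<close>, so \<open>pd (1, 0)\<close> is \<open>\<partial>\<^sub>t\<close> and \<open>pd (0, 1)\<close>, \<open>wpd (0, 1)\<close>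
  are \<open>\<partial>\<^sub>x\<close>. The elements of \<open>C\<^sub>c\<^sup>\<infinity>([0,T) \<times> \<Omega>)\<close> are the restrictions to \<open>t \<ge> 0\<close> of the elements of
  \<open>C\<^sub>c\<^sup>\<infinity>((-\<infinity>,T) \<times> \<Omega>)\<close>. Since \<open>\<partial>\<^sub>x u\<close> is only locally square integrable in the open set
  \<open>QT T\<close>, while the test functions need not vanish at \<open>t = 0\<close>, existence of the third integral
  is required explicitly; without it that integral would silently be zero.\<close>

definition weak_solution ::
  "real \<Rightarrow> real \<Rightarrow> (real \<Rightarrow> real) \<Rightarrow> (real \<Rightarrow> real) \<Rightarrow> (real \<times> real \<Rightarrow> real) \<Rightarrow> bool" where
  "weak_solution lam T u0 g u \<longleftrightarrow>
     u \<in> borel_measurable (lebesgue_on (QT T)) \<and>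
     (AE z in lebesgue_on (QT T). 0 \<le> u z) \<and>
     (\<lambda>z. (u z)\<^sup>2) \<in> Lq_V0 lam T (3/2) (3/2) \<and>
     weakly_diff (0, 1) (QT T) (\<lambda>z. (u z)\<^sup>2) \<and>
     wpd (0, 1) (QT T) (\<lambda>z. (u z)\<^sup>2) \<in> Lp (lebesgue_on (QT T)) 2 \<and>
     weakly_diff (0, 1) (QT T) u \<and>
     wpd (0, 1) (QT T) u \<in> Lp_loc (QT T) 2 \<and>
     (\<forall>\<phi>\<in>Cc_inf ({..<T} \<times> {0<..}).
        integrable (lebesgue_on (QT T)) (\<lambda>z. \<bar>wpd (0, 1) (QT T) u z\<bar>\<^sup>2 * \<phi> z) \<and>
        - (LINT z|dt_nu lam (QT T). u z * pd (1, 0) \<phi> z)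
        + (LINT z|lebesgue_on (QT T). wpd (0, 1) (QT T) (\<lambda>z. (u z)\<^sup>2 / 2) z * pd (0, 1) \<phi> z)
        + (LINT z|lebesgue_on (QT T). \<bar>wpd (0, 1) (QT T) u z\<bar>\<^sup>2 * \<phi> z)
        = (LINT x|nu lam. u0 x * \<phi> (0, x))
        + (LINT z|lebesgue_on (QT T). \<phi> z * u z * g (snd z)))"


section \<open>Regularized solutions\<close>

text \<open>The parabolic Hoelder space \<open>C\<^bsup>1+\<beta>/2,2+\<beta>\<^esup>([0,T] \<times> [a,b])\<close>; the derivatives \<open>u\<^sub>t\<close>, \<open>u\<^sub>x\<close>,
  \<open>u\<^sub>x\<^sub>x\<close> are passed as arguments and are one-sided at the boundary. Continuity of all of them
  follows from the bounds.\<close>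

definition parabolic_hoelder :: "real \<Rightarrow> real \<Rightarrow> real \<Rightarrow> real \<Rightarrow>
    (real \<times> real \<Rightarrow> real) \<Rightarrow> (real \<times> real \<Rightarrow> real) \<Rightarrow> (real \<times> real \<Rightarrow> real) \<Rightarrow> (real \<times> real \<Rightarrow> real) \<Rightarrow> bool"
  where
  "parabolic_hoelder \<beta> T a b u ut ux uxx \<longleftrightarrow>
     (\<forall>t\<in>{0..T}. \<forall>x\<in>{a..b}.
        ((\<lambda>s. u (s, x)) has_real_derivative ut (t, x)) (at t within {0..T}) \<and>
        ((\<lambda>y. u (t, y)) has_real_derivative ux (t, x)) (at x within {a..b}) \<and>
        ((\<lambda>y. ux (t, y)) has_real_derivative uxx (t, x)) (at x within {a..b})) \<and>
     (\<exists>C. \<forall>t\<in>{0..T}. \<forall>s\<in>{0..T}. \<forall>x\<in>{a..b}. \<forall>y\<in>{a..b}.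
        \<bar>ut (t, x) - ut (s, y)\<bar> \<le> C * (\<bar>t - s\<bar> powr (\<beta>/2) + \<bar>x - y\<bar> powr \<beta>) \<and>
        \<bar>uxx (t, x) - uxx (s, y)\<bar> \<le> C * (\<bar>t - s\<bar> powr (\<beta>/2) + \<bar>x - y\<bar> powr \<beta>) \<and>
        \<bar>ux (t, x) - ux (s, x)\<bar> \<le> C * \<bar>t - s\<bar> powr ((1 + \<beta>)/2))"

text \<open>\<open>w\<close> is the classical solution at parameter \<open>\<epsilon>\<close> on \<open>(a,b)\<close>, extended by zero.\<close>

definition regularized_problem :: "real \<Rightarrow> real \<Rightarrow> real \<Rightarrow> real \<Rightarrow> real \<Rightarrow> real \<Rightarrow>
    (real \<Rightarrow> real) \<Rightarrow> (real \<Rightarrow> real) \<Rightarrow> (real \<times> real \<Rightarrow> real) \<Rightarrow> bool" where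
  "regularized_problem lam T \<beta> \<epsilon> a b w0 G w \<longleftrightarrow>
     (\<exists>wt wx wxx. parabolic_hoelder \<beta> T a b w wt wx wxx \<and>
        (\<forall>t\<in>{0<..<T}. \<forall>x\<in>{a<..<b}.
           wt (t, x) = rho lam x * (w (t, x) + \<epsilon>) * wxx (t, x) + rho lam x * G x * (w (t, x) + \<epsilon>))) \<and>
     (\<forall>x\<in>{a..b}. w (0, x) = w0 x) \<and>
     (\<forall>t\<in>{0..T}. w (t, a) = 0 \<and> w (t, b) = 0) \<and>
     (\<forall>(t, x)\<in>QT T. x \<notin> {a..b} \<longrightarrow> w (t, x) = 0)"

text \<open>Only indices \<open>n \<ge> 1\<close> are meaningful.\<close>

definition regularized_solutions :: "real \<Rightarrow> real \<Rightarrow> real \<Rightarrow> (real \<Rightarrow> real) \<Rightarrow> (real \<Rightarrow> real) \<Rightarrow>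
    (nat \<Rightarrow> real) \<Rightarrow> (nat \<Rightarrow> real) \<Rightarrow> (nat \<Rightarrow> real) \<Rightarrow> (nat \<Rightarrow> real \<Rightarrow> real) \<Rightarrow> (nat \<Rightarrow> real \<Rightarrow> real) \<Rightarrow>
    (nat \<Rightarrow> real \<times> real \<Rightarrow> real) \<Rightarrow> bool" where
  "regularized_solutions lam T \<delta> u0 g a b r gn u0n un \<longleftrightarrow>
     (\<forall>n\<ge>1. 0 < a n \<and> a n < b n \<and> a (Suc n) < a n \<and> b n < b (Suc n)) \<and>
     a \<longlonglongrightarrow> 0 \<and> filterlim b at_top sequentially \<and>
     (\<lambda>n. 1 / real n * measure (nu lam) {a n<..<b n}) \<longlonglongrightarrow> 0 \<and>
     (\<forall>n\<ge>1. 0 < r n) \<and> r \<longlonglongrightarrow> 0 \<and>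
     filterlim (\<lambda>n. r n * real n powr \<delta>) at_top sequentially \<and>
     (\<forall>n\<ge>1. (\<lambda>x. rho lam x * gn n x) \<in> Cc_inf {a n<..<b n}) \<and>
     (\<forall>p\<in>{\<delta>..3}. Lp_tendsto (nu lam) p u0n u0) \<and>
     (\<forall>p\<ge>1. \<forall>K. compact K \<and> K \<subseteq> {0<..} \<longrightarrow>
        Lp_tendsto (lebesgue_on K) p (\<lambda>n x. rho lam x * gn n x) (\<lambda>x. rho lam x * g x)) \<and>
     (AE x in lebesgue_on {0<..}. (\<lambda>n. rho lam x * gn n x) \<longlonglongrightarrow> rho lam x * g x) \<and>
     (\<forall>n\<ge>1. ess_inf (lebesgue_on {0<..}) (\<lambda>x. rho lam x * g x)
              \<le> ess_inf (lebesgue_on {a n<..<b n}) (\<lambda>x. rho lam x * gn n x)) \<and>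
     (\<forall>n\<ge>1. linf_norm (lebesgue_on {0<..}) (\<lambda>x. rho lam x * gn n x)
              \<le> linf_norm (lebesgue_on {0<..}) (\<lambda>x. rho lam x * g x)) \<and>
     (\<forall>n\<ge>1. supp (u0n n) \<union> supp (\<lambda>x. rho lam x * gn n x) \<subseteq> {a n + r n..b n - r n}) \<and>
     (\<forall>n\<ge>1. \<exists>\<beta>. 0 < \<beta> \<and> \<beta> < 1 \<and>
        (\<forall>x. 0 \<le> u0n n x) \<and> u0n n \<in> Cc_2_hoelder \<beta> {a n<..<b n} \<and>
        regularized_problem lam T \<beta> (1 / real n) (a n) (b n) (u0n n) (gn n) (un n))"


section \<open>Constructed weak solutions\<close>

definition constructed_weak_solution :: "real \<Rightarrow> real \<Rightarrow> real \<Rightarrow> (real \<Rightarrow> real) \<Rightarrow> (real \<Rightarrow> real) \<Rightarrow>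
    (real \<times> real \<Rightarrow> real) \<Rightarrow> bool" where
  "constructed_weak_solution lam T \<delta> u0 g u \<longleftrightarrow>
     weak_solution lam T u0 g u \<and>
     wpd (0, 1) (QT T) u \<in> Lp (lebesgue_on (QT T)) 2 \<and>
     (\<forall>p. p \<in> {1..3} \<or> (lam = 0 \<and> p = \<delta>) \<longrightarrow> u \<in> Linf_Lp lam T p) \<and>
     (\<exists>a b r gn u0n un s.
        regularized_solutions lam T \<delta> u0 g a b r gn u0n un \<and> strict_mono s \<and>
        (\<forall>q. \<delta> < q \<and> q < 3 \<longrightarrow> (\<forall>K. compact K \<and> K \<subseteq> QT T \<longrightarrow>
           Lp_tendsto (dt_nu lam K) q (\<lambda>j. un (s j)) u)) \<and>
        (AE z in lebesgue_on (QT T). (\<lambda>j. un (s j) z) \<longlonglongrightarrow> u z) \<and>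
        L2_weak_tendsto (lebesgue_on (QT T))
          (\<lambda>j. wpd (0, 1) (QT T) (un (s j))) (wpd (0, 1) (QT T) u) \<and>
        L2_weak_tendsto (lebesgue_on (QT T))
          (\<lambda>j. wpd (0, 1) (QT T) (\<lambda>z. (un (s j) z)\<^sup>2)) (wpd (0, 1) (QT T) (\<lambda>z. (u z)\<^sup>2)) \<and>
        (\<forall>K. compact K \<and> K \<subseteq> QT T \<longrightarrow>
           Lp_tendsto (lebesgue_on K) 2
             (\<lambda>j. wpd (0, 1) (QT T) (un (s j))) (wpd (0, 1) (QT T) u)) \<and>
        (AE z in lebesgue_on (QT T).
           (\<lambda>j. wpd (0, 1) (QT T) (un (s j)) z) \<longlonglongrightarrow> wpd (0, 1) (QT T) u z)) \<and>
     continuous_on ({0<..T} \<times> {0<..}) u \<and>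
     (\<forall>K. compact K \<and> K \<subseteq> {0<..T} \<times> {0<..} \<longrightarrow>
        (\<exists>\<alpha>. 0 < \<alpha> \<and> \<alpha> \<le> 1 \<and> hoelder_on \<alpha> K u) \<and>
        (\<exists>L. \<forall>t x y. (t, x) \<in> K \<and> (t, y) \<in> K \<longrightarrow> \<bar>u (t, x) - u (t, y)\<bar> \<le> L * \<bar>x - y\<bar>))"


section \<open>The induced pair\<close>

definition x_of_k :: "real \<Rightarrow> real \<Rightarrow> real" where
  "x_of_k lam k = sqrt (1 / k\<^sup>2 + lam\<^sup>2) - lam"

definition W_star :: "real \<Rightarrow> (real \<times> real \<Rightarrow> real) \<Rightarrow> real \<times> real \<Rightarrow> real" where
  "W_star lam u = (\<lambda>(t, k). 1 / k ^ 3 * u (t, x_of_k lam k))"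

definition h_fun :: "real \<Rightarrow> (real \<Rightarrow> real) \<Rightarrow> real \<Rightarrow> real" where
  "h_fun lam g p = - (LINT q|lebesgue_on {p<..}. g (q - lam))"

text \<open>The distribution \<open>h + \<partial>\<^sub>p w(\<cdot> - \<lambda>)\<close> on \<open>(\<lambda>,\<infinity>)\<close> induced by a profile \<open>w\<close> on \<open>\<Omega>\<close>.\<close>

definition induced_distr :: "real \<Rightarrow> (real \<Rightarrow> real) \<Rightarrow> (real \<Rightarrow> real) \<Rightarrow> (real \<Rightarrow> real) \<Rightarrow> real" where
  "induced_distr lam g w \<phi> =
     reg_distr {lam<..} (h_fun lam g) \<phi> + distr_deriv (reg_distr {lam<..} (\<lambda>p. w (p - lam))) \<phi>"

definition f_star ::
  "real \<Rightarrow> (real \<Rightarrow> real) \<Rightarrow> (real \<times> real \<Rightarrow> real) \<Rightarrow> real \<Rightarrow> (real \<Rightarrow> real) \<Rightarrow> real" where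
  "f_star lam g u t = induced_distr lam g (\<lambda>x. u (t, x))"

definition f0_star :: "real \<Rightarrow> (real \<Rightarrow> real) \<Rightarrow> (real \<Rightarrow> real) \<Rightarrow> (real \<Rightarrow> real) \<Rightarrow> real" where
  "f0_star lam g u0 = induced_distr lam g u0"

end

(* Disintegrating the weak x-derivative of u in t shows that, for almost every t, the function
   u(t,.) is a primitive of a Borel representative of that derivative: test with products
   theta(t) psi(x) of smooth cutoffs, let theta tend to the indicator of an interval, then let psi
   range over a countable family of cutoffs of rational intervals and use continuity of u.
   On the level of slices, everything is a one-dimensional change of variables. With x = x(k) one
   has rho(x) = k^-2 sqrt(1 + lambda^2 k^2) and |dx/dk| = k^-2 (1 + lambda^2 k^2)^(-1/2), so d nu
   becomes dk / (1 + lambda^2 k^2) and |d_x u|^2 dx becomes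
   |d_k u|^2 k^2 sqrt(1 + lambda^2 k^2) dk. The bound uniform in q follows from
   y^q <= y + y^3 for 1 <= q <= 3. *)

theory Submission
  imports Defs
begin

section \<open>Smooth test functions\<close>

text \<open>Two obstacles shape the argument. The first is measure-theoretic:
  \<open>has_wpd\<close>, \<open>Lp\<close> and \<open>wpd\<close> refer to the completed measure
  \<open>lebesgue_on\<close>, and \<open>wpd\<close> is an arbitrary Lebesgue measurable
  representative, whereas Fubini runs over \<open>lborel\<close> and wants Borel functions on
  slices. Hence the passage to a Borel \<open>v'\<close>, statements about Borel integrands on which
  both measures agree, and lemmas that carry results back along almost everywhere equality. The
  second is the order of quantifiers: the null set of times must serve all intervals
  \<open>{c..d}\<close> and all exponents \<open>q\<close> at once. Test functions must therefore
  come from a countable family, and only the exponents 1, 3 and \<delta> may contribute a null set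
  of their own. Since local integrability in the open strip says nothing near its edges, the
  disintegration in t works on compact subintervals of (0,T). The way back, from primitives to weak
  derivatives, is integration by parts for functions without a derivative at every point, proved by
  exchanging integrals over a triangle.\<close>

lemma pd_eq: "(f has_derivative f') (at z) \<Longrightarrow> pd i f z = f' i"
  unfolding pd_def by (metis frechet_derivative_at)

lemma pd_real_eq: "(f has_real_derivative d) (at x) \<Longrightarrow> pd 1 f x = d"
  using pd_eq[of f "\<lambda>h. d * h" x 1] by (simp add: has_field_derivative_def)

lemma Ck_differentiable: "Ck (Suc n) f \<Longrightarrow> f differentiable (at z)"
  by (auto simp: differentiable_on_def)

lemma Ck_Suc_imp_Ck: "Ck (Suc n) f \<Longrightarrow> Ck n f"
proof (induction n arbitrary: f)
  case 0
  then show ?case by (auto simp: differentiable_imp_continuous_on)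
qed auto

lemma Ck_continuous: "Ck n f \<Longrightarrow> continuous_on UNIV f"
  by (induction n) (auto simp: differentiable_imp_continuous_on)

lemma Ck_const: "Ck n (\<lambda>x. c)"
proof (induction n arbitrary: c)
  case (Suc n)
  have "pd i (\<lambda>x::'a. c) = (\<lambda>x. 0)" for i by (simp add: pd_def fun_eq_iff)
  then show ?case using Suc by simp
qed simp

lemma Ck_add: "Ck n f \<Longrightarrow> Ck n g \<Longrightarrow> Ck n (\<lambda>x. f x + g x)"
proof (induction n arbitrary: f g)
  case (Suc n)
  have "pd i (\<lambda>x. f x + g x) = (\<lambda>x. pd i f x + pd i g x)" for i
  proof
    fix z
    have "(f has_derivative frechet_derivative f (at z)) (at z)"
         "(g has_derivative frechet_derivative g (at z)) (at z)"
      using Suc.prems by (meson Ck_differentiable frechet_derivative_works)+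
    from pd_eq[OF has_derivative_add[OF this]]
    show "pd i (\<lambda>x. f x + g x) z = pd i f z + pd i g z" by (simp add: pd_def)
  qed
  then show ?case using Suc by (auto intro: differentiable_on_add)
qed (auto intro: continuous_intros)

lemma Ck_mult: "Ck n f \<Longrightarrow> Ck n g \<Longrightarrow> Ck n (\<lambda>x. f x * g x)"
proof (induction n arbitrary: f g)
  case (Suc n)
  have "pd i (\<lambda>x. f x * g x) = (\<lambda>x. f x * pd i g x + pd i f x * g x)" for i
  proof
    fix z
    have "(f has_derivative frechet_derivative f (at z)) (at z)"
         "(g has_derivative frechet_derivative g (at z)) (at z)"
      using Suc.prems by (meson Ck_differentiable frechet_derivative_works)+
    from pd_eq[OF has_derivative_mult[OF this]]
    show "pd i (\<lambda>x. f x * g x) z = f z * pd i g z + pd i f z * g z" by (simp add: pd_def)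
  qed
  moreover have "Ck n f" "Ck n g" using Suc.prems Ck_Suc_imp_Ck by blast+
  ultimately show ?case using Suc by (auto intro!: differentiable_on_mult Ck_add)
qed (auto intro: continuous_intros)

text \<open>With \<open>a\<close> a real number the inner product is a rescaling of the line, with
  \<open>a\<close> a unit vector of the plane it extracts a coordinate. One computation thus serves
  both the dilated steps and the tensor product test functions.\<close>

lemma pd_affine:
  fixes f :: "real \<Rightarrow> real"
  assumes "f differentiable (at (a \<bullet> z + b))"
  shows "((\<lambda>z. f (a \<bullet> z + b)) has_derivative (\<lambda>h. (a \<bullet> h) * pd 1 f (a \<bullet> z + b))) (at z)"
    and "pd i (\<lambda>z. f (a \<bullet> z + b)) z = (a \<bullet> i) * pd 1 f (a \<bullet> z + b)"
proof -
  let ?f' = "frechet_derivative f (at (a \<bullet> z + b))"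
  have f: "(f has_derivative ?f') (at (a \<bullet> z + b))"
    using assms frechet_derivative_works by blast
  have "((\<lambda>z. f (a \<bullet> z + b)) has_derivative (\<lambda>h. ?f' (a \<bullet> h))) (at z)"
    by (rule has_derivative_compose[where f = "\<lambda>z. a \<bullet> z + b" and g = f, OF _ f])
       (auto intro!: derivative_eq_intros)
  moreover have "?f' (a \<bullet> h) = (a \<bullet> h) * pd 1 f (a \<bullet> z + b)" for h
    using linear_scale[OF has_derivative_linear[OF f], of "a \<bullet> h" 1] by (simp add: pd_def)
  ultimately show *: "((\<lambda>z. f (a \<bullet> z + b)) has_derivative (\<lambda>h. (a \<bullet> h) * pd 1 f (a \<bullet> z + b))) (at z)"
    by simp
  from pd_eq[OF *] show "pd i (\<lambda>z. f (a \<bullet> z + b)) z = (a \<bullet> i) * pd 1 f (a \<bullet> z + b)" .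
qed

lemma Ck_affine:
  fixes f :: "real \<Rightarrow> real"
  shows "Ck n f \<Longrightarrow> Ck n (\<lambda>z. f (a \<bullet> z + b))"
proof (induction n arbitrary: f)
  case 0
  then show ?case by (auto intro!: continuous_intros continuous_on_compose2[of UNIV f])
next
  case (Suc n)
  have d: "f differentiable (at x)" for x using Suc.prems Ck_differentiable by blast
  have "pd i (\<lambda>z. f (a \<bullet> z + b)) = (\<lambda>z. (a \<bullet> i) * pd 1 f (a \<bullet> z + b))" for i
    by (intro ext pd_affine(2)[OF d])
  moreover have "Ck n (\<lambda>z. pd 1 f (a \<bullet> z + b))" using Suc by simp
  moreover have "(\<lambda>z. f (a \<bullet> z + b)) differentiable (at z)" for z
    using pd_affine(1)[OF d] differentiableI by blast
  ultimately show ?case by (auto intro!: Ck_mult Ck_const simp: differentiable_on_def)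
qed

lemma
  fixes \<phi> :: "'a::euclidean_space \<Rightarrow> real"
  assumes "\<phi> \<in> Cc_inf U"
  shows Cc_inf_continuous: "continuous_on A \<phi>"
    and Cc_inf_pd_continuous: "i \<in> Basis \<Longrightarrow> continuous_on A (pd i \<phi>)"
    and Cc_inf_has_derivative: "(\<phi> has_derivative (\<lambda>h. frechet_derivative \<phi> (at z) h)) (at z)"
    and Cc_inf_eq_0: "z \<notin> supp \<phi> \<Longrightarrow> \<phi> z = 0"
    and Cc_inf_pd_eq_0: "z \<notin> supp \<phi> \<Longrightarrow> pd i \<phi> z = 0"
    and Cc_inf_supp: "compact (supp \<phi>)" "supp \<phi> \<subseteq> U"
proof -
  have Ck: "Ck n \<phi>" for n using assms by (simp add: Cc_inf_def)
  show "continuous_on A \<phi>" using Ck_continuous[OF Ck] continuous_on_subset by blast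
  show "continuous_on A (pd i \<phi>)" if "i \<in> Basis"
    using Ck[of 1] that continuous_on_subset by fastforce
  show d: "(\<phi> has_derivative (\<lambda>h. frechet_derivative \<phi> (at z) h)) (at z)"
    using Ck[of 1] Ck_differentiable[of 0] frechet_derivative_works by fastforce
  show 0: "\<phi> z = 0" if "z \<notin> supp \<phi>" for z
    using that subsetD[OF closure_subset, of z "{z. \<phi> z \<noteq> 0}"] by (auto simp: supp_def)
  show "pd i \<phi> z = 0" if z: "z \<notin> supp \<phi>"
  proof -
    \<comment> \<open>\<open>\<phi>\<close> vanishes on a whole neighbourhood of \<open>z\<close>,
      because the support is closed; this is what makes the derivative vanish as well.\<close>
    have "open (- supp \<phi>)" by (simp add: supp_def open_Compl)
    then have "(\<phi> has_derivative (\<lambda>h. 0)) (at z)"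
      by (intro has_derivative_transform_within_open[OF has_derivative_const[of 0 "at z"], of "- supp \<phi>" \<phi>])
        (use z 0 in auto)
    from pd_eq[OF this] show ?thesis .
  qed
  show "compact (supp \<phi>)" "supp \<phi> \<subseteq> U" using assms by (auto simp: Cc_inf_def)
qed

lemma Cc_inf_real_derivative:
  assumes "\<phi> \<in> Cc_inf U"
  shows "(\<phi> has_real_derivative pd 1 \<phi> x) (at x)"
proof -
  have d: "\<phi> differentiable (at x)"
    using Cc_inf_has_derivative[OF assms] differentiableI by blast
  then show ?thesis using DERIV_deriv_iff_real_differentiable pd_real_eq by metis
qed

text \<open>Lets a test function of two variables be inserted, at fixed \<open>t\<close>, into a
  one-dimensional weak derivative. The slice keeps compact support because its support is closed and
  lies in the projection of a compact set.\<close>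

lemma Cc_inf_slice:
  fixes \<phi> :: "real \<times> real \<Rightarrow> real"
  assumes "\<phi> \<in> Cc_inf (A \<times> B)"
  shows "(\<lambda>x. \<phi> (t, x)) \<in> Cc_inf B" and "pd 1 (\<lambda>x. \<phi> (t, x)) x = pd (0, 1) \<phi> (t, x)"
proof -
  have d: "((\<lambda>x. f (t, x)) has_derivative (\<lambda>h. frechet_derivative f (at (t, x)) (0, h))) (at x)"
    if "f differentiable (at (t, x))" for f :: "real \<times> real \<Rightarrow> real" and x
  proof -
    have "(f has_derivative frechet_derivative f (at (t, x))) (at (t, x))"
      using that frechet_derivative_works by blast
    then show ?thesis
      by (rule has_derivative_compose[rotated]) (auto intro!: derivative_eq_intros)
  qed
  have pd: "pd 1 (\<lambda>x. f (t, x)) x = pd (0, 1) f (t, x)"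
    if "f differentiable (at (t, x))" for f :: "real \<times> real \<Rightarrow> real" and x
    using pd_eq[OF d[OF that]] by (simp add: pd_def)
  have Ck: "Ck n f \<Longrightarrow> Ck n (\<lambda>x. f (t, x))" for n and f :: "real \<times> real \<Rightarrow> real"
  proof (induction n arbitrary: f)
    case 0
    then show ?case by (auto intro!: continuous_intros continuous_on_compose2[of UNIV f])
  next
    case (Suc n)
    have diff: "f differentiable (at z)" for z using Suc.prems Ck_differentiable by blast
    have "(0, 1) \<in> (Basis :: (real \<times> real) set)" by (auto simp: Basis_prod_def)
    then have "Ck n (\<lambda>x. pd (0, 1) f (t, x))" using Suc by (auto simp del: Ck.simps(1))
    moreover have "pd 1 (\<lambda>x. f (t, x)) = (\<lambda>x. pd (0, 1) f (t, x))" using pd[OF diff] by auto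
    moreover have "(\<lambda>x. f (t, x)) differentiable (at x)" for x
      using d[OF diff] differentiableI by blast
    ultimately show ?case by (auto simp: differentiable_on_def)
  qed
  have "\<phi> differentiable (at z)" for z
    using Cc_inf_has_derivative[OF assms] differentiableI by blast
  then show "pd 1 (\<lambda>x. \<phi> (t, x)) x = pd (0, 1) \<phi> (t, x)" by (rule pd)
  have closed: "closed {x. (t, x) \<in> supp \<phi>}"
  proof -
    have "closed (Pair t -` supp \<phi>)"
      by (rule continuous_closed_vimage) (auto simp: supp_def intro!: continuous_intros)
    then show ?thesis by (simp add: vimage_def)
  qed
  have sub: "supp (\<lambda>x. \<phi> (t, x)) \<subseteq> {x. (t, x) \<in> supp \<phi>}"
    unfolding supp_def[of "\<lambda>x. \<phi> (t, x)"]
    using Cc_inf_eq_0[OF assms] by (intro closure_minimal closed) auto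
  then have sub': "supp (\<lambda>x. \<phi> (t, x)) \<subseteq> snd ` supp \<phi>" by force
  have "bounded (snd ` supp \<phi>)"
    using Cc_inf_supp(1)[OF assms]
    by (intro compact_imp_bounded compact_continuous_image continuous_intros)
  then have "compact (supp (\<lambda>x. \<phi> (t, x)))"
    using sub' bounded_subset by (metis closed_closure compact_eq_bounded_closed supp_def)
  moreover have "supp (\<lambda>x. \<phi> (t, x)) \<subseteq> B" using sub Cc_inf_supp(2)[OF assms] by auto
  ultimately show "(\<lambda>x. \<phi> (t, x)) \<in> Cc_inf B"
    using assms Ck unfolding Cc_inf_def by blast
qed

text \<open>The family \<open>x\<^sup>-\<^sup>n exp(-1/x)\<close> (zero for \<open>x \<le> 0\<close>) is closed under differentiation up to linear
  combinations, so each of its members is smooth.\<close>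

definition flat_exp :: "nat \<Rightarrow> real \<Rightarrow> real" where
  "flat_exp n x = (if x \<le> 0 then 0 else exp (- (1 / x)) / x ^ n)"

lemma flat_exp_tendsto: "(flat_exp n \<longlongrightarrow> 0) (at 0)"
proof -
  \<comment> \<open>Substituting 1/x turns the behaviour at the origin from the right into the decay
    of \<open>x ^ n / exp x\<close> at infinity.\<close>
  have "((\<lambda>x::real. x ^ n / exp x) \<longlongrightarrow> 0) at_top" by (rule tendsto_power_div_exp_0)
  then have "((\<lambda>x::real. (1 / x) ^ n / exp (1 / x)) \<longlongrightarrow> 0) (at_right 0)"
    using filterlim_compose[of "\<lambda>x::real. x ^ n / exp x" _ at_top "\<lambda>x. 1 / x" "at_right 0"]
      filterlim_inverse_at_top_right by (simp add: inverse_eq_divide)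
  moreover have "eventually (\<lambda>x. (1 / x) ^ n / exp (1 / x) = flat_exp n x) (at_right 0)"
    by (auto simp: eventually_at_filter flat_exp_def exp_minus field_simps)
  ultimately have "(flat_exp n \<longlongrightarrow> 0) (at_right 0)" using Lim_transform_eventually by blast
  moreover have "(flat_exp n \<longlongrightarrow> 0) (at_left 0)"
  proof (rule Lim_transform_eventually[OF tendsto_const])
    show "eventually (\<lambda>x. 0 = flat_exp n x) (at_left 0)"
      by (auto simp: eventually_at_filter flat_exp_def)
  qed
  ultimately show ?thesis by (simp add: filterlim_split_at)
qed

lemma flat_exp_deriv:
  "(flat_exp n has_real_derivative flat_exp (n + 2) x - real n * flat_exp (n + 1) x) (at x)"
proof -
  consider "x < 0" | "x = 0" | "x > 0" by linarith
  then show ?thesis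
  proof cases
    case 1
    have "((\<lambda>x. 0) has_real_derivative 0) (at x)" by simp
    then have "(flat_exp n has_real_derivative 0) (at x)"
      by (rule has_field_derivative_transform_within_open[of _ _ _ "{..<0}"])
         (use 1 in \<open>auto simp: flat_exp_def\<close>)
    then show ?thesis using 1 by (simp add: flat_exp_def)
  next
    case 2
    \<comment> \<open>At the origin the difference quotient of \<open>flat_exp n\<close> is exactly
      \<open>flat_exp (n + 1)\<close>, whose limit is already known; both terms of the claimed
      derivative are 0 there.\<close>
    have "((\<lambda>y. (flat_exp n y - flat_exp n 0) / (y - 0)) \<longlongrightarrow> 0) (at 0)"
    proof (rule Lim_transform_eventually[OF flat_exp_tendsto[of "n + 1"]])
      show "\<forall>\<^sub>F y in at 0. flat_exp (n + 1) y = (flat_exp n y - flat_exp n 0) / (y - 0)"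
        by (auto simp: eventually_at_filter flat_exp_def field_simps)
    qed
    then show ?thesis using 2 by (simp add: has_field_derivative_iff flat_exp_def)
  next
    case 3
    have "((\<lambda>x. exp (- (1 / x)) / x ^ n) has_real_derivative
        flat_exp (n + 2) x - real n * flat_exp (n + 1) x) (at x)"
    proof -
      have e: "((\<lambda>x. exp (- (1 / x))) has_real_derivative exp (- (1 / x)) * (1 / x ^ 2)) (at x)"
        using 3 by (auto intro!: derivative_eq_intros simp: power2_eq_square)
      have p: "((\<lambda>x. x ^ n) has_real_derivative real n * (x ^ n / x)) (at x)"
        using 3 DERIV_pow[of n x] by (cases n) simp_all
      have "(E * (1 / x\<^sup>2) * P - E * (real n * (P / x))) / (P * P)
          = E / (P * x\<^sup>2) - real n * (E / (P * x))" if "P > 0" for E P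
        using that 3 by (simp add: field_simps power2_eq_square)
      note DERIV_cong[OF DERIV_divide[OF e p] this]
      then show ?thesis using 3 by (simp add: flat_exp_def power2_eq_square mult_ac)
    qed
    then show ?thesis
      by (rule has_field_derivative_transform_within_open[of _ _ _ "{0<..}"])
         (use 3 in \<open>auto simp: flat_exp_def\<close>)
  qed
qed

lemma flat_exp_Ck: "Ck m (flat_exp n)"
proof (induction m arbitrary: n)
  case 0
  show ?case using DERIV_isCont[OF flat_exp_deriv] by (simp add: continuous_at_imp_continuous_on)
next
  case (Suc m)
  have "pd 1 (flat_exp n) = (\<lambda>x. flat_exp (n + 2) x + (- real n) * flat_exp (n + 1) x)"
    using pd_real_eq[OF flat_exp_deriv] by auto
  moreover have "flat_exp n differentiable_on UNIV"
    using flat_exp_deriv by (meson differentiable_on_def differentiable_at_withinI real_differentiable_def)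
  moreover have "Ck m (\<lambda>x. flat_exp (n + 2) x + (- real n) * flat_exp (n + 1) x)"
    by (intro Ck_add Ck_mult Ck_const Suc)
  ultimately show ?case by (simp only: Ck.simps) simp
qed

text \<open>The step is the normalised primitive of the bump exp(-1/x) exp(-1/(1-x)) on (0,1),
  extended by zero. Its derivative is kept as a separate function because, being nonnegative,
  supported in [0,1] and of integral one, it later acts as an approximate identity.\<close>

lemma smooth_step_exists:
  obtains S s :: "real \<Rightarrow> real"
  where "\<And>n. Ck n S" "\<And>x. (S has_real_derivative s x) (at x)" "continuous_on UNIV s"
    "\<And>x. 0 \<le> s x" "\<And>x. x \<notin> {0..1} \<Longrightarrow> s x = 0" "\<And>x. x \<le> 0 \<Longrightarrow> S x = 0" "\<And>x. 1 \<le> x \<Longrightarrow> S x = 1"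
proof -
  define b where "b x = flat_exp 0 x * flat_exp 0 (- 1 \<bullet> x + 1)" for x
  have bCk: "Ck n b" for n unfolding b_def by (intro Ck_mult Ck_affine flat_exp_Ck)
  have bcont: "continuous_on UNIV b" using Ck_continuous[OF bCk] .
  have b0: "0 \<le> b x" for x by (auto simp: b_def flat_exp_def)
  have bpos: "0 < b x" if "x \<in> {0<..<1}" for x using that by (auto simp: b_def flat_exp_def)
  have bout: "b x = 0" if "x \<notin> {0<..<1}" for x using that by (auto simp: b_def flat_exp_def)
  have "\<exists>F. \<forall>x::real. (-\<infinity>::ereal) < x \<longrightarrow> x < (\<infinity>::ereal) \<longrightarrow> (F has_vector_derivative b x) (at x)"
    by (rule einterval_antiderivative) (use bcont in \<open>auto simp: continuous_on_eq_continuous_at\<close>)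
  then obtain F where F: "\<And>x. (F has_real_derivative b x) (at x)"
    by (auto simp: has_real_derivative_iff_has_vector_derivative)
  have Fcont: "continuous_on A F" for A
    using F DERIV_isCont continuous_at_imp_continuous_on by blast
  have const: "F y = F x" if "x \<le> y" "\<And>z. x < z \<Longrightarrow> z < y \<Longrightarrow> b z = 0" for x y
  proof (cases "x = y")
    case False
    then have "x < y" using that by simp
    then show ?thesis
    proof (rule DERIV_isconst_end[OF _ Fcont])
      show "(F has_real_derivative 0) (at z)" if "x < z" "z < y" for z
        using F[of z] \<open>\<And>z. x < z \<Longrightarrow> z < y \<Longrightarrow> b z = 0\<close>[OF that] by simp
    qed
  qed simp
  have left: "F x = F 0" if "x \<le> 0" for x using const[of x 0] that bout by force
  have right: "F x = F 1" if "1 \<le> x" for x using const[of 1 x] that bout by force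
  \<comment> \<open>Positivity of \<open>b\<close> inside (0,1) makes the normalising constant
    nonzero; subtracting \<open>F 0\<close> removes the dependence on the choice of
    antiderivative.\<close>
  have "F 0 < F 1"
    using F bpos by (intro DERIV_pos_imp_increasing_open[of 0 1 F] Fcont) auto
  define S where "S x = (F x - F 0) / (F 1 - F 0)" for x
  define s where "s x = b x / (F 1 - F 0)" for x
  have S: "(S has_real_derivative s x) (at x)" for x
    unfolding S_def s_def by (rule DERIV_cdivide) (auto intro!: derivative_eq_intros F)
  show ?thesis
  proof (rule that[of S s])
    show "Ck n S" for n
    proof (rule Ck_Suc_imp_Ck)
      have "pd 1 S = (\<lambda>x. inverse (F 1 - F 0) * b x)"
        using pd_real_eq[OF S] by (auto simp: s_def field_simps)
      then have "Ck n (pd 1 S)" by (auto intro!: Ck_mult Ck_const bCk)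
      moreover have "S differentiable_on UNIV"
        using S by (meson differentiable_on_def differentiable_at_withinI real_differentiable_def)
      ultimately show "Ck (Suc n) S" by simp
    qed
    show "continuous_on UNIV s"
      unfolding s_def using \<open>F 0 < F 1\<close> by (auto intro!: continuous_intros bcont)
    show "0 \<le> s x" for x unfolding s_def using b0 \<open>F 0 < F 1\<close> by auto
    show "s x = 0" if "x \<notin> {0..1}" for x unfolding s_def using bout[of x] that by auto
    show "(S has_real_derivative s x) (at x)" for x by (rule S)
    show "S x = 0" if "x \<le> 0" for x using left[OF that] by (simp add: S_def)
    show "S x = 1" if "1 \<le> x" for x using right[OF that] \<open>F 0 < F 1\<close> by (simp add: S_def)
  qed
qed

section \<open>Primitives and integration by parts\<close>

text \<open>Half-open intervals are stable under intersection and generate the Borel sets, so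
  vanishing integrals spread to all Borel sets by Dynkin induction, and a function with this
  property is zero almost everywhere. Since the hypothesis only sees subintervals of
  \<open>{s1<..s2}\<close>, the argument is run for \<open>w\<close> extended by zero.\<close>

lemma AE_eq_0_if_interval_integrals_eq_0:
  fixes w :: "real \<Rightarrow> real"
  assumes w: "set_integrable lborel {s1<..s2} w"
    and zero: "\<And>a b. s1 \<le> a \<Longrightarrow> a < b \<Longrightarrow> b \<le> s2 \<Longrightarrow> (LINT x:{a<..b}|lborel. w x) = 0"
  shows "AE x in lborel. x \<in> {s1<..s2} \<longrightarrow> w x = 0"
proof -
  define f where "f = (\<lambda>x. indicator {s1<..s2} x * w x)"
  have f: "integrable lborel f" using w by (simp add: set_integrable_def f_def)
  have Ioc: "(LINT x:{a<..b}|lborel. f x) = 0" for a b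
  proof (cases "max a s1 < min b s2")
    case True
    have "(LINT x:{a<..b}|lborel. f x) = (LINT x:{max a s1<..min b s2}|lborel. w x)"
      unfolding set_lebesgue_integral_def f_def
      by (intro Bochner_Integration.integral_cong) (auto simp: indicator_def)
    also have "\<dots> = 0" using True by (intro zero) auto
    finally show ?thesis .
  next
    case False
    then have "indicator {a<..b} x * f x = 0" for x by (auto simp: f_def indicator_def)
    then show ?thesis unfolding set_lebesgue_integral_def by (simp only: real_scaleR_def) simp
  qed
  \<comment> \<open>The total integral must vanish too: the complement step of the induction
    subtracts from it.\<close>
  have all: "(LINT x|lborel. f x) = 0"
    using Ioc[of s1 s2] by (simp add: set_lebesgue_integral_def f_def mult.assoc[symmetric] flip: indicator_inter_arith)
  have "(LINT x:A|lborel. f x) = 0" if "A \<in> sets lborel" for A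
  proof -
    have "sets borel = sigma_sets UNIV (range (\<lambda>(a, b). {a<..b::real}))"
      by (subst borel_sigma_sets_Ioc) simp
    with that have A: "A \<in> sigma_sets UNIV (range (\<lambda>(a, b). {a<..b::real}))" by simp
    have stable: "Int_stable (range (\<lambda>(a, b). {a<..b::real}))"
      by (auto simp: Int_stable_def)
    have sub: "range (\<lambda>(a, b). {a<..b::real}) \<subseteq> Pow UNIV" by simp
    have "A \<in> sets borel \<and> (LINT x:A|lborel. f x) = 0"
    proof (induction rule: sigma_sets_induct_disjoint[OF stable sub A, case_names
          basic empty compl union])
      case (compl A)
      have A: "integrable lborel (\<lambda>x. indicator A x * f x)"
        using integrable_mult_indicator[of A lborel f] f compl by simp
      have "(LINT x:UNIV - A|lborel. f x) = (\<integral>x. f x - indicator A x * f x \<partial>lborel)"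
        unfolding set_lebesgue_integral_def
        by (intro Bochner_Integration.integral_cong) (auto simp: indicator_def)
      also have "\<dots> = (LINT x|lborel. f x) - (LINT x:A|lborel. f x)"
        using f A by (simp add: set_lebesgue_integral_def)
      finally have "(LINT x:UNIV - A|lborel. f x) = (LINT x|lborel. f x) - (LINT x:A|lborel. f x)" .
      then show ?case using compl all by auto
    next
      case (union A)
      have "(LINT x:(\<Union>i. A i)|lborel. f x) = (\<Sum>i. (LINT x:(A i)|lborel. f x))"
        using union f
        by (intro lebesgue_integral_countable_add)
           (auto simp: disjoint_family_on_def set_integrable_def intro!: integrable_mult_indicator[where f = f, simplified])
      then show ?case using union by auto
    qed (use Ioc in \<open>auto simp: set_lebesgue_integral_def\<close>)
    then show ?thesis ..
  qed
  then have "AE x in lborel. f x = 0"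
    using f by (intro density_unique_real) (auto simp: set_lebesgue_integral_def)
  then show ?thesis by (rule AE_mp) (auto simp: f_def)
qed

text \<open>\<open>f\<close> is only a primitive of an integrable function, so there is no product
  rule at each point. Writing \<open>f x - f c\<close> as an integral and exchanging the order over
  the triangle \<open>y \<le> x\<close> leaves the integral of \<open>\<phi>'\<close> over
  \<open>{y..d}\<close>, which is \<open>- \<phi> y\<close> because
  \<open>\<phi> d = 0\<close>.\<close>

lemma integral_by_parts_primitive:
  fixes f w \<phi> \<phi>' :: "real \<Rightarrow> real"
  assumes "c \<le> d" and w: "set_integrable lborel {c..d} w"
    and f: "\<And>x. x \<in> {c..d} \<Longrightarrow> f x = f c + (LINT y:{c..x}|lborel. w y)"
    and \<phi>: "\<And>x. (\<phi> has_real_derivative \<phi>' x) (at x)" and cont: "continuous_on UNIV \<phi>'"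
    and "\<phi> c = 0" "\<phi> d = 0"
  shows "(LINT x:{c..d}|lborel. f x * \<phi>' x) = - (LINT x:{c..d}|lborel. w x * \<phi> x)"
proof -
  define W where "W = (\<lambda>y. indicator {c..d} y * w y)"
  have W: "integrable lborel W" using w by (simp add: set_integrable_def W_def)
  have [measurable]: "\<phi>' \<in> borel_measurable borel" "W \<in> borel_measurable borel"
      "W \<in> borel_measurable lborel"
    using borel_measurable_continuous_onI[OF cont] borel_measurable_integrable[OF W] by auto
  \<comment> \<open>The integrand on the triangle, with \<open>w\<close> cut off outside
    \<open>{c..d}\<close> so that both variables can range over the whole line.\<close>
  define H where "H x y = indicator {c..d} x * \<phi>' x * (if y \<le> x then W y else 0)" for x y
  have cont': "continuous_on {c..d} \<phi>'" using cont continuous_on_subset by blast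
  have \<phi>'int: "integrable lborel (\<lambda>x. indicator {c..d} x * \<phi>' x)"
    using borel_integrable_atLeastAtMost'[OF cont'] by (simp add: set_integrable_def)
  have [measurable]: "case_prod H \<in> borel_measurable (lborel \<Otimes>\<^sub>M lborel)"
    unfolding H_def by measurable
  have Wx: "integrable lborel (\<lambda>y. if y \<le> x then W y else 0)" for x
    using W by (rule Bochner_Integration.integrable_bound) auto
  have H: "integrable (lborel \<Otimes>\<^sub>M lborel) (case_prod H)"
  proof (rule lborel_pair.Fubini_integrable)
    show "integrable lborel (\<lambda>x. \<integral>y. norm (case_prod H (x, y)) \<partial>lborel)"
    proof (rule Bochner_Integration.integrable_bound)
      \<comment> \<open>For each \<open>x\<close> the inner integral is at most the full mass of
        \<open>\<bar>W\<bar>\<close>, which gives integrability on the product.\<close>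
      show "integrable lborel (\<lambda>x. indicator {c..d} x * \<phi>' x * (\<integral>y. \<bar>W y\<bar> \<partial>lborel))"
        using \<phi>'int by simp
      show "AE x in lborel. norm (\<integral>y. norm (case_prod H (x, y)) \<partial>lborel)
          \<le> norm (indicator {c..d} x * \<phi>' x * (\<integral>y. \<bar>W y\<bar> \<partial>lborel))"
      proof (intro AE_I2)
        fix x
        have "(\<integral>y. \<bar>if y \<le> x then W y else 0\<bar> \<partial>lborel) \<le> (\<integral>y. \<bar>W y\<bar> \<partial>lborel)"
          using W Wx by (intro integral_mono) auto
        then show "norm (\<integral>y. norm (case_prod H (x, y)) \<partial>lborel)
          \<le> norm (indicator {c..d} x * \<phi>' x * (\<integral>y. \<bar>W y\<bar> \<partial>lborel))"
          by (simp add: H_def abs_mult mult_left_mono)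
      qed
    qed measurable
    show "AE x in lborel. integrable lborel (\<lambda>y. case_prod H (x, y))"
      unfolding H_def using Wx by simp
  qed measurable
  have "(\<integral>x. indicator {c..d} x * \<phi>' x * f x \<partial>lborel)
      = (\<integral>x. indicator {c..d} x * \<phi>' x * f c + (\<integral>y. H x y \<partial>lborel) \<partial>lborel)"
  proof (rule Bochner_Integration.integral_cong[OF refl])
    fix x
    have "(\<integral>y. H x y \<partial>lborel) = indicator {c..d} x * \<phi>' x * (LINT y:{c..x}|lborel. w y)"
    proof (cases "x \<in> {c..d}")
      case True
      then have "(if y \<le> x then W y else 0) = indicator {c..x} y * w y" for y
        by (auto simp: W_def indicator_def)
      then show ?thesis by (simp add: H_def set_lebesgue_integral_def)
    qed (simp add: H_def)
    then show "indicator {c..d} x * \<phi>' x * f x = indicator {c..d} x * \<phi>' x * f c + (\<integral>y. H x y \<partial>lborel)"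
      using f[of x] by (cases "x \<in> {c..d}") (simp_all add: algebra_simps)
  qed
  also have "\<dots> = (\<integral>x. indicator {c..d} x * \<phi>' x * f c \<partial>lborel) + (\<integral>x. (\<integral>y. H x y \<partial>lborel) \<partial>lborel)"
    using \<phi>'int lborel_pair.integrable_fst[OF H] by (intro Bochner_Integration.integral_add) auto
  also have "(\<integral>x. (\<integral>y. H x y \<partial>lborel) \<partial>lborel) = (\<integral>y. (\<integral>x. H x y \<partial>lborel) \<partial>lborel)"
    using lborel_pair.integral_fst[OF H] lborel_pair.integral_snd[OF H] by simp
  also have "\<dots> = (\<integral>y. - (W y * \<phi> y) \<partial>lborel)"
  proof (rule Bochner_Integration.integral_cong[OF refl])
    fix y
    show "(\<integral>x. H x y \<partial>lborel) = - (W y * \<phi> y)"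
    proof (cases "y \<in> {c..d}")
      case True
      have "(\<integral>x. \<phi>' x * indicator {y..d} x \<partial>lborel) = \<phi> d - \<phi> y"
        using True \<phi> cont by (intro integral_FTC_Icc_real) (auto simp: continuous_on_eq_continuous_at)
      moreover have "H x y = W y * (\<phi>' x * indicator {y..d} x)" for x
        using True by (auto simp: H_def W_def indicator_def)
      ultimately show ?thesis using \<open>\<phi> d = 0\<close> by simp
    next
      case False
      then have "W y = 0" by (simp add: W_def)
      then show ?thesis by (simp add: H_def if_distrib cong: if_cong)
    qed
  qed
  \<comment> \<open>The constant contributes \<open>f c * (\<phi> d - \<phi> c)\<close>, and both
    ends vanish.\<close>
  also have "(\<integral>x. indicator {c..d} x * \<phi>' x * f c \<partial>lborel) = 0"
  proof -
    have "(\<integral>x. \<phi>' x * indicator {c..d} x \<partial>lborel) = \<phi> d - \<phi> c"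
      using \<open>c \<le> d\<close> \<phi> cont by (intro integral_FTC_Icc_real) (auto simp: continuous_on_eq_continuous_at)
    then show ?thesis using \<open>\<phi> c = 0\<close> \<open>\<phi> d = 0\<close> by (simp add: mult.commute)
  qed
  finally show ?thesis by (simp add: set_lebesgue_integral_def W_def mult_ac)
qed

section \<open>Weak derivatives and their slices\<close>

text \<open>The bridge between the definitions, which integrate against \<open>lebesgue_on\<close>,
  and the product and substitution arguments over \<open>lborel\<close>. The integrand has to be
  Borel on \<open>S\<close> only, its values outside being arbitrary; hence
  \<open>set_borel_measurable\<close>.\<close>

lemma
  fixes f :: "'a::euclidean_space \<Rightarrow> real"
  assumes S: "S \<in> sets borel" and f: "set_borel_measurable borel S f"
  shows borel_measurable_lebesgue_on: "f \<in> borel_measurable (lebesgue_on S)"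
    and integrable_lebesgue_on_iff: "integrable (lebesgue_on S) f \<longleftrightarrow> set_integrable lborel S f"
    and integral_lebesgue_on_eq: "(LINT x|lebesgue_on S. f x) = (LINT x:S|lborel. f x)"
proof -
  have f': "(\<lambda>x. indicator S x *\<^sub>R f x) \<in> borel_measurable lborel"
    using f by (simp add: set_borel_measurable_def)
  have S': "S \<inter> space lebesgue \<in> sets lebesgue" using S by auto
  show "f \<in> borel_measurable (lebesgue_on S)"
    using measurable_completion[OF f'] S' by (subst borel_measurable_restrict_space_iff) (auto simp: mult.commute)
  show "integrable (lebesgue_on S) f \<longleftrightarrow> set_integrable lborel S f"
    using S' f' by (simp add: integrable_restrict_space integrable_completion set_integrable_def)
  show "(LINT x|lebesgue_on S. f x) = (LINT x:S|lborel. f x)"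
    using S' f' by (simp add: integral_restrict_space integral_completion set_lebesgue_integral_def)
qed

lemma set_borel_measurable_if_continuous:
  fixes f :: "'a::topological_space \<Rightarrow> real"
  shows "S \<in> sets borel \<Longrightarrow> continuous_on S f \<Longrightarrow> set_borel_measurable borel S f"
  unfolding set_borel_measurable_def by (rule borel_measurable_continuous_on_indicator)

lemma Lp_1_iff: "f \<in> Lp M 1 \<longleftrightarrow> integrable M f"
  by (auto simp: Lp_def integrable_abs_iff)

lemma Lp_loc_1_iff: "f \<in> Lp_loc U 1 \<longleftrightarrow> (\<forall>K. compact K \<and> K \<subseteq> U \<longrightarrow> integrable (lebesgue_on K) f)"
  by (simp add: Lp_loc_def Lp_1_iff)

lemma continuous_imp_Lp_loc_1:
  fixes f :: "'a::euclidean_space \<Rightarrow> real"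
  assumes "continuous_on U f"
  shows "f \<in> Lp_loc U 1"
  unfolding Lp_loc_1_iff
proof safe
  fix K assume K: "compact K" "K \<subseteq> U"
  have "continuous_on K f" using K assms continuous_on_subset by blast
  moreover have "K \<in> sets borel" using K by (simp add: borel_compact)
  ultimately show "integrable (lebesgue_on K) f"
    using borel_integrable_compact[OF K(1), of f]
    by (subst integrable_lebesgue_on_iff) (auto simp: set_borel_measurable_def set_integrable_def
        intro: borel_measurable_continuous_on_indicator)
qed

text \<open>The factor is bounded on the compact set that carries it, so nothing is seen of
  \<open>f\<close> near the boundary of \<open>U\<close>. Continuity on \<open>K\<close> alone
  suffices, hence a continuous function times the indicator of \<open>K\<close> qualifies.\<close>

lemma
  fixes f \<psi> :: "'a::euclidean_space \<Rightarrow> real"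
  assumes f: "f \<in> Lp_loc U 1" and K: "compact K" "K \<subseteq> U" and U: "U \<in> sets borel"
    and \<psi>: "continuous_on K \<psi>" and 0: "\<And>x. x \<notin> K \<Longrightarrow> \<psi> x = 0"
  shows Lp_loc_mult_integrable: "integrable (lebesgue_on U) (\<lambda>x. f x * \<psi> x)"
    and Lp_loc_mult_integral: "(LINT x|lebesgue_on U. f x * \<psi> x) = (LINT x|lebesgue_on K. f x * \<psi> x)"
proof -
  have int: "integrable (lebesgue_on K) f" using f K by (simp add: Lp_loc_1_iff)
  have Kb: "K \<in> sets borel" using K by (simp add: borel_compact)
  have \<psi>m: "\<psi> \<in> borel_measurable (lebesgue_on K)"
    using borel_measurable_lebesgue_on[OF Kb set_borel_measurable_if_continuous[OF Kb \<psi>]] .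
  obtain B where B: "\<And>x. x \<in> K \<Longrightarrow> \<bar>\<psi> x\<bar> \<le> B"
    using compact_imp_bounded[OF compact_continuous_image[OF \<psi> K(1)]] by (auto simp: bounded_iff)
  have *: "integrable (lebesgue_on K) (\<lambda>x. f x * \<psi> x)"
  proof (rule Bochner_Integration.integrable_bound)
    show "integrable (lebesgue_on K) (\<lambda>x. B * f x)" using int by simp
    show "AE x in lebesgue_on K. norm (f x * \<psi> x) \<le> norm (B * f x)"
    proof (intro AE_I2)
      fix x assume "x \<in> space (lebesgue_on K)"
      then have "\<bar>\<psi> x\<bar> \<le> \<bar>B\<bar>" using B[of x] by (simp add: space_restrict_space)
      then show "norm (f x * \<psi> x) \<le> norm (B * f x)"
        by (simp add: abs_mult mult.commute[of "\<bar>f x\<bar>"] mult_right_mono)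
    qed
  qed (use \<psi>m int in measurable)
  have eq: "indicator U x *\<^sub>R (f x * \<psi> x) = indicator K x *\<^sub>R (f x * \<psi> x)" for x
    using 0[of x] K by (auto simp: indicator_def)
  show "integrable (lebesgue_on U) (\<lambda>x. f x * \<psi> x)"
    using * U Kb by (simp add: integrable_restrict_space eq del: real_scaleR_def)
  show "(LINT x|lebesgue_on U. f x * \<psi> x) = (LINT x|lebesgue_on K. f x * \<psi> x)"
    using U Kb by (simp add: integral_restrict_space eq del: real_scaleR_def)
qed

lemma
  assumes f: "f \<in> Lp_loc U 1" and \<phi>: "\<phi> \<in> Cc_inf U" and U: "U \<in> sets borel"
  shows Lp_loc_test_integrable: "integrable (lebesgue_on U) (\<lambda>x. f x * \<phi> x)"
    and Lp_loc_test_pd_integrable: "i \<in> Basis \<Longrightarrow> integrable (lebesgue_on U) (\<lambda>x. f x * pd i \<phi> x)"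
  using Lp_loc_mult_integrable[OF f Cc_inf_supp[OF \<phi>] U]
    Cc_inf_continuous[OF \<phi>] Cc_inf_pd_continuous[OF \<phi>] Cc_inf_eq_0[OF \<phi>] Cc_inf_pd_eq_0[OF \<phi>]
  by blast+

lemma compact_subset_greaterThan:
  fixes K :: "real set"
  assumes "compact K" "K \<subseteq> {l<..}"
  obtains c d where "l < c" "c < d" "K \<subseteq> {c<..<d}"
proof (cases "K = {}")
  case True
  then show ?thesis using that[of "l + 1" "l + 2"] by auto
next
  case False
  obtain a where a: "a \<in> K" "\<And>x. x \<in> K \<Longrightarrow> a \<le> x" using compact_attains_inf[OF assms(1) False] by blast
  obtain b where b: "b \<in> K" "\<And>x. x \<in> K \<Longrightarrow> x \<le> b" using compact_attains_sup[OF assms(1) False] by blast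
  have "l < a" using a assms by auto
  have "a \<le> b" using a b by simp
  show ?thesis
  \<comment> \<open>\<open>a\<close> is the minimum of \<open>K\<close> and exceeds
    \<open>l\<close>, so the midpoint lies strictly between the two.\<close>
  proof (rule that[of "(l + a) / 2" "b + 1"])
    show "K \<subseteq> {(l + a) / 2<..<b + 1}" using a(2) b(2) \<open>l < a\<close> by fastforce
  qed (use \<open>l < a\<close> \<open>a \<le> b\<close> in auto)
qed

text \<open>The support of a test function is compact in \<open>{l<..}\<close> and so lies inside
  some \<open>{c<..<d}\<close> with \<open>l < c\<close>; integration by parts on
  \<open>{c..d}\<close> then has no boundary terms, whatever \<open>f\<close> does near
  \<open>l\<close> or at infinity.\<close>

lemma has_wpd_if_primitive:
  fixes f w :: "real \<Rightarrow> real"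
  assumes f: "continuous_on {l<..} f" and w: "set_borel_measurable borel {l<..} w"
    and int: "\<And>c d. l < c \<Longrightarrow> c < d \<Longrightarrow> set_integrable lborel {c..d} w"
    and prim: "\<And>c d. l < c \<Longrightarrow> c < d \<Longrightarrow> f d - f c = (LINT x:{c..d}|lborel. w x)"
  shows "has_wpd 1 {l<..} f w"
  unfolding has_wpd_def
proof (intro conjI ballI)
  have wm: "set_borel_measurable borel K w" if "K \<in> sets borel" "K \<subseteq> {l<..}" for K
    using set_borel_measurable_subset[of borel "{l<..}" w K] w that by simp
  have wloc: "set_integrable lborel K w" if K: "compact K" "K \<subseteq> {l<..}" for K
  proof -
    obtain c d where cd: "l < c" "c < d" "K \<subseteq> {c<..<d}" using compact_subset_greaterThan[OF K] .
    show ?thesis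
      by (rule set_integrable_subset[OF int[OF cd(1,2)]])
         (use cd(3) K in \<open>auto simp: borel_compact\<close>)
  qed
  show wL: "w \<in> Lp_loc {l<..} 1"
    unfolding Lp_loc_1_iff
    using wloc wm by (auto simp: integrable_lebesgue_on_iff borel_compact)
  show fL: "f \<in> Lp_loc {l<..} 1" by (rule continuous_imp_Lp_loc_1[OF f])
  fix \<phi> :: "real \<Rightarrow> real" assume \<phi>: "\<phi> \<in> Cc_inf {l<..}"
  obtain c d where cd: "l < c" "c < d" "supp \<phi> \<subseteq> {c<..<d}"
    using compact_subset_greaterThan[OF Cc_inf_supp[OF \<phi>]] .
  have out: "\<phi> x = 0" "pd 1 \<phi> x = 0" if "x \<notin> {c<..<d}" for x
    using that cd Cc_inf_eq_0[OF \<phi>] Cc_inf_pd_eq_0[OF \<phi>] by blast+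
  have sub: "{c..d} \<subseteq> {l<..}" using cd by auto
  have fc: "set_borel_measurable borel {c..d} f"
    using f sub unfolding set_borel_measurable_def
    by (intro borel_measurable_continuous_on_indicator) (auto intro: continuous_on_subset)
  have mult: "set_borel_measurable borel {c..d} (\<lambda>x. h x * \<psi> x)"
    if "set_borel_measurable borel {c..d} h" "continuous_on UNIV \<psi>" for h \<psi> :: "real \<Rightarrow> real"
    using that borel_measurable_continuous_onI[OF that(2)]
    unfolding set_borel_measurable_def by (auto simp: mult.assoc[symmetric] simp del: mult.assoc)
  have "(LINT x|lebesgue_on {l<..}. f x * pd 1 \<phi> x) = (LINT x|lebesgue_on {c..d}. f x * pd 1 \<phi> x)"
    using fL sub Cc_inf_pd_continuous[OF \<phi>] out by (intro Lp_loc_mult_integral) auto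
  also have "\<dots> = (LINT x:{c..d}|lborel. f x * pd 1 \<phi> x)"
    using mult[OF fc] Cc_inf_pd_continuous[OF \<phi>, of 1] by (intro integral_lebesgue_on_eq) auto
  also have "\<dots> = - (LINT x:{c..d}|lborel. w x * \<phi> x)"
  proof (rule integral_by_parts_primitive)
    show "f x = f c + (LINT y:{c..x}|lborel. w y)" if "x \<in> {c..d}" for x
    \<comment> \<open>\<open>prim\<close> speaks of nondegenerate intervals; at \<open>x = c\<close>
      the interval is a null set.\<close>
    proof (cases "x = c")
      case True
      have "(LINT y:{c..c}|lborel. w y) = 0"
        unfolding set_lebesgue_integral_def
        by (rule integral_eq_zero_AE, rule AE_I[where N = "{c}"]) (auto simp: indicator_def)
      then show ?thesis using True by simp
    qed (use prim[OF cd(1), of x] that in auto)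
  qed (use cd int out Cc_inf_real_derivative[OF \<phi>] Cc_inf_pd_continuous[OF \<phi>] in auto)
  also have "(LINT x:{c..d}|lborel. w x * \<phi> x) = (LINT x|lebesgue_on {c..d}. w x * \<phi> x)"
    using mult[OF wm[OF _ sub]] Cc_inf_continuous[OF \<phi>] by (intro integral_lebesgue_on_eq[symmetric]) auto
  also have "\<dots> = (LINT x|lebesgue_on {l<..}. w x * \<phi> x)"
    using wL sub Cc_inf_continuous[OF \<phi>] out by (intro Lp_loc_mult_integral[symmetric]) auto
  finally show "(LINT x|lebesgue_on {l<..}. f x * pd 1 \<phi> x) = - (LINT x|lebesgue_on {l<..}. w x * \<phi> x)" .
qed

text \<open>Fubini: for almost every \<open>t\<close> the inner integral of the tested combination
  vanishes, since a slice of a test function is a test function. Local integrability on the product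
  does not follow from the slices and is assumed separately.\<close>

lemma has_wpd_if_slices:
  fixes F D :: "real \<times> real \<Rightarrow> real"
  assumes A: "A \<in> sets borel" and B: "B \<in> sets borel"
    and F: "F \<in> Lp_loc (A \<times> B) 1" "set_borel_measurable borel (A \<times> B) F"
    and D: "D \<in> Lp_loc (A \<times> B) 1" "set_borel_measurable borel (A \<times> B) D"
    and slice: "AE t in lborel. t \<in> A \<longrightarrow> has_wpd 1 B (\<lambda>x. F (t, x)) (\<lambda>x. D (t, x))"
  shows "has_wpd (0, 1) (A \<times> B) F D"
  unfolding has_wpd_def
proof (intro conjI ballI F D)
  fix \<phi> :: "real \<times> real \<Rightarrow> real" assume \<phi>: "\<phi> \<in> Cc_inf (A \<times> B)"
  have AB: "A \<times> B \<in> sets borel" using A B by (simp add: borel_Times)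
  have b: "(0, 1) \<in> (Basis :: (real \<times> real) set)" by (auto simp: Basis_prod_def)
  note int = Lp_loc_test_pd_integrable[OF F(1) \<phi> AB b] Lp_loc_test_integrable[OF D(1) \<phi> AB]
  \<comment> \<open>Both integrands are joined into one, so that Fubini is applied once and to a
    function whose slice integrals are zero.\<close>
  define G where "G = (\<lambda>z. F z * pd (0, 1) \<phi> z + D z * \<phi> z)"
  have G: "integrable (lebesgue_on (A \<times> B)) G" unfolding G_def using int by simp
  have Gm: "set_borel_measurable borel (A \<times> B) G"
    using F(2) D(2) borel_measurable_continuous_onI[OF Cc_inf_continuous[OF \<phi>]]
      borel_measurable_continuous_onI[OF Cc_inf_pd_continuous[OF \<phi> b]]
    unfolding set_borel_measurable_def G_def
    by (auto simp: distrib_left mult.assoc[symmetric] simp del: mult.assoc)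
  have Gi: "integrable (lborel \<Otimes>\<^sub>M lborel) (\<lambda>z. indicator (A \<times> B) z * G z)"
    using G integrable_lebesgue_on_iff[OF AB Gm] by (simp add: set_integrable_def lborel_prod)
  have "(LINT z|lebesgue_on (A \<times> B). G z) = (\<integral>z. indicator (A \<times> B) z * G z \<partial>(lborel \<Otimes>\<^sub>M lborel))"
    using integral_lebesgue_on_eq[OF AB Gm] by (simp add: set_lebesgue_integral_def lborel_prod)
  also have "\<dots> = (\<integral>t. (\<integral>x. indicator (A \<times> B) (t, x) * G (t, x) \<partial>lborel) \<partial>lborel)"
    using lborel_pair.integral_fst'[OF Gi] by simp
  also have "\<dots> = (\<integral>t. 0 \<partial>(lborel :: real measure))"
  proof (rule integral_cong_AE)
    show "(\<lambda>t. \<integral>x. indicator (A \<times> B) (t, x) * G (t, x) \<partial>lborel) \<in> borel_measurable lborel"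
      using lborel_pair.integrable_fst'[OF Gi] by simp
    show "AE t in lborel. (\<integral>x. indicator (A \<times> B) (t, x) * G (t, x) \<partial>lborel) = 0"
      using slice
    proof eventually_elim
      case (elim t)
      show ?case
      proof (cases "t \<in> A")
        case True
        with elim have w: "has_wpd 1 B (\<lambda>x. F (t, x)) (\<lambda>x. D (t, x))" by simp
        define \<psi> where "\<psi> = (\<lambda>x. \<phi> (t, x))"
        have \<psi>: "\<psi> \<in> Cc_inf B" "\<And>x. pd 1 \<psi> x = pd (0, 1) \<phi> (t, x)"
          unfolding \<psi>_def by (rule Cc_inf_slice[OF \<phi>])+
        have Gt: "set_borel_measurable borel B (\<lambda>x. G (t, x))"
        proof -
          have "(\<lambda>x. indicator (A \<times> B) (t, x) * G (t, x)) \<in> borel_measurable borel"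
            using Gm unfolding set_borel_measurable_def
            by (intro measurable_compose[OF borel_measurable_continuous_onI[of "Pair t"]]) (auto intro: continuous_intros)
          then show ?thesis using True by (simp add: set_borel_measurable_def indicator_times)
        qed
        have "(\<integral>x. indicator (A \<times> B) (t, x) * G (t, x) \<partial>lborel) = (LINT x|lebesgue_on B. G (t, x))"
          using True integral_lebesgue_on_eq[OF B Gt] by (simp add: set_lebesgue_integral_def indicator_times)
        also have "\<dots> = (LINT x|lebesgue_on B. F (t, x) * pd 1 \<psi> x) + (LINT x|lebesgue_on B. D (t, x) * \<psi> x)"
          unfolding G_def \<psi>(2)[symmetric] using w Lp_loc_test_pd_integrable[OF _ \<psi>(1) B, of _ 1]
            Lp_loc_test_integrable[OF _ \<psi>(1) B]
          by (subst Bochner_Integration.integral_add[symmetric]) (auto simp: has_wpd_def \<psi>_def)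
        also have "\<dots> = 0" using w \<psi>(1) by (simp add: has_wpd_def)
        finally show ?thesis .
      qed (simp add: indicator_times)
    qed
  qed simp
  finally have "(LINT z|lebesgue_on (A \<times> B). G z) = 0" by simp
  then show "(LINT z|lebesgue_on (A \<times> B). F z * pd (0, 1) \<phi> z) = - (LINT z|lebesgue_on (A \<times> B). D z * \<phi> z)"
    unfolding G_def using int by simp
qed

section \<open>Smooth cutoffs of half-open intervals and their limits\<close>

locale smooth_step =
  fixes S s :: "real \<Rightarrow> real"
  assumes Ck_S: "Ck n S"
    and S_deriv: "(S has_real_derivative s x) (at x)"
    and s_cont: "continuous_on UNIV s"
    and s_nonneg: "0 \<le> s x"
    and s_eq_0: "x \<notin> {0..1} \<Longrightarrow> s x = 0"
    and S_eq_0: "x \<le> 0 \<Longrightarrow> S x = 0"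
    and S_eq_1: "1 \<le> x \<Longrightarrow> S x = 1"
begin

lemma S_bounds: "0 \<le> S x" "S x \<le> 1"
proof -
  have mono: "S x \<le> S y" if "x \<le> y" for x y
  proof (rule DERIV_nonneg_imp_nondecreasing[OF that])
    show "\<exists>d. (S has_real_derivative d) (at z) \<and> 0 \<le> d" for z
      using S_deriv[of z] s_nonneg[of z] by blast
  qed
  show "0 \<le> S x" using mono[of "min 0 x" x] S_eq_0[of "min 0 x"] by simp
  show "S x \<le> 1" using mono[of x "max 1 x"] S_eq_1[of "max 1 x"] by simp
qed

text \<open>Each step is 0 up to its node and reaches 1 at distance \<open>1 / real (Suc m)\<close>
  to the right of it. This one-sided placement produces the half-open limit \<open>{a<..b}\<close>
  and the overshoot of the support beyond \<open>b\<close>; \<open>Suc m\<close> keeps the scale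
  positive at \<open>m = 0\<close>.\<close>

definition cut :: "nat \<Rightarrow> real \<Rightarrow> real \<Rightarrow> real \<Rightarrow> real" where
  "cut m a b x = S (real (Suc m) * (x - a)) - S (real (Suc m) * (x - b))"

definition cut' :: "nat \<Rightarrow> real \<Rightarrow> real \<Rightarrow> real \<Rightarrow> real" where
  "cut' m a b x = real (Suc m) * s (real (Suc m) * (x - a)) - real (Suc m) * s (real (Suc m) * (x - b))"

lemma cut_deriv: "(cut m a b has_real_derivative cut' m a b x) (at x)"
proof -
  have *: "((\<lambda>x. S (k * (x - c))) has_real_derivative k * s (k * (x - c))) (at x)" for k c
  proof -
    have "((\<lambda>x. k * (x - c)) has_real_derivative k) (at x)" by (auto intro!: derivative_eq_intros)
    from DERIV_chain2[OF S_deriv this] show ?thesis by (simp add: mult.commute)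
  qed
  show ?thesis unfolding cut_def cut'_def by (intro DERIV_diff *)
qed

lemma cut_abs: "\<bar>cut m a b x\<bar> \<le> 1"
  unfolding cut_def using S_bounds[of "real (Suc m) * (x - a)"] S_bounds[of "real (Suc m) * (x - b)"]
  by linarith

lemma cut_eq_0: "a < b \<Longrightarrow> x \<notin> {a..b + 1 / real (Suc m)} \<Longrightarrow> cut m a b x = 0"
proof -
  assume "a < b" and x: "x \<notin> {a..b + 1 / real (Suc m)}"
  consider "x < a" | "b + 1 / real (Suc m) < x" using x by force
  then show ?thesis
  proof cases
    case 1
    then show ?thesis using \<open>a < b\<close> by (simp add: cut_def S_eq_0 mult_nonneg_nonpos)
  next
    case 2
    then have "1 \<le> real (Suc m) * (x - b)" by (simp add: field_simps)
    moreover from this have "1 \<le> real (Suc m) * (x - a)"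
      using \<open>a < b\<close> by (smt (verit) mult_left_mono of_nat_0_le_iff)
    ultimately show ?thesis by (simp add: cut_def S_eq_1)
  qed
qed

lemma cut_tendsto:
  assumes "a < b"
  shows "(\<lambda>m. cut m a b x) \<longlonglongrightarrow> indicator {a<..b} x"
proof -
  have *: "(\<lambda>m. S (real (Suc m) * (x - c))) \<longlonglongrightarrow> (if c < x then 1 else 0)" for c
  proof (cases "c < x")
    case True
    \<comment> \<open>From \<open>N\<close> on the argument is at least 1 and the step is saturated,
      so the sequence is eventually constant.\<close>
    obtain N where N: "1 / (x - c) < real N" using reals_Archimedean2 by blast
    have "S (real (Suc m) * (x - c)) = 1" if "N \<le> m" for m
    proof (rule S_eq_1)
      have "1 < real N * (x - c)" using N True by (simp add: field_simps)
      also have "\<dots> \<le> real (Suc m) * (x - c)" using that True by (intro mult_right_mono) auto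
      finally show "1 \<le> real (Suc m) * (x - c)" by simp
    qed
    then have "\<forall>\<^sub>F m in sequentially. S (real (Suc m) * (x - c)) = 1"
      by (auto simp: eventually_sequentially)
    from tendsto_eventually[OF this] show ?thesis using True by simp
  qed (simp add: S_eq_0 mult_nonneg_nonpos)
  show ?thesis
    using tendsto_diff[OF *[of a] *[of b]] assms unfolding cut_def by (auto simp: indicator_def split: if_splits)
qed

lemma Ck_cut: "Ck n (cut m a b)"
proof -
  have "cut m a b = (\<lambda>x. S (real (Suc m) \<bullet> x + (- real (Suc m) * a)) + (-1) * S (real (Suc m) \<bullet> x + (- real (Suc m) * b)))"
    by (auto simp: cut_def algebra_simps)
  then show ?thesis by (simp only:) (intro Ck_add Ck_mult Ck_const Ck_affine Ck_S)
qed

lemma supp_cut: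
  assumes "a < b"
  shows "supp (cut m a b) \<subseteq> {a..b + 1 / real (Suc m)}"
  unfolding supp_def using cut_eq_0[OF assms] by (intro closure_minimal) blast+

lemma cut_Cc_inf:
  assumes "a < b" "{a..b + 1 / real (Suc m)} \<subseteq> U"
  shows "cut m a b \<in> Cc_inf U"
proof -
  have "compact (supp (cut m a b))"
    using supp_cut[OF assms(1)] bounded_subset[OF bounded_closed_interval]
    by (metis closed_closure compact_eq_bounded_closed supp_def)
  then show ?thesis using supp_cut[OF assms(1)] assms(2) Ck_cut by (auto simp: Cc_inf_def)
qed

lemma cut_product_Cc_inf:
  fixes \<psi> :: "real \<Rightarrow> real"
  assumes ab: "a < b" "{a..b + 1 / real (Suc m)} \<subseteq> A" and \<psi>: "\<psi> \<in> Cc_inf B"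
  shows "(\<lambda>z. cut m a b (fst z) * \<psi> (snd z)) \<in> Cc_inf (A \<times> B)"
    and "pd (0, 1) (\<lambda>z. cut m a b (fst z) * \<psi> (snd z)) (t, x) = cut m a b t * pd 1 \<psi> x"
proof -
  define \<phi> where "\<phi> = (\<lambda>z. cut m a b (fst z) * \<psi> (snd z))"
  have Ck: "Ck n \<phi>" for n
  proof -
    have "Ck n \<psi>" using \<psi> by (simp add: Cc_inf_def)
    then have "Ck n (\<lambda>z. cut m a b ((1::real, 0::real) \<bullet> z + 0) * \<psi> ((0::real, 1::real) \<bullet> z + 0))"
      by (intro Ck_mult Ck_affine Ck_cut)
    then show ?thesis by (simp add: \<phi>_def inner_prod_def inner_real_def)
  qed
  have closed: "closed ({a..b + 1 / real (Suc m)} \<times> supp \<psi>)"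
    by (intro closed_Times) (auto simp: supp_def)
  have sub: "supp \<phi> \<subseteq> {a..b + 1 / real (Suc m)} \<times> supp \<psi>"
    unfolding supp_def[of \<phi>]
  proof (intro closure_minimal closed subsetI)
    fix z assume "z \<in> {z. \<phi> z \<noteq> 0}"
    then have "cut m a b (fst z) \<noteq> 0" "\<psi> (snd z) \<noteq> 0" by (auto simp: \<phi>_def)
    then show "z \<in> {a..b + 1 / real (Suc m)} \<times> supp \<psi>"
      using cut_eq_0[OF ab(1)] Cc_inf_eq_0[OF \<psi>] by (metis mem_Times_iff)
  qed
  have "compact ({a..b + 1 / real (Suc m)} \<times> supp \<psi>)"
    using Cc_inf_supp(1)[OF \<psi>] by (intro compact_Times) auto
  then have "compact (supp \<phi>)"
    using compact_Int_closed[OF _ closed_closure, of _ "{z. \<phi> z \<noteq> 0}"] sub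
    by (metis Int_absorb1 supp_def)
  then show \<phi>: "(\<lambda>z. cut m a b (fst z) * \<psi> (snd z)) \<in> Cc_inf (A \<times> B)"
    using Ck sub ab(2) Cc_inf_supp(2)[OF \<psi>] unfolding \<phi>_def[symmetric] Cc_inf_def by blast
  show "pd (0, 1) (\<lambda>z. cut m a b (fst z) * \<psi> (snd z)) (t, x) = cut m a b t * pd 1 \<psi> x"
    using Cc_inf_slice(2)[OF \<phi>, of t x] pd_real_eq[OF DERIV_cmult[OF Cc_inf_real_derivative[OF \<psi>], of "cut m a b t" x]]
    by simp
qed

text \<open>\<open>s\<close> has integral one, so the rescaled kernels form an approximate identity
  on the right of \<open>a\<close>. In the variable \<open>y = real (Suc m) * (x - a)\<close> the
  kernel is fixed and only the argument \<open>a + y / real (Suc m)\<close> of \<open>f\<close>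
  moves, towards \<open>a\<close>.\<close>

lemma concentration:
  fixes f :: "real \<Rightarrow> real"
  assumes f: "continuous_on {l<..} f" and a: "l < a"
  shows "integrable lborel (\<lambda>x. indicator {l<..} x * f x * (real (Suc m) * s (real (Suc m) * (x - a))))"
    and "(\<lambda>m. \<integral>x. indicator {l<..} x * f x * (real (Suc m) * s (real (Suc m) * (x - a))) \<partial>lborel) \<longlonglongrightarrow> f a"
proof -
  define g where "g = (\<lambda>x. indicator {l<..} x * f x)"
  have [measurable]: "g \<in> borel_measurable borel" "s \<in> borel_measurable borel"
    using borel_measurable_continuous_on_indicator[OF _ f] borel_measurable_continuous_onI[OF s_cont]
    by (auto simp: g_def)
  have "continuous_on {a..a + 1} f" using f a by (elim continuous_on_subset) auto
  then have "bounded (f ` {a..a + 1})"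
    by (intro compact_imp_bounded compact_continuous_image) auto
  then obtain B where "\<forall>y\<in>f ` {a..a + 1}. norm y \<le> B" unfolding bounded_iff by blast
  then have B: "\<And>x. x \<in> {a..a + 1} \<Longrightarrow> \<bar>f x\<bar> \<le> B" by auto
  have s_int: "integrable lborel s" and s_int1: "(\<integral>x. s x \<partial>lborel) = 1"
  proof -
    have eq: "s x * indicator {0..1} x = s x" for x using s_eq_0[of x] by (auto simp: indicator_def)
    have "continuous_on {0..1} s" using s_cont continuous_on_subset by blast
    from borel_integrable_atLeastAtMost'[OF this] show "integrable lborel s"
      by (simp add: set_integrable_def mult.commute[of "indicator _ _"] eq)
    have "(\<integral>x. s x * indicator {0..1} x \<partial>lborel) = S 1 - S 0"
      using S_deriv s_cont by (intro integral_FTC_Icc_real) (auto simp: continuous_on_eq_continuous_at)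
    then show "(\<integral>x. s x \<partial>lborel) = 1" using S_eq_0[of 0] S_eq_1[of 1] by (simp add: eq)
  qed
  \<comment> \<open>For \<open>y\<close> in [0,1] the argument never leaves
    \<open>{a..a + 1}\<close>, which makes the bound independent of \<open>m\<close>.\<close>
  have dom: "norm (g (a + y / real (Suc m)) * s y) \<le> B * s y" for y m
  proof (cases "y \<in> {0..1}")
    case True
    then have "y / real (Suc m) \<le> 1" by (simp add: field_simps)
    then have "a + y / real (Suc m) \<in> {a..a + 1}" using True by simp
    from B[OF this] have "\<bar>g (a + y / real (Suc m))\<bar> \<le> B"
      using order_trans[OF abs_ge_zero B[of a]] by (auto simp: g_def indicator_def)
    then show ?thesis using s_nonneg[of y] by (simp add: abs_mult mult_right_mono)
  qed (simp add: s_eq_0)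
  have int: "integrable lborel (\<lambda>y. g (a + y / real (Suc m)) * s y)" for m
    by (rule Bochner_Integration.integrable_bound[of _ "\<lambda>y. B * s y"])
       (use s_int dom in \<open>auto intro: order_trans[OF _ abs_ge_self]\<close>)
  have M: "real (Suc m) * (a + 1 / real (Suc m) * y - a) = y" for m y by (simp add: field_simps)
  have "integrable lborel (\<lambda>x. g x * (real (Suc m) * s (real (Suc m) * (x - a))))"
  proof (subst lborel_integrable_real_affine_iff[symmetric, of "1 / real (Suc m)" _ a])
    show "integrable lborel (\<lambda>x. g (a + 1 / real (Suc m) * x) *
        (real (Suc m) * s (real (Suc m) * (a + 1 / real (Suc m) * x - a))))"
      using integrable_mult_right[OF int[of m], of "real (Suc m)"] unfolding M by (simp add: mult_ac)
  qed simp
  then show "integrable lborel (\<lambda>x. indicator {l<..} x * f x * (real (Suc m) * s (real (Suc m) * (x - a))))"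
    by (simp add: g_def)
  have eq: "(\<integral>x. g x * (real (Suc m) * s (real (Suc m) * (x - a))) \<partial>lborel)
      = (\<integral>y. g (a + y / real (Suc m)) * s y \<partial>lborel)" for m
  proof -
    have "(\<integral>x. g x * (real (Suc m) * s (real (Suc m) * (x - a))) \<partial>lborel)
      = \<bar>1 / real (Suc m)\<bar> *\<^sub>R (\<integral>y. g (a + 1 / real (Suc m) * y) *
          (real (Suc m) * s (real (Suc m) * (a + 1 / real (Suc m) * y - a))) \<partial>lborel)"
      by (rule lborel_integral_real_affine) simp
    also have "\<dots> = (\<integral>y. \<bar>1 / real (Suc m)\<bar> * (g (a + 1 / real (Suc m) * y) * (real (Suc m) * s y)) \<partial>lborel)"
      unfolding M real_scaleR_def by (rule integral_mult_right_zero[symmetric])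
    also have "\<dots> = (\<integral>y. g (a + y / real (Suc m)) * s y \<partial>lborel)"
      by (intro Bochner_Integration.integral_cong) (auto simp: field_simps)
    finally show ?thesis .
  qed
  have "(\<lambda>m. \<integral>y. g (a + y / real (Suc m)) * s y \<partial>lborel) \<longlonglongrightarrow> (\<integral>y. f a * s y \<partial>lborel)"
  proof (rule integral_dominated_convergence[where w = "\<lambda>y. B * s y"])
    show "AE y in lborel. (\<lambda>m. g (a + y / real (Suc m)) * s y) \<longlonglongrightarrow> f a * s y"
    proof (intro AE_I2 tendsto_intros)
      fix y
      have "(\<lambda>m. y / real (Suc m)) \<longlonglongrightarrow> 0"
        using LIMSEQ_Suc[OF lim_const_over_n[of y]] by simp
      from tendsto_add[OF tendsto_const[of a] this] have lim: "(\<lambda>m. a + y / real (Suc m)) \<longlonglongrightarrow> a" by simp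
      have ev: "\<forall>\<^sub>F x in nhds a. x \<in> {l<..}" using a by (intro eventually_nhds_in_open) auto
      have "isCont f a" using f a by (simp add: continuous_on_eq_continuous_at)
      moreover from ev have "\<forall>\<^sub>F x in nhds a. f x = g x"
        by eventually_elim (simp add: g_def)
      ultimately have "isCont g a" using isCont_cong by blast
      moreover have "g a = f a" using a by (simp add: g_def)
      ultimately show "(\<lambda>m. g (a + y / real (Suc m))) \<longlonglongrightarrow> f a"
        using isCont_tendsto_compose lim by metis
    qed
  qed (use s_int dom in auto)
  then show "(\<lambda>m. \<integral>x. indicator {l<..} x * f x * (real (Suc m) * s (real (Suc m) * (x - a))) \<partial>lborel) \<longlonglongrightarrow> f a"
    using eq s_int1 by (simp add: g_def)
qed

end

lemma set_lborel_integral_Ioc_eq_Icc: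
  fixes w :: "real \<Rightarrow> real"
  assumes "set_borel_measurable borel {a..b} w"
  shows "(LINT x:{a<..b}|lborel. w x) = (LINT x:{a..b}|lborel. w x)"
proof -
  define h where "h = (\<lambda>x. indicator {a..b} x * w x)"
  have [measurable]: "h \<in> borel_measurable borel"
    using assms by (simp add: h_def set_borel_measurable_def)
  have eq: "indicator {a<..b} x *\<^sub>R w x = indicator {a<..b} x * h x" for x
    by (auto simp: h_def indicator_def)
  show ?thesis
    unfolding set_lebesgue_integral_def eq
  proof (rule integral_cong_AE)
    show "AE x in lborel. indicator {a<..b} x * h x = indicator {a..b} x *\<^sub>R w x"
      by (rule AE_I[where N = "{a}"]) (auto simp: h_def indicator_def)
  qed (use assms in \<open>auto simp: set_borel_measurable_def\<close>)
qed

text \<open>Both sides depend continuously on the endpoints, so equality at rational endpoints,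
  which is all that a countable family of test functions can provide, extends by density.\<close>

lemma primitive_if_rational:
  fixes f w :: "real \<Rightarrow> real"
  assumes f: "continuous_on {l<..} f"
    and int: "\<And>c d. l < c \<Longrightarrow> c < d \<Longrightarrow> set_integrable lborel {c..d} w"
    and rat: "\<And>c d. l < c \<Longrightarrow> c < d \<Longrightarrow> c \<in> \<rat> \<Longrightarrow> d \<in> \<rat> \<Longrightarrow> f d - f c = (LINT x:{c..d}|lborel. w x)"
    and cd: "l < c" "c < d"
  shows "f d - f c = (LINT x:{c..d}|lborel. w x)"
proof -
  \<comment> \<open>\<open>H\<close> is based at a rational \<open>p\<close> below \<open>c\<close>
    and watched up to some \<open>q\<close> above \<open>d\<close>, so that \<open>c\<close> and
    \<open>d\<close> are interior points; the identity for \<open>{c..d}\<close> is then a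
    difference of two.\<close>
  obtain p where p: "p \<in> \<rat>" "l < p" "p < c" using Rats_dense_in_real cd by blast
  obtain q where q: "q \<in> \<rat>" "d < q" using Rats_dense_in_real[of d "d + 1"] by auto
  define H where "H x = f x - f p - integral {p..x} w" for x
  have int': "w integrable_on {x..y}" "(LINT z:{x..y}|lborel. w z) = integral {x..y} w" if "l < x" "x < y" for x y
    using set_borel_integral_eq_integral[OF int[OF that]] by auto
  have "continuous_on {p..q} (\<lambda>x. integral {p..x} w)"
    using int'[of p q] p q cd by (intro indefinite_integral_continuous_1) auto
  moreover have "continuous_on {p..q} f" using f p by (elim continuous_on_subset) auto
  ultimately have H: "continuous_on {p..q} H" unfolding H_def by (intro continuous_intros)
  have 0: "H x = 0" if "x \<in> {p<..<q} \<inter> \<rat>" for x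
    using that rat[of p x] int'(2)[of p x] p by (auto simp: H_def)
  have sub: "{p<..<q} \<subseteq> closure ({p<..<q} \<inter> \<rat>)"
    using open_Int_closure_subset[of "{p<..<q}" "\<rat>"] by (simp add: Rats_closure_real)
  have "closure ({p<..<q} \<inter> \<rat>) \<subseteq> {p..q}" by (intro closure_minimal) auto
  from continuous_on_subset[OF H this]
  have "H x = 0" if "x \<in> {p<..<q}" for x
    using continuous_constant_on_closure[of "{p<..<q} \<inter> \<rat>" H 0 x] 0 sub that by blast
  from this[of c] this[of d] have "f d - f c = integral {p..d} w - integral {p..c} w"
    using p q cd by (simp add: H_def)
  also have "\<dots> = integral {c..d} w"
    using Henstock_Kurzweil_Integration.integral_combine[of p c d w] int'(1)[of p d] p cd by simp
  finally show ?thesis using int'(2)[OF cd] by simp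
qed

section \<open>Disintegration of the weak derivative in time\<close>

context smooth_step
begin

text \<open>The derivative of the cutoff is a kernel at \<open>p\<close> minus a kernel at
  \<open>q\<close>, so the tested identity tends to \<open>f p - f q\<close> plus the integral of
  \<open>w\<close> over \<open>{p<..q}\<close>. Integrability up to \<open>q + 1\<close> leaves room
  for the overshoot of every cutoff and yields one dominating function for all
  \<open>m\<close>.\<close>

lemma primitive_if_cut:
  fixes f w :: "real \<Rightarrow> real"
  assumes f: "continuous_on {0<..} f" and w: "set_integrable lborel {p..q + 1} w"
    and pq: "0 < p" "p < q"
    and eq: "\<And>m. (LINT x:{0<..}|lborel. f x * cut' m p q x + w x * cut m p q x) = 0"
  shows "f q - f p = (LINT x:{p..q}|lborel. w x)"
proof -
  let ?F = "\<lambda>a m x. indicator {0<..} x * f x * (real (Suc m) * s (real (Suc m) * (x - a)))"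
  let ?W = "\<lambda>x. indicator {p..q + 1} x * w x"
  have W: "integrable lborel ?W" using w by (simp add: set_integrable_def)
  have [measurable]: "?W \<in> borel_measurable borel" using borel_measurable_integrable[OF W] by simp
  have [measurable]: "cut m p q \<in> borel_measurable borel" for m
    using Ck_continuous[OF Ck_cut[of 0]] by (intro borel_measurable_continuous_onI)
  have bound: "norm (?W x * cut m p q x) \<le> norm (?W x)" for x m
    using mult_left_mono[OF cut_abs, of "\<bar>?W x\<bar>"] by (simp add: abs_mult)
  have Wc: "integrable lborel (\<lambda>x. ?W x * cut m p q x)" for m
    by (rule Bochner_Integration.integrable_bound[OF W]) (use bound in auto)
  note F = concentration[OF f]
  have eq': "(\<integral>x. ?F p m x \<partial>lborel) - (\<integral>x. ?F q m x \<partial>lborel) + (\<integral>x. ?W x * cut m p q x \<partial>lborel) = 0" for m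
  proof -
    have "indicator {0<..} x *\<^sub>R (f x * cut' m p q x + w x * cut m p q x)
        = ?F p m x - ?F q m x + ?W x * cut m p q x" for x
    proof -
      have "indicator {0<..} x * (w x * cut m p q x) = ?W x * cut m p q x"
      proof (cases "x \<in> {p..q + 1}")
        case False
        have "1 / real (Suc m) \<le> 1" by (simp add: field_simps)
        then have "x \<notin> {p..q + 1 / real (Suc m)}" 
          using False \<open>1 / real (Suc m) \<le> 1\<close> by (smt (verit) atLeastAtMost_iff)
        then show ?thesis using cut_eq_0[OF pq(2)] by simp
      qed (use pq in simp)
      then show ?thesis by (simp add: cut'_def algebra_simps)
    qed
    then have "(LINT x:{0<..}|lborel. f x * cut' m p q x + w x * cut m p q x)
      = (\<integral>x. ?F p m x - ?F q m x + ?W x * cut m p q x \<partial>lborel)"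
      by (simp only: set_lebesgue_integral_def)
    also have "\<dots> = (\<integral>x. ?F p m x \<partial>lborel) - (\<integral>x. ?F q m x \<partial>lborel) + (\<integral>x. ?W x * cut m p q x \<partial>lborel)"
      using F(1)[of p m] F(1)[of q m] pq Wc
      by (subst Bochner_Integration.integral_add) (auto simp del: of_nat_Suc)
    finally show ?thesis using eq by simp
  qed
  have lim: "(\<lambda>m. \<integral>x. ?W x * cut m p q x \<partial>lborel) \<longlonglongrightarrow> (\<integral>x. ?W x * indicator {p<..q} x \<partial>lborel)"
  proof (rule integral_dominated_convergence[where w = "\<lambda>x. norm (?W x)"])
    show "AE x in lborel. (\<lambda>m. ?W x * cut m p q x) \<longlonglongrightarrow> ?W x * indicator {p<..q} x"
      using cut_tendsto[OF pq(2)] by (intro AE_I2 tendsto_intros)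
    show "AE x in lborel. norm (?W x * cut m p q x) \<le> norm (?W x)" for m
      using bound by auto
  qed (use W in auto)
  have "(\<lambda>m. (\<integral>x. ?F p m x \<partial>lborel) - (\<integral>x. ?F q m x \<partial>lborel) + (\<integral>x. ?W x * cut m p q x \<partial>lborel))
      \<longlonglongrightarrow> f p - f q + (\<integral>x. ?W x * indicator {p<..q} x \<partial>lborel)"
    using pq by (intro tendsto_intros F(2) lim) auto
  then have "f p - f q + (\<integral>x. ?W x * indicator {p<..q} x \<partial>lborel) = 0"
    unfolding eq' using LIMSEQ_unique tendsto_const by blast
  moreover have "(\<integral>x. ?W x * indicator {p<..q} x \<partial>lborel) = (LINT x:{p<..q}|lborel. w x)"
    unfolding set_lebesgue_integral_def
    by (intro Bochner_Integration.integral_cong) (auto simp: indicator_def)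
  moreover have "set_integrable lborel {p..q} w" by (rule set_integrable_subset[OF w]) auto
  then have "(LINT x:{p<..q}|lborel. w x) = (LINT x:{p..q}|lborel. w x)"
    using borel_measurable_integrable
    by (intro set_lborel_integral_Ioc_eq_Icc) (auto simp: set_borel_measurable_def set_integrable_def)
  ultimately show ?thesis by simp
qed

text \<open>The exceptional null set found here depends on \<open>\<psi>\<close>. As
  \<open>u\<close> and \<open>v\<close> are integrable only over compact subsets of the open strip,
  all integrals in t are taken over slabs with \<open>0 < s1\<close> and \<open>s2 < T\<close>; in x
  the support of \<open>\<psi>\<close> provides the compactness.\<close>

lemma AE_test_slice:
  fixes u v :: "real \<times> real \<Rightarrow> real" and B :: "real set"
  assumes wd: "has_wpd (0, 1) ({0<..<T} \<times> B) u v" and "0 < T" and B: "B \<in> sets borel"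
    and um: "set_borel_measurable borel ({0<..<T} \<times> B) u"
    and vm: "set_borel_measurable borel ({0<..<T} \<times> B) v"
    and \<psi>: "\<psi> \<in> Cc_inf B"
  shows "AE t in lborel. t \<in> {0<..<T} \<longrightarrow> (LINT x:B|lborel. u (t, x) * pd 1 \<psi> x + v (t, x) * \<psi> x) = 0"
proof -
  let ?Q = "{0<..<T} \<times> B"
  have Q: "?Q \<in> sets borel" using B by (intro borel_Times) auto
  define G where "G = (\<lambda>z. indicator ?Q z * (u z * pd 1 \<psi> (snd z) + v z * \<psi> (snd z)))"
  define w where "w t = (\<integral>x. G (t, x) \<partial>lborel)" for t
  have cont: "continuous_on A (\<lambda>z::real \<times> real. \<psi> (snd z))" "continuous_on A (\<lambda>z::real \<times> real. pd 1 \<psi> (snd z))" for A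
    using Cc_inf_continuous[OF \<psi>, of UNIV] Cc_inf_pd_continuous[OF \<psi>, of 1 UNIV]
    by (auto intro!: continuous_intros intro: continuous_on_compose2)
  have "(\<lambda>z. indicator ?Q z * u z) \<in> borel_measurable borel" "(\<lambda>z. indicator ?Q z * v z) \<in> borel_measurable borel"
    using um vm by (auto simp: set_borel_measurable_def)
  with cont[THEN borel_measurable_continuous_onI]
  have [measurable]: "G \<in> borel_measurable borel"
    by (simp add: G_def distrib_left mult.assoc[symmetric])
  have Gm [measurable]: "(\<lambda>z. indicator (A \<times> UNIV) z * G z) \<in> borel_measurable borel" if "A \<in> sets borel" for A
  proof (intro borel_measurable_times borel_measurable_indicator)
    show "A \<times> UNIV \<in> sets (borel :: (real \<times> real) measure)" using that by (intro borel_Times) auto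
  qed measurable
  have uv: "u \<in> Lp_loc ?Q 1" "v \<in> Lp_loc ?Q 1" using wd by (auto simp: has_wpd_def)
  have slab: "integrable lborel (\<lambda>z. indicator ({s1..s2} \<times> UNIV) z * G z)" if s: "0 < s1" "s2 < T" for s1 s2
  proof -
    let ?K = "{s1..s2} \<times> supp \<psi>"
    let ?h = "\<lambda>z. u z * pd 1 \<psi> (snd z) + v z * \<psi> (snd z)"
    have K: "compact ?K" "?K \<subseteq> ?Q" using s Cc_inf_supp[OF \<psi>] by (auto intro!: compact_Times)
    have Kb: "?K \<in> sets borel" using K by (simp add: borel_compact)
    have mi: "integrable (lebesgue_on ?K) (\<lambda>z. f z * \<psi>' z)"
      if "f \<in> Lp_loc ?Q 1" "continuous_on UNIV \<psi>'" for f and \<psi>' :: "real \<times> real \<Rightarrow> real"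
    proof -
      \<comment> \<open>\<open>\<psi>'\<close> need not vanish outside \<open>?K\<close>; its
        product with the indicator does, and is still continuous on \<open>?K\<close>.\<close>
      have "f \<in> Lp_loc ?K 1" using that(1) K(2) by (auto simp: Lp_loc_1_iff)
      from Lp_loc_mult_integrable[OF this K(1) order_refl Kb, of "\<lambda>z. indicator ?K z * \<psi>' z"]
      have "integrable (lebesgue_on ?K) (\<lambda>z. f z * (indicator ?K z * \<psi>' z))"
        using continuous_on_subset[OF that(2)] by (auto cong: continuous_on_cong)
      then show ?thesis
        by (rule Bochner_Integration.integrable_cong[THEN iffD1, rotated 2]) (auto simp: space_restrict_space)
    qed
    have "integrable (lebesgue_on ?K) ?h"
      using mi[OF uv(1) cont(2)] mi[OF uv(2) cont(1)] by simp
    then have "integrable lebesgue (\<lambda>z. indicator ?K z * ?h z)"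
      using Kb by (simp add: integrable_restrict_space)
    moreover have "indicator ?K z * ?h z = indicator ({s1..s2} \<times> UNIV) z * G z" for z
      using s Cc_inf_eq_0[OF \<psi>, of "snd z"] Cc_inf_pd_eq_0[OF \<psi>, of "snd z" 1] Cc_inf_supp(2)[OF \<psi>]
      by (cases z) (auto simp: G_def indicator_def)
    ultimately have "integrable lebesgue (\<lambda>z. indicator ({s1..s2} \<times> UNIV) z * G z)"
      by (simp only:)
    moreover have "(\<lambda>z. indicator ({s1..s2} \<times> UNIV) z * G z) \<in> borel_measurable lborel"
      using Gm[of "{s1..s2}"] by simp
    ultimately show ?thesis using integrable_completion by blast
  qed
  have slab_zero: "(\<integral>z. indicator ({s1<..s2} \<times> UNIV) z * G z \<partial>lborel) = 0" if s: "0 < s1" "s1 < s2" "s2 < T" for s1 s2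
  proof -
    \<comment> \<open>The supports of the cutoffs reach beyond \<open>s2\<close>; \<open>r\<close>
      lies halfway to \<open>T\<close>, and shifting the index by \<open>N\<close> keeps every
      overshoot below \<open>r - s2\<close>.\<close>
    define r where "r = (s2 + T) / 2"
    have r: "s2 < r" "r < T" using s by (auto simp: r_def)
    obtain N where N: "1 / (r - s2) < real N" using reals_Archimedean2 by blast
    let ?\<theta> = "\<lambda>m. cut (m + N) s1 s2"
    let ?R = "\<lambda>z. indicator ({s1..r} \<times> UNIV) z * G z"
    have sub: "{s1..s2 + 1 / real (Suc (m + N))} \<subseteq> {s1..r}" for m
    proof -
      have "1 < real N * (r - s2)" using N r by (simp add: field_simps)
      also have "\<dots> \<le> real (Suc (m + N)) * (r - s2)" using r by (intro mult_right_mono) auto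
      finally show ?thesis by (auto simp: field_simps)
    qed
    then have sub': "{s1..s2 + 1 / real (Suc (m + N))} \<subseteq> {0<..<T}" for m using r s by fastforce
    have cm: "(\<lambda>z. ?\<theta> m (fst z)) \<in> borel_measurable (borel :: (real \<times> real) measure)" for m
      using Ck_continuous[OF Ck_cut[of 0], of "m + N" s1 s2]
      by (intro borel_measurable_continuous_onI) (auto intro!: continuous_intros intro: continuous_on_compose2)
    have Rm: "?R \<in> borel_measurable borel" by (rule Gm) simp
    note \<theta>Rm = borel_measurable_times[OF cm Rm]
    have im: "(\<lambda>z. indicator {s1<..s2} (fst z) * ?R z) \<in> borel_measurable borel"
      by (rule borel_measurable_times[OF measurable_compose[OF
          borel_measurable_continuous_onI[OF continuous_on_fst[OF continuous_on_id]] borel_measurable_indicator] Rm])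
        simp
    have zero: "(\<integral>z. ?\<theta> m (fst z) * ?R z \<partial>lborel) = 0" for m
    proof -
      define \<phi> where "\<phi> = (\<lambda>z. ?\<theta> m (fst z) * \<psi> (snd z))"
      have \<phi>: "\<phi> \<in> Cc_inf ?Q" and pd: "pd (0, 1) \<phi> z = ?\<theta> m (fst z) * pd 1 \<psi> (snd z)" for z
        using cut_product_Cc_inf[OF s(2) sub' \<psi>, of m] unfolding \<phi>_def by (auto, cases z, simp)
      have b: "(0, 1) \<in> (Basis :: (real \<times> real) set)" by (auto simp: Basis_prod_def)
      have "0 = (LINT z|lebesgue_on ?Q. u z * pd (0, 1) \<phi> z) + (LINT z|lebesgue_on ?Q. v z * \<phi> z)"
        using wd \<phi> by (simp add: has_wpd_def)
      also have "\<dots> = (LINT z|lebesgue_on ?Q. u z * pd (0, 1) \<phi> z + v z * \<phi> z)"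
        using Lp_loc_test_pd_integrable[OF uv(1) \<phi> Q b] Lp_loc_test_integrable[OF uv(2) \<phi> Q] by simp
      also have "\<dots> = (LINT z|lebesgue. ?\<theta> m (fst z) * ?R z)"
      proof -
        have "indicator ?Q z *\<^sub>R (u z * pd (0, 1) \<phi> z + v z * \<phi> z) = ?\<theta> m (fst z) * ?R z" for z
        proof (cases "fst z \<in> {s1..r}")
          case False
          then have "?\<theta> m (fst z) = 0" using sub by (intro cut_eq_0[OF s(2)]) blast
          then show ?thesis unfolding pd by (simp add: \<phi>_def)
        next
          case True
          then have "indicator ({s1..r} \<times> UNIV) z = (1 :: real)" by (cases z) simp
          then show ?thesis unfolding pd by (simp add: \<phi>_def G_def algebra_simps)
        qed
        then show ?thesis using Q by (simp add: integral_restrict_space)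
      qed
      also have "\<dots> = (\<integral>z. ?\<theta> m (fst z) * ?R z \<partial>lborel)"
        using \<theta>Rm by (intro integral_completion) simp
      finally show ?thesis by simp
    qed
    have "(\<lambda>m. \<integral>z. ?\<theta> m (fst z) * ?R z \<partial>lborel) \<longlonglongrightarrow> (\<integral>z. indicator {s1<..s2} (fst z) * ?R z \<partial>lborel)"
    proof (rule integral_dominated_convergence[where w = "\<lambda>z. norm (?R z)"])
      show "AE z in lborel. (\<lambda>m. ?\<theta> m (fst z) * ?R z) \<longlonglongrightarrow> indicator {s1<..s2} (fst z) * ?R z"
        by (intro AE_I2 tendsto_intros LIMSEQ_ignore_initial_segment cut_tendsto s)
      show "AE z in lborel. norm (?\<theta> m (fst z) * ?R z) \<le> norm (?R z)" for m
        using mult_right_mono[OF cut_abs, of "\<bar>?R _\<bar>"] by (intro AE_I2) (simp add: abs_mult)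
      show "integrable lborel (\<lambda>z. norm (?R z))" using slab[of s1 r] s r by (intro integrable_norm) auto
    qed (use \<theta>Rm im in simp_all)
    then have "(\<integral>z. indicator {s1<..s2} (fst z) * ?R z \<partial>lborel) = 0"
      unfolding zero using LIMSEQ_unique tendsto_const by blast
    moreover have "indicator {s1<..s2} (fst z) * ?R z = indicator ({s1<..s2} \<times> UNIV) z * G z" for z
      using r by (cases z) (auto simp: indicator_def)
    ultimately show ?thesis by simp
  qed
  have w: "set_integrable lborel {s1<..s2} w" and w0: "(LINT t:{s1<..s2}|lborel. w t) = 0"
    if s: "0 < s1" "s1 < s2" "s2 < T" for s1 s2
  proof -
    let ?R = "\<lambda>z. indicator ({s1<..s2} \<times> UNIV) z * G z"
    have "integrable lborel ?R"
      by (rule Bochner_Integration.integrable_bound[OF slab[OF s(1,3)]])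
         (use Gm[of "{s1<..s2}"] in \<open>auto simp: indicator_def\<close>)
    then have R: "integrable (lborel \<Otimes>\<^sub>M lborel) ?R" by (simp add: lborel_prod)
    have eq: "(\<integral>x. ?R (t, x) \<partial>lborel) = indicator {s1<..s2} t * w t" for t
      by (simp add: w_def indicator_times)
    show "set_integrable lborel {s1<..s2} w"
      using lborel_pair.integrable_fst'[OF R] by (simp add: set_integrable_def eq)
    show "(LINT t:{s1<..s2}|lborel. w t) = 0"
      using lborel_pair.integral_fst'[OF R] slab_zero[OF s] by (simp add: set_lebesgue_integral_def eq lborel_prod)
  qed
  have loc: "AE t in lborel. t \<in> {s1<..s2} \<longrightarrow> w t = 0" if s: "0 < s1" "s1 < s2" "s2 < T" for s1 s2
    using w[OF s] by (rule AE_eq_0_if_interval_integrals_eq_0) (use s w0 in auto)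
  \<comment> \<open>Countably many intervals exhaust (0,T). The offset 3 makes each of them
    nondegenerate, as T/3 < T - T/3.\<close>
  have "AE t in lborel. \<forall>n::nat. t \<in> {T / (real n + 3)<..T - T / (real n + 3)} \<longrightarrow> w t = 0"
    unfolding AE_all_countable
  proof
    fix n :: nat
    show "AE t in lborel. t \<in> {T / (real n + 3)<..T - T / (real n + 3)} \<longrightarrow> w t = 0"
    proof -
      have "0 < T / (real n + 3)" using \<open>0 < T\<close> by simp
      moreover have "T / (real n + 3) \<le> T / 3" using \<open>0 < T\<close> by (intro divide_left_mono) auto
      ultimately show ?thesis using \<open>0 < T\<close> by (intro loc) linarith+
    qed
  qed
  then show ?thesis
  proof eventually_elim
    case (elim t)
    show ?case
    proof
      assume t: "t \<in> {0<..<T}"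
      obtain n where n: "T / min t (T - t) < real n" using reals_Archimedean2 by blast
      have "t \<in> {T / (real n + 3)<..T - T / (real n + 3)}"
      proof -
        have "T < min t (T - t) * real n" using n t by (simp add: field_simps)
        also have "\<dots> < min t (T - t) * (real n + 3)" using t by (intro mult_strict_left_mono) auto
        finally have "T / (real n + 3) < min t (T - t)" by (subst pos_divide_less_eq) linarith+
        then show ?thesis by simp
      qed
      with elim have "w t = 0" by blast
      moreover have "w t = (LINT x:B|lborel. u (t, x) * pd 1 \<psi> x + v (t, x) * \<psi> x)"
        using t by (simp add: w_def G_def set_lebesgue_integral_def indicator_times)
      ultimately show "(LINT x:B|lborel. u (t, x) * pd 1 \<psi> x + v (t, x) * \<psi> x) = 0" by simp
    qed
  qed
qed

text \<open>The null set is chosen before \<open>c\<close> and \<open>d\<close>: it collects those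
  of all rational intervals and all levels \<open>m\<close>, together with the times at which
  \<open>v(t,.)\<close> fails to be integrable on some member of a compact exhaustion.\<close>

lemma AE_primitive_slices:
  fixes u v :: "real \<times> real \<Rightarrow> real"
  assumes u: "continuous_on ({0<..<T} \<times> {0<..}) u"
    and wd: "has_wpd (0, 1) ({0<..<T} \<times> {0<..}) u v" and "0 < T"
    and vm: "set_borel_measurable borel ({0<..<T} \<times> {0<..}) v"
  shows "AE t in lborel. t \<in> {0<..<T} \<longrightarrow> (\<forall>c d. 0 < c \<longrightarrow> c < d \<longrightarrow>
    set_integrable lborel {c..d} (\<lambda>x. v (t, x)) \<and>
    u (t, d) - u (t, c) = (LINT x:{c..d}|lborel. v (t, x)))"
proof -
  let ?Q = "{0<..<T} \<times> {0::real<..}"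
  \<comment> \<open>An exhaustion of the strip by rectangles. Those with small \<open>n\<close> may
    be empty, which does no harm.\<close>
  let ?K = "\<lambda>n::nat. {1 / (real n + 1)..T - 1 / (real n + 1)} \<times> {1 / (real n + 1)..real n + 1}"
  have "open ?Q" by (intro open_Times) auto
  then have um: "set_borel_measurable borel ?Q u"
    using u by (intro set_borel_measurable_if_continuous borel_open)
  have K: "compact (?K n)" "?K n \<subseteq> ?Q" "?K n \<in> sets borel" for n
  proof -
    have p: "0 < 1 / (real n + 1)" by simp
    show "?K n \<subseteq> ?Q"
    proof (clarify, intro conjI)
      fix t x assume "t \<in> {1 / (real n + 1)..T - 1 / (real n + 1)}" "x \<in> {1 / (real n + 1)..real n + 1}"
      then show "t \<in> {0<..<T}" "x \<in> {0<..}" 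
        using p unfolding atLeastAtMost_iff greaterThanLessThan_iff greaterThan_iff by linarith+
    qed
    show "compact (?K n)" by (intro compact_Times) auto
    then show "?K n \<in> sets borel" by (rule borel_compact)
  qed
  have "AE t in lborel. \<forall>n. integrable lborel (\<lambda>x. indicator (?K n) (t, x) * v (t, x))"
    unfolding AE_all_countable
  proof
    fix n
    have "set_borel_measurable borel (?K n) v"
      using set_borel_measurable_subset[of borel ?Q v "?K n"] vm K by simp
    then have "set_integrable lborel (?K n) v"
      using wd K(1,2)[of n] integrable_lebesgue_on_iff[OF K(3)] by (auto simp: has_wpd_def Lp_loc_1_iff)
    then have "integrable (lborel \<Otimes>\<^sub>M lborel) (\<lambda>z. indicator (?K n) z * v z)"
      by (simp add: set_integrable_def lborel_prod)
    from lborel_pair.AE_integrable_fst'[OF this]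
    show "AE t in lborel. integrable lborel (\<lambda>x. indicator (?K n) (t, x) * v (t, x))" .
  qed
  moreover have "AE t in lborel. \<forall>p\<in>{q \<in> \<rat>. 0 < (q :: real)}. \<forall>q\<in>{q \<in> \<rat>. p < q}. \<forall>m. t \<in> {0<..<T} \<longrightarrow>
      (LINT x:{0<..}|lborel. u (t, x) * pd 1 (cut m p q) x + v (t, x) * cut m p q x) = 0"
  proof (intro AE_ball_countable' countable_Collect countable_rat)
    fix p q :: real assume pq: "p \<in> {q \<in> \<rat>. 0 < q}" "q \<in> {q \<in> \<rat>. p < q}"
    show "AE t in lborel. \<forall>m. t \<in> {0<..<T} \<longrightarrow>
      (LINT x:{0<..}|lborel. u (t, x) * pd 1 (cut m p q) x + v (t, x) * cut m p q x) = 0"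
      unfolding AE_all_countable
    proof
      fix m
      have "cut m p q \<in> Cc_inf {0<..}" using pq by (intro cut_Cc_inf) auto
      then show "AE t in lborel. t \<in> {0<..<T} \<longrightarrow>
          (LINT x:{0<..}|lborel. u (t, x) * pd 1 (cut m p q) x + v (t, x) * cut m p q x) = 0"
        by (intro AE_test_slice[OF wd \<open>0 < T\<close> _ um vm]) auto
    qed
  qed
  ultimately show ?thesis
  proof eventually_elim
    case (elim t)
    show ?case
    proof
      assume t: "t \<in> {0<..<T}"
      have int: "set_integrable lborel {c..d} (\<lambda>x. v (t, x))" if cd: "0 < c" "c < d" for c d
      proof -
        \<comment> \<open>\<open>e\<close> is a lower bound for the distances of \<open>t\<close> to
          0 and \<open>T\<close> and of \<open>{c..d}\<close> to 0; any \<open>n\<close> beyond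
          \<open>1 / e\<close> and \<open>d\<close> gives a rectangle containing
          \<open>{t} \<times> {c..d}\<close>.\<close>
        obtain e where e: "0 < e" "e \<le> t" "e \<le> T - t" "e \<le> c"
          using t \<open>0 < c\<close> by (intro that[of "min t (min (T - t) c)"]) auto
        obtain n where n: "max d (1 / e) < real n" using reals_Archimedean2 by blast
        then have *: "1 / e < real n + 1" "d \<le> real n + 1" by auto
        with e(1) have "1 / (real n + 1) < e" by (simp add: pos_divide_less_eq mult.commute)
        then have **: "t \<in> {1 / (real n + 1)..T - 1 / (real n + 1)}" "1 / (real n + 1) \<le> c"
          using e by auto
        have "integrable lborel (\<lambda>x. indicator (?K n) (t, x) * v (t, x))" using elim(1) by blast
        then have "set_integrable lborel {1 / (real n + 1)..real n + 1} (\<lambda>x. v (t, x))"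
          using **(1) by (simp add: set_integrable_def indicator_times)
        then show ?thesis by (rule set_integrable_subset) (use **(2) *(2) in auto)
      qed
      have cont: "continuous_on {0<..} (\<lambda>x. u (t, x))"
        using t by (intro continuous_on_compose2[OF u]) (auto intro!: continuous_intros)
      have "u (t, d) - u (t, c) = (LINT x:{c..d}|lborel. v (t, x))" if "0 < c" "c < d" for c d
      proof (rule primitive_if_rational[OF cont int _ that])
        fix p q :: real assume pq: "0 < p" "p < q" "p \<in> \<rat>" "q \<in> \<rat>"
        show "u (t, q) - u (t, p) = (LINT x:{p..q}|lborel. v (t, x))"
        proof (rule primitive_if_cut[OF cont _ pq(1,2)])
          show "(LINT x:{0<..}|lborel. u (t, x) * cut' m p q x + v (t, x) * cut m p q x) = 0" for m
            using elim(2) t pq by (simp add: pd_real_eq[OF cut_deriv])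
        qed (use int pq in auto)
      qed
      with int show "\<forall>c d. 0 < c \<longrightarrow> c < d \<longrightarrow> set_integrable lborel {c..d} (\<lambda>x. v (t, x)) \<and>
        u (t, d) - u (t, c) = (LINT x:{c..d}|lborel. v (t, x))" by blast
    qed
  qed
qed

end

section \<open>The change of variables from \<open>k\<close> to \<open>x\<close>\<close>

text \<open>Kept with its sign: the map is decreasing, and the sign enters the weak derivative of
  \<open>u(t, x(k))\<close> through the chain rule, while transported measures see the absolute
  value only.\<close>

definition x_of_k_deriv :: "real \<Rightarrow> real \<Rightarrow> real" where
  "x_of_k_deriv lam k = - 1 / (k\<^sup>2 * sqrt (1 + lam\<^sup>2 * k\<^sup>2))"

lemma sqrt_x_of_k:
  assumes "0 < k"
  shows "sqrt (1 / k\<^sup>2 + lam\<^sup>2) = sqrt (1 + lam\<^sup>2 * k\<^sup>2) / k"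
proof -
  have "1 / k\<^sup>2 + lam\<^sup>2 = (1 + lam\<^sup>2 * k\<^sup>2) / k\<^sup>2" using assms by (simp add: field_simps)
  then show ?thesis using assms by (simp add: real_sqrt_divide)
qed

lemma one_plus_pos: "0 < 1 + lam\<^sup>2 * k\<^sup>2" for lam k :: real
  by (simp add: add_pos_nonneg)

lemma x_of_k_pos:
  assumes "0 \<le> lam" "0 < k"
  shows "0 < x_of_k lam k"
proof -
  have "sqrt (lam\<^sup>2) < sqrt (1 / k\<^sup>2 + lam\<^sup>2)" using assms by (intro real_sqrt_less_mono) auto
  then show ?thesis using assms by (simp add: x_of_k_def)
qed

lemma x_of_k_has_derivative:
  assumes "0 < k"
  shows "(x_of_k lam has_real_derivative x_of_k_deriv lam k) (at k)"
proof -
  have pos: "0 < 1 / k\<^sup>2 + lam\<^sup>2" using assms by (simp add: add_pos_nonneg)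
  have "((\<lambda>k. 1 / k\<^sup>2 + lam\<^sup>2) has_real_derivative - 2 / k ^ 3) (at k)"
    using assms by (auto intro!: derivative_eq_intros simp: power2_eq_square power3_eq_cube)
  from DERIV_chain2[OF DERIV_real_sqrt[OF pos] this]
  have "((\<lambda>k. sqrt (1 / k\<^sup>2 + lam\<^sup>2)) has_real_derivative
      inverse (sqrt (1 / k\<^sup>2 + lam\<^sup>2)) / 2 * (- 2 / k ^ 3)) (at k)" .
  moreover have "inverse (sqrt (1 / k\<^sup>2 + lam\<^sup>2)) / 2 * (- 2 / k ^ 3) = x_of_k_deriv lam k"
    unfolding sqrt_x_of_k[OF assms] x_of_k_deriv_def
    using assms by (simp add: field_simps power2_eq_square power3_eq_cube)
  ultimately have "((\<lambda>k. sqrt (1 / k\<^sup>2 + lam\<^sup>2)) has_real_derivative x_of_k_deriv lam k) (at k)"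
    by simp
  from DERIV_diff[OF this DERIV_const[of lam]] show ?thesis by (simp add: x_of_k_def[abs_def])
qed

lemma x_of_k_deriv_neg: "0 < k \<Longrightarrow> x_of_k_deriv lam k < 0"
  using one_plus_pos[of lam k] by (simp add: x_of_k_deriv_def)

lemma x_of_k_continuous: "continuous_on {0<..} (x_of_k lam)"
  using x_of_k_has_derivative DERIV_isCont by (metis continuous_at_imp_continuous_on greaterThan_iff)

lemma x_of_k_less: "0 < j \<Longrightarrow> j < k \<Longrightarrow> x_of_k lam k < x_of_k lam j"
proof -
  assume jk: "0 < j" "j < k"
  then have "1 / k\<^sup>2 < 1 / j\<^sup>2" by (intro divide_strict_left_mono power_strict_mono) auto
  then show ?thesis by (simp add: x_of_k_def)
qed

lemma x_of_k_inj: "inj_on (x_of_k lam) {0<..}"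
proof (rule linorder_inj_onI')
  fix i j :: real assume "i \<in> {0<..}" "i < j"
  then show "x_of_k lam i \<noteq> x_of_k lam j" using x_of_k_less[of i j lam] by simp
qed

text \<open>Solving \<open>x + lam = sqrt (1 / k\<^sup>2 + lam\<^sup>2)\<close> for \<open>k\<close>
  gives \<open>1 / k\<^sup>2 = (x + lam)\<^sup>2 - lam\<^sup>2 = x * (x + 2 * lam)\<close>.\<close>

lemma x_of_k_inverse:
  assumes "0 \<le> lam" "0 < x"
  shows "x_of_k lam (1 / sqrt (x * (x + 2 * lam))) = x" and "0 < 1 / sqrt (x * (x + 2 * lam))"
proof -
  have pos: "0 < x * (x + 2 * lam)" using assms by simp
  then have "1 / (1 / sqrt (x * (x + 2 * lam)))\<^sup>2 + lam\<^sup>2 = (x + lam)\<^sup>2"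
    by (simp add: power_divide power2_eq_square algebra_simps)
  then show "x_of_k lam (1 / sqrt (x * (x + 2 * lam))) = x" using assms by (simp add: x_of_k_def)
  show "0 < 1 / sqrt (x * (x + 2 * lam))" using pos by simp
qed

lemma x_of_k_image:
  assumes "0 \<le> lam"
  shows "x_of_k lam ` {0<..} = {0<..}"
proof
  show "{0<..} \<subseteq> x_of_k lam ` {0<..}"
    using x_of_k_inverse[OF assms] by (metis greaterThan_iff imageI subsetI)
qed (use x_of_k_pos[OF assms] in auto)

lemma x_of_k_image_Icc:
  assumes "0 \<le> lam" "0 < c" "c < d"
  shows "x_of_k lam ` {c..d} = {x_of_k lam d..x_of_k lam c}"
proof
  show "x_of_k lam ` {c..d} \<subseteq> {x_of_k lam d..x_of_k lam c}"
    using x_of_k_less[of _ d lam] x_of_k_less[of c _ lam] assms by (force simp: le_less)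
  show "{x_of_k lam d..x_of_k lam c} \<subseteq> x_of_k lam ` {c..d}"
  proof
    fix x assume x: "x \<in> {x_of_k lam d..x_of_k lam c}"
    then have "0 < x" using x_of_k_pos[of lam d] assms by auto
    then obtain k where k: "0 < k" "x = x_of_k lam k" using x_of_k_inverse[OF assms(1)] by metis
    have "c \<le> k" "k \<le> d"
      using x x_of_k_less[of k c lam] x_of_k_less[of d k lam] k assms by force+
    then show "x \<in> x_of_k lam ` {c..d}" using k by auto
  qed
qed

text \<open>The factors regroup: \<open>sqrt x * sqrt (x + 2 * lam)\<close> is the root of
  \<open>x * (x + 2 * lam) = 1 / k\<^sup>2\<close>, and \<open>x + lam\<close> is the square root in
  the definition of \<open>x_of_k\<close>.\<close>

lemma rho_x_of_k:
  assumes "0 \<le> lam" "0 < k"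
  shows "rho lam (x_of_k lam k) = sqrt (1 + lam\<^sup>2 * k\<^sup>2) / k\<^sup>2"
proof -
  define x where "x = x_of_k lam k"
  have P: "x + lam = sqrt (1 / k\<^sup>2 + lam\<^sup>2)" by (simp add: x_def x_of_k_def)
  have "x * (x + 2 * lam) = (x + lam)\<^sup>2 - lam\<^sup>2" by (simp add: power2_eq_square algebra_simps)
  also have "(x + lam)\<^sup>2 = 1 / k\<^sup>2 + lam\<^sup>2" unfolding P by simp
  finally have "x * (x + 2 * lam) = 1 / k\<^sup>2" by simp
  then have "sqrt x * sqrt (x + 2 * lam) = 1 / k"
    using assms by (simp add: real_sqrt_mult[symmetric] real_sqrt_divide)
  moreover have "rho lam x = (sqrt x * sqrt (x + 2 * lam)) * (x + lam)" by (simp add: rho_def mult_ac)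
  ultimately have "rho lam x = 1 / k * (x + lam)" by simp
  then show ?thesis
    unfolding P sqrt_x_of_k[OF assms(2)] by (simp add: x_def power2_eq_square)
qed

text \<open>The weight in the second identity is the reciprocal of the Jacobian. Squaring the chain
  rule produces the Jacobian twice; the weight cancels one copy and the other carries out the
  substitution.\<close>

lemma x_of_k_deriv_weight:
  assumes "0 \<le> lam" "0 < k"
  shows "\<bar>x_of_k_deriv lam k\<bar> * (1 / rho lam (x_of_k lam k)) = 1 / (1 + lam\<^sup>2 * k\<^sup>2)"
    and "(x_of_k_deriv lam k)\<^sup>2 * (k\<^sup>2 * sqrt (1 + lam\<^sup>2 * k\<^sup>2)) = \<bar>x_of_k_deriv lam k\<bar>"
proof -
  define r where "r = sqrt (1 + lam\<^sup>2 * k\<^sup>2)"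
  have r: "0 < r" "r * r = 1 + lam\<^sup>2 * k\<^sup>2" using one_plus_pos[of lam k] by (auto simp: r_def)
  have d: "x_of_k_deriv lam k = - 1 / (k\<^sup>2 * r)" "\<bar>x_of_k_deriv lam k\<bar> = 1 / (k\<^sup>2 * r)"
    using r assms by (auto simp: x_of_k_deriv_def r_def[symmetric])
  show "\<bar>x_of_k_deriv lam k\<bar> * (1 / rho lam (x_of_k lam k)) = 1 / (1 + lam\<^sup>2 * k\<^sup>2)"
    unfolding rho_x_of_k[OF assms] d(2) r_def[symmetric] r(2)[symmetric] using r(1) assms by simp
  show "(x_of_k_deriv lam k)\<^sup>2 * (k\<^sup>2 * sqrt (1 + lam\<^sup>2 * k\<^sup>2)) = \<bar>x_of_k_deriv lam k\<bar>"
    unfolding d r_def[symmetric] using r(1) assms by (simp add: power2_eq_square)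
qed

text \<open>The substitution theorem speaks of absolute integrability over the completed measure.
  Borel measurability on both sides is established first in order to return to
  \<open>lborel\<close>.\<close>

lemma
  fixes f :: "real \<Rightarrow> real"
  assumes lam: "0 \<le> lam" and S: "S \<in> sets borel" "S \<subseteq> {0<..}" "x_of_k lam ` S \<in> sets borel"
    and f: "set_borel_measurable borel (x_of_k lam ` S) f"
  shows x_of_k_measurable: "set_borel_measurable borel S (\<lambda>k. f (x_of_k lam k))"
    and x_of_k_set_integrable: "set_integrable lborel S (\<lambda>k. \<bar>x_of_k_deriv lam k\<bar> * f (x_of_k lam k))
      \<longleftrightarrow> set_integrable lborel (x_of_k lam ` S) f"
    and x_of_k_integral: "set_integrable lborel (x_of_k lam ` S) f \<Longrightarrow>
      (LINT k:S|lborel. \<bar>x_of_k_deriv lam k\<bar> * f (x_of_k lam k)) = (LINT x:x_of_k lam ` S|lborel. f x)"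
proof -
  let ?g = "\<lambda>k. \<bar>x_of_k_deriv lam k\<bar> * f (x_of_k lam k)"
  have [measurable]: "x_of_k lam \<in> borel_measurable borel"
    unfolding x_of_k_def[abs_def] by measurable
  have [measurable]: "x_of_k_deriv lam \<in> borel_measurable borel"
    unfolding x_of_k_deriv_def[abs_def] by measurable
  have [measurable]: "(\<lambda>x. indicator (x_of_k lam ` S) x * f x) \<in> borel_measurable borel"
    using f by (simp add: set_borel_measurable_def)
  have [measurable]: "S \<in> sets borel" by fact
  \<comment> \<open>\<open>f\<close> is known to be Borel on the image only; inserting the indicator
    of the image composes a globally Borel function with \<open>x_of_k\<close>.\<close>
  have eq: "indicator S k * f (x_of_k lam k)
      = indicator S k * (indicator (x_of_k lam ` S) (x_of_k lam k) * f (x_of_k lam k))" for k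
    by (auto simp: indicator_def)
  show m: "set_borel_measurable borel S (\<lambda>k. f (x_of_k lam k))"
    unfolding set_borel_measurable_def real_scaleR_def eq by measurable
  then have gm: "set_borel_measurable borel S ?g"
    unfolding set_borel_measurable_def real_scaleR_def
    using borel_measurable_times[of "\<lambda>k. \<bar>x_of_k_deriv lam k\<bar>" borel "\<lambda>k. indicator S k * f (x_of_k lam k)"]
    by (simp add: mult.left_commute)
  have conv: "set_integrable lebesgue A h \<longleftrightarrow> set_integrable lborel A h"
    if "set_borel_measurable borel A h" for A and h :: "real \<Rightarrow> real"
    using that by (auto simp: set_integrable_def set_borel_measurable_def integrable_completion)
  have cov: "?g absolutely_integrable_on S \<and> integral S ?g = b
      \<longleftrightarrow> f absolutely_integrable_on (x_of_k lam ` S) \<and> integral (x_of_k lam ` S) f = b" for b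
  proof (rule has_absolute_integral_change_of_variables_1')
    show "S \<in> sets lebesgue" using S by auto
    show "(x_of_k lam has_real_derivative x_of_k_deriv lam k) (at k within S)" if "k \<in> S" for k
      using x_of_k_has_derivative that S(2) by (blast intro: has_field_derivative_at_within)
    show "inj_on (x_of_k lam) S" using x_of_k_inj S(2) inj_on_subset by blast
  qed
  then show iff: "set_integrable lborel S ?g \<longleftrightarrow> set_integrable lborel (x_of_k lam ` S) f"
    using conv[OF gm] conv[OF f] by blast
  show "(LINT k:S|lborel. ?g k) = (LINT x:x_of_k lam ` S|lborel. f x)"
    if int: "set_integrable lborel (x_of_k lam ` S) f"
    using cov[of "integral (x_of_k lam ` S) f"] conv[OF f] int iff
      set_borel_integral_eq_integral(2)[OF int] set_borel_integral_eq_integral(2)[of S ?g] by simp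
qed

text \<open>Since \<open>x_of_k\<close> decreases, \<open>{c..d}\<close> is mapped to an interval
  with exchanged ends; the resulting sign is absorbed by the negative derivative, so the primitive
  formula keeps its form.\<close>

lemma primitive_x_of_k:
  fixes f w :: "real \<Rightarrow> real"
  assumes lam: "0 \<le> lam" and w: "set_borel_measurable borel {0<..} w"
    and int: "\<And>c d. 0 < c \<Longrightarrow> c < d \<Longrightarrow> set_integrable lborel {c..d} w"
    and prim: "\<And>c d. 0 < c \<Longrightarrow> c < d \<Longrightarrow> f d - f c = (LINT x:{c..d}|lborel. w x)"
    and cd: "0 < c" "c < d"
  shows "set_integrable lborel {c..d} (\<lambda>k. w (x_of_k lam k) * x_of_k_deriv lam k)"
    and "f (x_of_k lam d) - f (x_of_k lam c) = (LINT k:{c..d}|lborel. w (x_of_k lam k) * x_of_k_deriv lam k)"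
proof -
  let ?x = "x_of_k lam"
  note image = x_of_k_image_Icc[OF lam cd]
  have x: "0 < ?x d" "?x d < ?x c" using x_of_k_pos[OF lam] x_of_k_less cd by auto
  have wm: "set_borel_measurable borel (?x ` {c..d}) w"
    unfolding image using set_borel_measurable_subset[OF w, of "{?x d..?x c}"] x by (simp add: subset_iff)
  have S: "{c..d} \<in> sets borel" "{c..d} \<subseteq> {0<..}" "?x ` {c..d} \<in> sets borel"
    unfolding image using cd by auto
  have eq: "indicator {c..d} k *\<^sub>R (w (?x k) * x_of_k_deriv lam k)
      = - (indicator {c..d} k *\<^sub>R (\<bar>x_of_k_deriv lam k\<bar> * w (?x k)))" for k
    using x_of_k_deriv_neg[of k lam] cd by (auto simp: indicator_def)
  have iw: "set_integrable lborel (?x ` {c..d}) w" unfolding image by (rule int[OF x])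
  with x_of_k_set_integrable[OF lam S wm]
  show "set_integrable lborel {c..d} (\<lambda>k. w (?x k) * x_of_k_deriv lam k)"
    unfolding set_integrable_def eq by simp
  show "f (?x d) - f (?x c) = (LINT k:{c..d}|lborel. w (?x k) * x_of_k_deriv lam k)"
    using prim[OF x] x_of_k_integral[OF lam S wm iw]
    unfolding set_lebesgue_integral_def eq image by simp
qed

section \<open>Lebesgue spaces and distributions\<close>

text \<open>The function to be shifted by \<open>lam\<close> in (ii) is \<open>wpd\<close> itself,
  which is only Lebesgue measurable, so translation invariance is needed for the completed measure.
  It is the affine substitution with all scale factors equal to one.\<close>

lemma
  fixes c :: "'a::euclidean_space"
  shows lebesgue_measurable_plus: "(+) c \<in> lebesgue \<rightarrow>\<^sub>M lebesgue"
    and lebesgue_distr_plus: "distr lebesgue lebesgue ((+) c) = lebesgue"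
proof -
  have T: "(\<lambda>x. c + (\<Sum>j\<in>Basis. (1 * (x \<bullet> j)) *\<^sub>R j)) = (+) c"
    by (simp add: euclidean_representation fun_eq_iff)
  show "(+) c \<in> lebesgue \<rightarrow>\<^sub>M lebesgue"
    using lebesgue_affine_measurable[of "\<lambda>_::'a. 1" c] unfolding T by simp
  show "distr lebesgue lebesgue ((+) c) = lebesgue"
    using lebesgue_affine_euclidean[of "\<lambda>_::'a. 1" c] unfolding T by (simp add: density_1)
qed

lemma AE_lebesgue_plus:
  fixes c :: "'a::euclidean_space"
  assumes "AE x in lebesgue. P x"
  shows "AE x in lebesgue. P (c + x)"
proof (rule AE_distrD[OF lebesgue_measurable_plus[of c]])
  show "AE x in distr lebesgue lebesgue ((+) c). P x" unfolding lebesgue_distr_plus by (rule assms)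
qed

lemma integrable_lebesgue_plus:
  fixes f :: "'a::euclidean_space \<Rightarrow> real"
  assumes "integrable lebesgue f"
  shows "integrable lebesgue (\<lambda>x. f (c + x))"
proof (rule integrable_distr[OF lebesgue_measurable_plus[of c]])
  show "integrable (distr lebesgue lebesgue ((+) c)) f" unfolding lebesgue_distr_plus by (rule assms)
qed

lemma compact_imp_sets_lebesgue: "compact K \<Longrightarrow> K \<in> sets lebesgue"
  by (rule fmeasurableD[OF lmeasurable_compact])

lemma Lp_lebesgue_on_iff:
  fixes f :: "'a::euclidean_space \<Rightarrow> real"
  assumes "S \<in> sets lebesgue"
  shows "f \<in> Lp (lebesgue_on S) p \<longleftrightarrow>
    (\<lambda>x. indicator S x * f x) \<in> borel_measurable lebesgue \<and>
    integrable lebesgue (\<lambda>x. indicator S x * \<bar>f x\<bar> powr p)"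
proof -
  have S: "S \<inter> space lebesgue \<in> sets lebesgue" using assms by simp
  show ?thesis
    unfolding Lp_def mem_Collect_eq borel_measurable_restrict_space_iff[OF S] integrable_restrict_space[OF S]
    by simp
qed

lemma Lp_lebesgue_on_plus:
  fixes f :: "'a::euclidean_space \<Rightarrow> real"
  assumes f: "f \<in> Lp (lebesgue_on S) p" and S: "S \<in> sets lebesgue"
  shows "(\<lambda>x. f (c + x)) \<in> Lp (lebesgue_on {x. c + x \<in> S}) p"
proof -
  have S': "{x. c + x \<in> S} \<in> sets lebesgue"
    using measurable_sets[OF lebesgue_measurable_plus S, of c] by (simp add: vimage_def)
  have "(\<lambda>x. indicator S (c + x) * f (c + x)) \<in> borel_measurable lebesgue"
    using measurable_compose[OF lebesgue_measurable_plus, of "\<lambda>x. indicator S x * f x"] f S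
    by (simp add: Lp_lebesgue_on_iff)
  moreover have "integrable lebesgue (\<lambda>x. indicator S (c + x) * \<bar>f (c + x)\<bar> powr p)"
    using integrable_lebesgue_plus[of "\<lambda>x. indicator S x * \<bar>f x\<bar> powr p"] f S
    by (simp add: Lp_lebesgue_on_iff)
  moreover have "indicator {x. c + x \<in> S} x = (indicator S (c + x) :: real)" for x
    by (simp add: indicator_def)
  ultimately show ?thesis using Lp_lebesgue_on_iff[OF S'] by (simp del: indicator_simps)
qed

lemma Lp_loc_plus:
  fixes f :: "'a::euclidean_space \<Rightarrow> real"
  assumes f: "f \<in> Lp_loc U p"
  shows "(\<lambda>x. f (c + x)) \<in> Lp_loc {x. c + x \<in> U} p"
  unfolding Lp_loc_def
proof safe
  fix K assume K: "compact K" "K \<subseteq> {x. c + x \<in> U}"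
  have cK: "compact ((+) c ` K)" using K(1) by (rule compact_translation)
  have "f \<in> Lp (lebesgue_on ((+) c ` K)) p" using f cK K(2) by (auto simp: Lp_loc_def)
  moreover have "(+) c ` K \<in> sets lebesgue" using cK by (rule compact_imp_sets_lebesgue)
  ultimately have "(\<lambda>x. f (c + x)) \<in> Lp (lebesgue_on {x. c + x \<in> (+) c ` K}) p"
    by (rule Lp_lebesgue_on_plus)
  moreover have "{x. c + x \<in> (+) c ` K} = K" by auto
  ultimately show "(\<lambda>x. f (c + x)) \<in> Lp (lebesgue_on K) p" by simp
qed

text \<open>By completeness, functions that agree almost everywhere are measurable together, so
  measurability of \<open>g\<close> is a consequence and the integrals agree
  unconditionally.\<close>

lemma
  fixes f g :: "'a::euclidean_space \<Rightarrow> real"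
  assumes S: "S \<in> sets lebesgue" and eq: "AE x in lebesgue. x \<in> S \<longrightarrow> f x = g x"
  shows integrable_lebesgue_on_cong_AE: "integrable (lebesgue_on S) f \<Longrightarrow> integrable (lebesgue_on S) g"
    and integral_lebesgue_on_cong_AE: "(LINT x|lebesgue_on S. f x) = (LINT x|lebesgue_on S. g x)"
proof -
  have eq': "AE x in lebesgue_on S. f x = g x" using eq S by (simp add: AE_restrict_space_iff)
  have m: "g \<in> borel_measurable (lebesgue_on S)"
    if fm: "f \<in> borel_measurable (lebesgue_on S)" and eq: "AE x in lebesgue. x \<in> S \<longrightarrow> f x = g x"
    for f g :: "'a \<Rightarrow> real"
  proof -
    have "(\<lambda>x. indicator S x * f x) \<in> borel_measurable lebesgue"
      using fm S by (simp add: borel_measurable_restrict_space_iff mult.commute)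
    then have "(\<lambda>x. indicator S x * g x) \<in> borel_measurable lebesgue"
      by (rule borel_measurable_AE) (use eq in eventually_elim, auto simp: indicator_def)
    then show ?thesis using S by (simp add: borel_measurable_restrict_space_iff mult.commute)
  qed
  show int: "integrable (lebesgue_on S) f \<Longrightarrow> integrable (lebesgue_on S) g"
    using integrable_cong_AE_imp[of "lebesgue_on S" f g] m[OF _ eq] eq' borel_measurable_integrable
    by (metis (mono_tags, lifting) AE_mp AE_I2)
  have sym: "AE x in lebesgue. x \<in> S \<longrightarrow> g x = f x" using eq by eventually_elim auto
  show "(LINT x|lebesgue_on S. f x) = (LINT x|lebesgue_on S. g x)"
  proof (cases "f \<in> borel_measurable (lebesgue_on S)")
    case True
    then show ?thesis using m[OF True eq] eq' by (intro integral_cong_AE) auto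
  next
    \<comment> \<open>Without measurability neither function is integrable, and both integrals take
      the default value 0.\<close>
    case False
    then have "g \<notin> borel_measurable (lebesgue_on S)" using m[OF _ sym] by blast
    then show ?thesis using False borel_measurable_integrable not_integrable_integral_eq by metis
  qed
qed

lemma Lp_loc_1_cong_AE:
  fixes v v' :: "'a::euclidean_space \<Rightarrow> real"
  assumes v: "v \<in> Lp_loc U 1" and eq: "AE x in lebesgue. x \<in> U \<longrightarrow> v x = v' x"
  shows "v' \<in> Lp_loc U 1"
  unfolding Lp_loc_1_iff
proof safe
  fix K assume K: "compact K" "K \<subseteq> U"
  show "integrable (lebesgue_on K) v'"
  proof (rule integrable_lebesgue_on_cong_AE)
    show "AE x in lebesgue. x \<in> K \<longrightarrow> v x = v' x" using eq by eventually_elim (use K in auto)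
  qed (use v K in \<open>auto simp: Lp_loc_1_iff compact_imp_sets_lebesgue\<close>)
qed

text \<open>Moves a weak derivative between \<open>wpd\<close> and its Borel representative, in the
  plane and on slices.\<close>

lemma has_wpd_cong_AE:
  fixes v v' :: "'a::euclidean_space \<Rightarrow> real"
  assumes v: "has_wpd i U f v" and eq: "AE x in lebesgue. x \<in> U \<longrightarrow> v x = v' x" and U: "U \<in> sets lebesgue"
  shows "has_wpd i U f v'"
proof -
  have "(LINT x|lebesgue_on U. v x * \<phi> x) = (LINT x|lebesgue_on U. v' x * \<phi> x)" for \<phi>
    by (rule integral_lebesgue_on_cong_AE[OF U]) (use eq in eventually_elim, auto)
  then show ?thesis using v Lp_loc_1_cong_AE[OF _ eq] by (simp add: has_wpd_def)
qed

section \<open>Interpolation between exponents\<close>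

lemma powr_le_add_powr:
  fixes y :: real
  assumes "0 \<le> y" "p \<le> q" "q \<le> r"
  shows "y powr q \<le> y powr p + y powr r"
proof (cases "y \<le> 1")
  case True
  then have "y powr q \<le> y powr p" using assms by (intro powr_mono') auto
  then show ?thesis by (simp add: add_increasing2)
next
  case False
  then have "y powr q \<le> y powr r" using assms by (intro powr_mono) auto
  then show ?thesis by (simp add: add_increasing)
qed

text \<open>Serves for \<open>q\<close> between 1 and 3 on time slices of \<open>u\<close>, and for
  the exponent 1 between \<open>\<delta>\<close> and 3 on the initial datum when
  \<open>lam = 0\<close>.\<close>

lemma
  assumes p: "f \<in> Lp M p" and r: "f \<in> Lp M r" and q: "p \<le> q" "q \<le> r"
  shows Lp_interpolation: "f \<in> Lp M q"
    and Lp_interpolation_bound: "(LINT x|M. \<bar>f x\<bar> powr q) \<le> (LINT x|M. \<bar>f x\<bar> powr p) + (LINT x|M. \<bar>f x\<bar> powr r)"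
proof -
  have [measurable]: "f \<in> borel_measurable M" using p by (simp add: Lp_def)
  have sum: "integrable M (\<lambda>x. \<bar>f x\<bar> powr p + \<bar>f x\<bar> powr r)" using p r by (simp add: Lp_def)
  have le: "\<bar>f x\<bar> powr q \<le> \<bar>f x\<bar> powr p + \<bar>f x\<bar> powr r" for x
    using q by (intro powr_le_add_powr) auto
  have int: "integrable M (\<lambda>x. \<bar>f x\<bar> powr q)"
    by (rule Bochner_Integration.integrable_bound[OF sum]) (use le in \<open>auto intro!: AE_I2\<close>)
  then show "f \<in> Lp M q" by (simp add: Lp_def)
  have "(LINT x|M. \<bar>f x\<bar> powr q) \<le> (LINT x|M. \<bar>f x\<bar> powr p + \<bar>f x\<bar> powr r)"
    using int sum le by (rule integral_mono)
  then show "(LINT x|M. \<bar>f x\<bar> powr q) \<le> (LINT x|M. \<bar>f x\<bar> powr p) + (LINT x|M. \<bar>f x\<bar> powr r)"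
    using p r by (simp add: Lp_def)
qed

text \<open>The bound for every \<open>q\<close> is a formula in the bounds for 1 and 3, so it holds
  outside the null sets of these two exponents.\<close>

lemma lp_norm_interpolation:
  assumes f: "f \<in> Lp M 1" "f \<in> Lp M 3" and C: "lp_norm M 1 f \<le> C1" "lp_norm M 3 f \<le> C3"
    and q: "1 \<le> q" "q \<le> 3"
  shows "lp_norm M q f \<le> (C1 + C3 powr 3) powr (1 / q)"
proof -
  have "(LINT x|M. \<bar>f x\<bar> powr 1) \<le> C1" using C(1) by (simp add: lp_norm_def)
  moreover have "(LINT x|M. \<bar>f x\<bar> powr 3) \<le> C3 powr 3"
  proof -
    have "(LINT x|M. \<bar>f x\<bar> powr 3) = (lp_norm M 3 f) powr 3"
      by (simp add: lp_norm_def powr_powr)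
    also have "\<dots> \<le> C3 powr 3" using C(2) by (intro powr_mono2) (auto simp: lp_norm_def)
    finally show ?thesis .
  qed
  ultimately show ?thesis
    unfolding lp_norm_def using Lp_interpolation_bound[OF f q] q by (intro powr_mono2) auto
qed

text \<open>The seminorms in \<open>is_distribution\<close> are suprema in the reals, which dominate
  the values only when the range is bounded.\<close>

lemma Cc_inf_bdd_above:
  fixes \<phi> :: "real \<Rightarrow> real"
  assumes "\<phi> \<in> Cc_inf U"
  shows "bdd_above (range (\<lambda>x. \<bar>\<phi> x\<bar>))" and "bdd_above (range (\<lambda>x. \<bar>pd 1 \<phi> x\<bar>))"
proof -
  have "bdd_above (range (\<lambda>x. \<bar>f x\<bar>))"
    if f: "continuous_on (supp \<phi>) f" "\<And>x. x \<notin> supp \<phi> \<Longrightarrow> f x = 0" for f :: "real \<Rightarrow> real"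
  proof -
    have "bounded (f ` supp \<phi>)"
      using f Cc_inf_supp(1)[OF assms] by (intro compact_imp_bounded compact_continuous_image)
    then obtain B where B: "\<forall>y\<in>f ` supp \<phi>. norm y \<le> B" unfolding bounded_iff by blast
    have "\<bar>f x\<bar> \<le> max B 0" for x
      using B f(2)[of x] by (cases "x \<in> supp \<phi>") (auto simp: max.coboundedI1)
    then show ?thesis by (auto simp: bdd_above_def)
  qed
  then show "bdd_above (range (\<lambda>x. \<bar>\<phi> x\<bar>))" "bdd_above (range (\<lambda>x. \<bar>pd 1 \<phi> x\<bar>))"
    using Cc_inf_continuous[OF assms] Cc_inf_pd_continuous[OF assms] Cc_inf_eq_0[OF assms]
      Cc_inf_pd_eq_0[OF assms] by auto
qed

lemma reg_distr_bound:
  fixes f \<psi> :: "real \<Rightarrow> real"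
  assumes f: "f \<in> Lp_loc U 1" and U: "U \<in> sets borel" and K: "compact K" "K \<subseteq> U"
    and \<psi>: "continuous_on UNIV \<psi>" "\<And>x. x \<notin> K \<Longrightarrow> \<psi> x = 0" "bdd_above (range (\<lambda>x. \<bar>\<psi> x\<bar>))"
  shows "\<bar>LINT x|lebesgue_on U. f x * \<psi> x\<bar> \<le> (LINT x|lebesgue_on K. \<bar>f x\<bar>) * (SUP x. \<bar>\<psi> x\<bar>)"
proof -
  have \<psi>K: "continuous_on K \<psi>" using \<psi>(1) continuous_on_subset by blast
  have fK: "integrable (lebesgue_on K) f" using f K by (simp add: Lp_loc_1_iff)
  have fL: "f \<in> Lp_loc K 1" using f K by (auto simp: Lp_loc_1_iff)
  have int: "integrable (lebesgue_on K) (\<lambda>x. f x * \<psi> x)"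
    using Lp_loc_mult_integrable[OF fL K(1) order_refl _ \<psi>K \<psi>(2)] K by (simp add: borel_compact)
  have "\<bar>LINT x|lebesgue_on U. f x * \<psi> x\<bar> = \<bar>LINT x|lebesgue_on K. f x * \<psi> x\<bar>"
    using Lp_loc_mult_integral[OF f K U \<psi>K \<psi>(2)] by simp
  also have "\<dots> \<le> (LINT x|lebesgue_on K. \<bar>f x * \<psi> x\<bar>)" by (rule integral_abs_bound)
  also have "\<dots> \<le> (LINT x|lebesgue_on K. \<bar>f x\<bar> * (SUP x. \<bar>\<psi> x\<bar>))"
    using fK cSUP_upper[OF _ \<psi>(3)]
    by (intro integral_mono[OF integrable_abs[OF int]]) (auto simp: abs_mult mult_left_mono)
  finally show ?thesis by simp
qed

text \<open>The order is at most one: on each compact set \<open>h\<close> pairs with the test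
  function and \<open>w\<close> with its derivative, and the constants are the integrals of
  \<open>\<bar>h\<bar>\<close> and \<open>\<bar>w\<bar>\<close> over that set.\<close>

lemma is_distribution_add_deriv:
  assumes U: "U \<in> sets borel" and h: "h \<in> Lp_loc U 1" and w: "w \<in> Lp_loc U 1"
  shows "is_distribution U (\<lambda>\<phi>. reg_distr U h \<phi> + distr_deriv (reg_distr U w) \<phi>)"
  unfolding is_distribution_def
proof (intro conjI ballI allI impI)
  fix \<phi> \<psi> :: "real \<Rightarrow> real" and c d :: real
  assume \<phi>: "\<phi> \<in> Cc_inf U" and \<psi>: "\<psi> \<in> Cc_inf U"
  have pd: "pd 1 (\<lambda>x. c * \<phi> x + d * \<psi> x) = (\<lambda>x. c * pd 1 \<phi> x + d * pd 1 \<psi> x)"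
    by (intro ext pd_real_eq DERIV_add DERIV_cmult Cc_inf_real_derivative[OF \<phi>] Cc_inf_real_derivative[OF \<psi>])
  have lin: "(LINT x|lebesgue_on U. f x * (c * a x + d * b x))
      = c * (LINT x|lebesgue_on U. f x * a x) + d * (LINT x|lebesgue_on U. f x * b x)"
    if "integrable (lebesgue_on U) (\<lambda>x. f x * a x)" "integrable (lebesgue_on U) (\<lambda>x. f x * b x)"
    for f a b :: "real \<Rightarrow> real"
  proof -
    have "(LINT x|lebesgue_on U. f x * (c * a x + d * b x))
        = (LINT x|lebesgue_on U. c * (f x * a x) + d * (f x * b x))"
      by (intro Bochner_Integration.integral_cong) (auto simp: algebra_simps)
    then show ?thesis using that by simp
  qed
  have "reg_distr U h (\<lambda>x. c * \<phi> x + d * \<psi> x) = c * reg_distr U h \<phi> + d * reg_distr U h \<psi>"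
    unfolding reg_distr_def
    by (rule lin[OF Lp_loc_test_integrable[OF h \<phi> U] Lp_loc_test_integrable[OF h \<psi> U]])
  moreover have "reg_distr U w (pd 1 (\<lambda>x. c * \<phi> x + d * \<psi> x))
      = c * reg_distr U w (pd 1 \<phi>) + d * reg_distr U w (pd 1 \<psi>)"
    unfolding reg_distr_def pd
    by (rule lin[OF Lp_loc_test_pd_integrable[OF w \<phi> U] Lp_loc_test_pd_integrable[OF w \<psi> U]]) auto
  ultimately show "reg_distr U h (\<lambda>x. c * \<phi> x + d * \<psi> x) + distr_deriv (reg_distr U w) (\<lambda>x. c * \<phi> x + d * \<psi> x)
      = c * (reg_distr U h \<phi> + distr_deriv (reg_distr U w) \<phi>) + d * (reg_distr U h \<psi> + distr_deriv (reg_distr U w) \<psi>)"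
    by (simp add: distr_deriv_def algebra_simps)
next
  fix K assume K: "compact K \<and> K \<subseteq> U"
  define C where "C = (LINT x|lebesgue_on K. \<bar>h x\<bar>) + (LINT x|lebesgue_on K. \<bar>w x\<bar>)"
  have "\<bar>reg_distr U h \<phi> + distr_deriv (reg_distr U w) \<phi>\<bar> \<le> C * (\<Sum>j\<le>1. SUP x. \<bar>(pd 1 ^^ j) \<phi> x\<bar>)"
    if \<phi>: "\<phi> \<in> Cc_inf U" and sub: "supp \<phi> \<subseteq> K" for \<phi>
  proof -
    let ?A = "SUP x. \<bar>\<phi> x\<bar>" and ?B = "SUP x. \<bar>pd 1 \<phi> x\<bar>"
    have out: "\<phi> x = 0" "pd 1 \<phi> x = 0" if "x \<notin> K" for x
      using that sub Cc_inf_eq_0[OF \<phi>, of x] Cc_inf_pd_eq_0[OF \<phi>, of x 1] by blast+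
    have "0 \<le> ?A" "0 \<le> ?B"
      using Cc_inf_bdd_above[OF \<phi>] by (auto intro: cSUP_upper2)
    moreover have "0 \<le> (LINT x|lebesgue_on K. \<bar>h x\<bar>)" "0 \<le> (LINT x|lebesgue_on K. \<bar>w x\<bar>)" by auto
    moreover have "\<bar>reg_distr U h \<phi>\<bar> \<le> (LINT x|lebesgue_on K. \<bar>h x\<bar>) * ?A"
      unfolding reg_distr_def
      using K out Cc_inf_continuous[OF \<phi>] Cc_inf_bdd_above[OF \<phi>]
      by (intro reg_distr_bound h U) auto
    moreover have "\<bar>distr_deriv (reg_distr U w) \<phi>\<bar> \<le> (LINT x|lebesgue_on K. \<bar>w x\<bar>) * ?B"
      unfolding reg_distr_def distr_deriv_def abs_minus_cancel
      using K out Cc_inf_pd_continuous[OF \<phi>] Cc_inf_bdd_above[OF \<phi>]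
      by (intro reg_distr_bound w U) auto
    \<comment> \<open>Two bounds with different constants are merged into one product; the mixed
      terms are nonnegative.\<close>
    moreover have "\<bar>x + y\<bar> \<le> (a + b) * (A + B)"
      if "0 \<le> A" "0 \<le> B" "0 \<le> a" "0 \<le> b" "\<bar>x\<bar> \<le> a * A" "\<bar>y\<bar> \<le> b * B" for x y a b A B :: real
    proof -
      have "0 \<le> a * B" "0 \<le> b * A" using that by auto
      moreover have "(a + b) * (A + B) = a * A + a * B + (b * A + b * B)" by (simp add: algebra_simps)
      ultimately show ?thesis using that(5,6) by linarith
    qed
    ultimately have "\<bar>reg_distr U h \<phi> + distr_deriv (reg_distr U w) \<phi>\<bar> \<le> C * (?A + ?B)"
      unfolding C_def by blast
    then show ?thesis by simp
  qed
  then show "\<exists>C m. \<forall>\<phi>\<in>Cc_inf U. supp \<phi> \<subseteq> K \<longrightarrow>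
      \<bar>reg_distr U h \<phi> + distr_deriv (reg_distr U w) \<phi>\<bar> \<le> C * (\<Sum>j\<le>m. SUP x. \<bar>(pd 1 ^^ j) \<phi> x\<bar>)"
    by blast
qed

section \<open>The weight \<open>rho\<close> and its consequences for \<open>u0\<close> and
  \<open>h_fun\<close>\<close>

lemma rho_ge_power2:
  assumes "0 \<le> lam" "0 \<le> x"
  shows "x\<^sup>2 \<le> rho lam x"
proof -
  have "x\<^sup>2 = sqrt x * x * sqrt x" using assms by (simp add: power2_eq_square mult_ac)
  also have "\<dots> \<le> sqrt x * (x + lam) * sqrt (x + 2 * lam)"
    using assms by (intro mult_mono) auto
  finally show ?thesis by (simp add: rho_def)
qed

lemma rho_pos: "0 \<le> lam \<Longrightarrow> 0 < x \<Longrightarrow> 0 < rho lam x"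
  by (simp add: rho_def)

lemma rho_continuous: "continuous_on A (rho lam)"
  unfolding rho_def[abs_def] by (intro continuous_intros)

lemma borel_measurable_lebesgue_on_if_borel:
  "f \<in> borel_measurable borel \<Longrightarrow> f \<in> borel_measurable (lebesgue_on S)"
  by (rule measurable_restrict_space1) (rule measurable_completion, simp)

lemma integrable_imp_Lp_loc_1:
  fixes f :: "'a::euclidean_space \<Rightarrow> real"
  assumes f: "integrable (lebesgue_on U) f" and U: "U \<in> sets lebesgue"
  shows "f \<in> Lp_loc U 1"
  unfolding Lp_loc_1_iff
proof safe
  fix K assume K: "compact K" "K \<subseteq> U"
  have "integrable lebesgue (\<lambda>x. indicator U x *\<^sub>R f x)"
    using f U by (simp add: integrable_restrict_space)
  then have "integrable lebesgue (\<lambda>x. indicator K x *\<^sub>R (indicator U x *\<^sub>R f x))"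
    by (rule integrable_mult_indicator[OF compact_imp_sets_lebesgue[OF K(1)]])
  moreover have "indicator K x *\<^sub>R (indicator U x *\<^sub>R f x) = indicator K x *\<^sub>R f x" for x
    using K by (auto simp: indicator_def)
  ultimately have "integrable lebesgue (\<lambda>x. indicator K x *\<^sub>R f x)" by (simp only:)
  then show "integrable (lebesgue_on K) f"
    using compact_imp_sets_lebesgue[OF K(1)] by (simp add: integrable_restrict_space)
qed

lemma integrable_nu_iff:
  assumes "0 \<le> lam" "f \<in> borel_measurable (lebesgue_on {0<..})"
  shows "integrable (nu lam) f \<longleftrightarrow> integrable (lebesgue_on {0<..}) (\<lambda>x. 1 / rho lam x * f x)"
    and "(LINT x|nu lam. f x) = (LINT x|lebesgue_on {0<..}. 1 / rho lam x * f x)"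
proof -
  have m: "(\<lambda>x. 1 / rho lam x) \<in> borel_measurable (lebesgue_on {0<..})"
    using borel_measurable_continuous_onI[OF rho_continuous]
    by (intro borel_measurable_lebesgue_on_if_borel) auto
  have nn: "AE x in lebesgue_on {0<..}. 0 \<le> 1 / rho lam x"
    using rho_pos[OF assms(1)] by (intro AE_I2) (auto simp: space_restrict_space less_imp_le)
  show "integrable (nu lam) f \<longleftrightarrow> integrable (lebesgue_on {0<..}) (\<lambda>x. 1 / rho lam x * f x)"
    unfolding nu_def using integrable_density[OF assms(2) m nn] by simp
  show "(LINT x|nu lam. f x) = (LINT x|lebesgue_on {0<..}. 1 / rho lam x * f x)"
    unfolding nu_def using integral_density[OF assms(2) m nn] by simp
qed

lemma sets_nu: "sets (nu lam) = sets (lebesgue_on {0<..})"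
  by (simp add: nu_def)

lemma borel_measurable_nu: "borel_measurable (nu lam) = borel_measurable (lebesgue_on {0<..})"
  by (rule measurable_cong_sets[OF sets_nu refl])

text \<open>On a compact subset of the open half-line the continuous positive \<open>rho\<close> is
  bounded, so the weight of \<open>nu\<close> can be undone there by multiplying with
  \<open>rho\<close>.\<close>

lemma Lp_nu_1_imp_Lp_loc:
  assumes lam: "0 \<le> lam" and f: "f \<in> Lp (nu lam) 1"
  shows "f \<in> Lp_loc {0<..} 1"
  unfolding Lp_loc_1_iff
proof safe
  fix K :: "real set" assume K: "compact K" "K \<subseteq> {0<..}"
  let ?F = "\<lambda>x. 1 / rho lam x * f x"
  have "f \<in> borel_measurable (lebesgue_on {0<..})"
    using f by (simp add: Lp_def borel_measurable_nu)
  from integrable_nu_iff(1)[OF lam this] f have "integrable (lebesgue_on {0<..}) ?F"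
    unfolding Lp_1_iff by blast
  then have "?F \<in> Lp_loc {0<..} 1" by (rule integrable_imp_Lp_loc_1) auto
  then have "?F \<in> Lp_loc K 1" using K by (auto simp: Lp_loc_1_iff)
  moreover have "continuous_on K (\<lambda>x. indicator K x * rho lam x)"
    using rho_continuous[of K lam] by (auto cong: continuous_on_cong)
  ultimately have "integrable (lebesgue_on K) (\<lambda>x. ?F x * (indicator K x * rho lam x))"
    using K by (intro Lp_loc_mult_integrable[OF _ K(1) order_refl]) (auto simp: borel_compact)
  moreover have "rho lam x \<noteq> 0" if "x \<in> K" for x using rho_pos[OF lam, of x] K that by auto
  ultimately show "integrable (lebesgue_on K) f"
    by (elim Bochner_Integration.integrable_cong[THEN iffD1, rotated 2]) (auto simp: space_restrict_space)
qed

text \<open>For \<open>lam = 0\<close> hypothesis (H) offers the exponents \<open>\<delta>\<close>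
  and 3; the exponent 1 lies between them.\<close>

lemma hyp_H_Lp_loc:
  assumes "0 \<le> lam" "hyp_H lam \<delta> u0 g"
  shows "u0 \<in> Lp_loc {0<..} 1"
proof (rule Lp_nu_1_imp_Lp_loc[OF assms(1)])
  show "u0 \<in> Lp (nu lam) 1"
  proof (cases "lam = 0")
    case True
    then show ?thesis
      using assms(2) Lp_interpolation[of u0 "nu lam" \<delta> 3 1] unfolding hyp_H_def by simp
  qed (use assms(2) in \<open>auto simp: hyp_H_def\<close>)
qed

text \<open>Essential boundedness of \<open>rho lam x * g x\<close> together with
  \<open>x\<^sup>2 \<le> rho lam x\<close> dominates \<open>g\<close> by a multiple of
  \<open>x powr (- 2)\<close>. This is integrable near infinity but not near 0, so the lower limit
  has to stay away from \<open>lam\<close>.\<close>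

lemma h_fun_continuous:
  assumes lam: "0 \<le> lam" and g: "g \<in> borel_measurable (lebesgue_on {0<..})"
    and bound: "linf_norm (lebesgue_on {0<..}) (\<lambda>x. rho lam x * g x) < \<infinity>"
  shows "continuous_on {lam<..} (h_fun lam g)"
proof -
  obtain B where "linf_norm (lebesgue_on {0<..}) (\<lambda>x. rho lam x * g x) \<le> ereal B"
    using bound by (cases "linf_norm (lebesgue_on {0<..}) (\<lambda>x. rho lam x * g x)") auto
  then have le: "esssup (lebesgue_on {0<..}) (\<lambda>x. ereal \<bar>rho lam x * g x\<bar>) \<le> ereal B"
    by (simp add: linf_norm_def)
  have "AE x in lebesgue_on {0<..}. ereal \<bar>rho lam x * g x\<bar>
      \<le> esssup (lebesgue_on {0<..}) (\<lambda>x. ereal \<bar>rho lam x * g x\<bar>)"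
    by (rule esssup_AE)
  then have "AE x in lebesgue_on {0<..}. \<bar>rho lam x * g x\<bar> \<le> B"
    by eventually_elim (use order_trans[OF _ le] in force)
  then have B: "AE x in lebesgue. 0 < x \<longrightarrow> \<bar>rho lam x * g x\<bar> \<le> B"
    by (simp add: AE_restrict_space_iff)
  have gint: "integrable lebesgue (\<lambda>x. indicator {c<..} x * g x)" if c: "0 < c" for c
  proof (rule Bochner_Integration.integrable_bound)
    have "((\<lambda>x. x powr (- 2)) has_integral - (c powr (- 2 + 1)) / (- 2 + 1)) {c..}"
      using c by (intro has_integral_powr_to_inf) auto
    then have "(\<lambda>x. x powr (- 2)) absolutely_integrable_on {c..}"
      by (intro nonnegative_absolutely_integrable_1) (auto simp: integrable_on_def)
    then have "integrable lebesgue (\<lambda>x. indicator {c..} x * x powr (- 2))"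
      by (simp add: set_integrable_def)
    then show "integrable lebesgue (\<lambda>x. \<bar>B\<bar> * (indicator {c..} x * x powr (- 2)))" by simp
    have "(\<lambda>x. indicator {0<..} x * g x) \<in> borel_measurable lebesgue"
      using g by (simp add: borel_measurable_restrict_space_iff mult.commute)
    from borel_measurable_times[OF borel_measurable_indicator this, of "{c<..}"]
    have "(\<lambda>x. indicator {c<..} x * (indicator {0<..} x * g x)) \<in> borel_measurable lebesgue" by simp
    moreover have "indicator {c<..} x * (indicator {0<..} x * g x) = indicator {c<..} x * g x" for x
      using c by (auto simp: indicator_def)
    ultimately show "(\<lambda>x. indicator {c<..} x * g x) \<in> borel_measurable lebesgue" by simp
    show "AE x in lebesgue. norm (indicator {c<..} x * g x) \<le> norm (\<bar>B\<bar> * (indicator {c..} x * x powr (- 2)))"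
      using B
    proof eventually_elim
      case (elim x)
      show ?case
      proof (cases "c < x")
        case True
        then have x: "0 < x" using c by simp
        have "x\<^sup>2 * \<bar>g x\<bar> \<le> rho lam x * \<bar>g x\<bar>"
          using rho_ge_power2[OF lam, of x] x by (intro mult_right_mono) auto
        also have "\<dots> \<le> \<bar>B\<bar>" using elim x rho_pos[OF lam x] by (simp add: abs_mult)
        finally have "\<bar>g x\<bar> \<le> \<bar>B\<bar> / x\<^sup>2" using x by (simp add: pos_le_divide_eq mult.commute)
        then show ?thesis using True x by (simp add: powr_minus_divide)
      qed simp
    qed
  qed
  have h: "h_fun lam g p = - (LINT q|lebesgue. indicator {p<..} q * g (q - lam))" for p
    by (simp add: h_fun_def integral_restrict_space)
  have gint': "integrable lebesgue (\<lambda>q. indicator {c<..} q * g (q - lam))" if "lam < c" for c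
  proof -
    have eq: "indicator {c - lam<..} (- lam + q) * g (- lam + q) = indicator {c<..} q * g (q - lam)" for q
      by (auto simp: indicator_def)
    show ?thesis
      using integrable_lebesgue_plus[OF gint[of "c - lam"], of "- lam"] that unfolding eq by simp
  qed
  have "isCont (h_fun lam g) p" if p: "lam < p" for p
  proof -
    \<comment> \<open>Near \<open>p\<close> all lower limits stay above the fixed \<open>c\<close>,
      and the integrand cut at \<open>c\<close> dominates them all.\<close>
    define c where "c = (lam + p) / 2"
    have c: "lam < c" "c < p" using p by (auto simp: c_def)
    have "continuous_on {c<..} (h_fun lam g)"
    proof (rule continuous_on_sequentiallyI)
      fix s a assume s: "\<forall>n. s n \<in> {c<..}" and a: "a \<in> {c<..}" "s \<longlonglongrightarrow> a"
      have "(\<lambda>n. LINT q|lebesgue. indicator {s n<..} q * g (q - lam)) \<longlonglongrightarrow>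
          (LINT q|lebesgue. indicator {a<..} q * g (q - lam))"
      proof (rule integral_dominated_convergence)
        have "(\<lambda>q. indicator {b<..} q * g (q - lam)) \<in> borel_measurable lebesgue" if "c < b" for b
          by (rule borel_measurable_integrable[OF gint']) (use c(1) that in simp)
        then show "(\<lambda>q. indicator {a<..} q * g (q - lam)) \<in> borel_measurable lebesgue"
          "(\<lambda>q. indicator {s n<..} q * g (q - lam)) \<in> borel_measurable lebesgue" for n
          using s a by auto
        show "integrable lebesgue (\<lambda>q. norm (indicator {c<..} q * g (q - lam)))"
          using gint'[OF c(1)] by simp
        show "AE q in lebesgue. norm (indicator {s n<..} q * g (q - lam)) \<le> norm (indicator {c<..} q * g (q - lam))" for n
          using s[rule_format, of n] by (intro AE_I2) (auto simp: indicator_def)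
        show "AE q in lebesgue. (\<lambda>n. indicator {s n<..} q * g (q - lam)) \<longlonglongrightarrow> indicator {a<..} q * g (q - lam)"
        \<comment> \<open>The indicators of \<open>{s n<..}\<close> converge to that of
          \<open>{a<..}\<close> except possibly at \<open>q = a\<close>, a null set; elsewhere they
          are eventually constant.\<close>
        proof (rule AE_mp[OF AE_completion[OF AE_lborel_singleton[of a]]], intro AE_I2 impI tendsto_intros)
          fix q assume "q \<noteq> a"
          then consider "q < a" | "a < q" by linarith
          then have "\<forall>\<^sub>F n in sequentially. indicator {s n<..} q = (indicator {a<..} q :: real)"
          proof cases
            case 1
            from order_tendstoD(1)[OF a(2) this] show ?thesis
              by eventually_elim (use 1 in \<open>auto simp: indicator_def\<close>)
          next
            case 2
            from order_tendstoD(2)[OF a(2) this] show ?thesis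
              by eventually_elim (use 2 in \<open>auto simp: indicator_def\<close>)
          qed
          then show "(\<lambda>n. indicator {s n<..} q :: real) \<longlonglongrightarrow> indicator {a<..} q" by (rule tendsto_eventually)
        qed
      qed
      then show "(\<lambda>n. h_fun lam g (s n)) \<longlonglongrightarrow> h_fun lam g a" unfolding h by (rule tendsto_minus)
    qed
    then show ?thesis using c by (simp add: continuous_on_eq_continuous_at)
  qed
  then show ?thesis by (auto intro: continuous_at_imp_continuous_on)
qed

text \<open>\<open>g\<close> is tied to \<open>f\<close> at positive \<open>k\<close> only: at
  \<open>k = 0\<close> the factor \<open>1 / k ^ 3\<close> is 0 by convention and
  \<open>k ^ 3 * W_star lam u (t, k)\<close> does not recover \<open>u\<close>. Norms are preserved
  exactly, so bounds uniform in t carry over from \<open>nu\<close>.\<close>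

lemma
  fixes f :: "real \<Rightarrow> real"
  assumes lam: "0 \<le> lam" and fm: "set_borel_measurable borel {0<..} f" and f: "f \<in> Lp (nu lam) q"
    and g: "\<And>k. 0 < k \<Longrightarrow> g k = f (x_of_k lam k)"
  shows Lp_x_of_k: "g \<in> Lp (density (lebesgue_on {0<..}) (\<lambda>k. ennreal (1 / (1 + lam\<^sup>2 * k\<^sup>2)))) q"
    and lp_norm_x_of_k: "lp_norm (density (lebesgue_on {0<..}) (\<lambda>k. ennreal (1 / (1 + lam\<^sup>2 * k\<^sup>2)))) q g
      = lp_norm (nu lam) q f"
proof -
  let ?M = "density (lebesgue_on {0<..}) (\<lambda>k. ennreal (1 / (1 + lam\<^sup>2 * k\<^sup>2)))"
  let ?F = "\<lambda>x. 1 / rho lam x * \<bar>f x\<bar> powr q"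
  let ?G = "\<lambda>k. 1 / (1 + lam\<^sup>2 * k\<^sup>2) * \<bar>g k\<bar> powr q"
  note image = x_of_k_image[OF lam]
  have pw: "set_borel_measurable borel {0<..} (\<lambda>x. \<bar>h x\<bar> powr q)"
    if "set_borel_measurable borel {0<..} h" for h :: "real \<Rightarrow> real"
  proof -
    have [measurable]: "(\<lambda>x. indicator {0<..} x * h x) \<in> borel_measurable borel"
      using that by (simp add: set_borel_measurable_def)
    have "(\<lambda>x. indicator {0<..} x * \<bar>indicator {0<..} x * h x\<bar> powr q) \<in> borel_measurable borel"
      by measurable
    moreover have "indicator {0<..} x * \<bar>indicator {0<..} x * h x\<bar> powr q = indicator {0<..} x * \<bar>h x\<bar> powr q" for x
      by (auto simp: indicator_def)
    ultimately show ?thesis by (simp add: set_borel_measurable_def)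
  qed
  have ml: "set_borel_measurable borel {0<..} (\<lambda>x. w x * h x)"
    if "set_borel_measurable borel {0<..} h" "w \<in> borel_measurable borel" for w h :: "real \<Rightarrow> real"
    using borel_measurable_times[OF that(2), of "\<lambda>x. indicator {0<..} x * h x"] that(1)
    by (simp add: set_borel_measurable_def mult.left_commute)
  have [measurable]: "rho lam \<in> borel_measurable borel" by (rule borel_measurable_continuous_onI[OF rho_continuous])
  have wm: "(\<lambda>k. 1 / (1 + lam\<^sup>2 * k\<^sup>2)) \<in> borel_measurable borel" by measurable
  have Fm: "set_borel_measurable borel {0<..} ?F" by (rule ml[OF pw[OF fm]]) measurable
  have S: "{0::real<..} \<in> sets borel" "{0::real<..} \<subseteq> {0<..}" "x_of_k lam ` {0<..} \<in> sets borel"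
    unfolding image by auto
  have "set_borel_measurable borel {0<..} (\<lambda>k. f (x_of_k lam k))"
    using x_of_k_measurable[OF lam S] fm image by simp
  moreover have "set_borel_measurable borel {0<..} g \<longleftrightarrow> set_borel_measurable borel {0<..} (\<lambda>k. f (x_of_k lam k))"
    unfolding set_borel_measurable_def by (intro measurable_cong) (auto simp: indicator_def g)
  ultimately have gm: "set_borel_measurable borel {0<..} g" by simp
  have Gm: "set_borel_measurable borel {0<..} ?G" by (rule ml[OF pw[OF gm] wm])
  have gl: "g \<in> borel_measurable (lebesgue_on {0<..})" by (rule borel_measurable_lebesgue_on[OF S(1) gm])
  have fpl: "(\<lambda>x. \<bar>f x\<bar> powr q) \<in> borel_measurable (lebesgue_on {0<..})"
    by (rule borel_measurable_lebesgue_on[OF S(1) pw[OF fm]])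
  have gpl: "(\<lambda>x. \<bar>g x\<bar> powr q) \<in> borel_measurable (lebesgue_on {0<..})"
    by (rule borel_measurable_lebesgue_on[OF S(1) pw[OF gm]])
  have wl: "(\<lambda>k. 1 / (1 + lam\<^sup>2 * k\<^sup>2)) \<in> borel_measurable (lebesgue_on {0<..})"
    by (rule borel_measurable_lebesgue_on_if_borel[OF wm])
  have wn: "AE k in lebesgue_on {0<..}. 0 \<le> 1 / (1 + lam\<^sup>2 * k\<^sup>2)" by (intro AE_I2) auto
  have Fi: "set_integrable lborel {0<..} ?F"
    using f integrable_nu_iff(1)[OF lam fpl] integrable_lebesgue_on_iff[OF S(1) Fm] by (simp add: Lp_def)
  have eq: "\<bar>x_of_k_deriv lam k\<bar> * ?F (x_of_k lam k) = ?G k" if "k \<in> {0<..}" for k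
  proof -
    have k: "0 < k" using that by simp
    have "\<bar>x_of_k_deriv lam k\<bar> * ?F (x_of_k lam k)
        = (\<bar>x_of_k_deriv lam k\<bar> * (1 / rho lam (x_of_k lam k))) * \<bar>f (x_of_k lam k)\<bar> powr q"
      by (rule mult.assoc[symmetric])
    then show ?thesis unfolding x_of_k_deriv_weight(1)[OF lam k] g[OF k] .
  qed
  have "set_integrable lborel {0<..} (\<lambda>k. \<bar>x_of_k_deriv lam k\<bar> * ?F (x_of_k lam k))"
    using x_of_k_set_integrable[OF lam S, of ?F] Fm Fi unfolding image by blast
  then have Gi: "set_integrable lborel {0<..} ?G"
    by (rule set_integrable_cong[THEN iffD1, rotated 3]) (use eq in auto)
  have "(LINT k:{0<..}|lborel. ?G k) = (LINT k:{0<..}|lborel. \<bar>x_of_k_deriv lam k\<bar> * ?F (x_of_k lam k))"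
    using eq by (intro set_lebesgue_integral_cong) auto
  also have "\<dots> = (LINT x:{0<..}|lborel. ?F x)"
    using x_of_k_integral[OF lam S, of ?F] Fm Fi unfolding image by blast
  finally have int: "(LINT k:{0<..}|lborel. ?G k) = (LINT x:{0<..}|lborel. ?F x)" .
  show "g \<in> Lp ?M q"
    using gl Gi integrable_density[OF gpl wl wn] integrable_lebesgue_on_iff[OF S(1) Gm] by (simp add: Lp_def)
  show "lp_norm ?M q g = lp_norm (nu lam) q f"
    using int integral_density[OF gpl wl wn] integral_lebesgue_on_eq[OF S(1) Gm]
      integrable_nu_iff(2)[OF lam fpl] integral_lebesgue_on_eq[OF S(1) Fm]
    by (simp add: lp_norm_def)
qed

section \<open>The induced pair\<close>

lemma Lp_2_iff: "f \<in> Lp M 2 \<longleftrightarrow> f \<in> borel_measurable M \<and> integrable M (\<lambda>x. (f x)\<^sup>2)"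
proof -
  have "\<bar>y\<bar> powr 2 = y\<^sup>2" for y :: real by (cases "y = 0") simp_all
  then show ?thesis by (simp add: Lp_def)
qed

text \<open>\<open>v'\<close> is Borel on the whole space, so each of its slices is Borel, which
  fails for a general Lebesgue measurable function.\<close>

lemma Borel_representative:
  fixes v :: "'a::euclidean_space \<Rightarrow> real"
  assumes S: "S \<in> sets borel" and v: "v \<in> borel_measurable (lebesgue_on S)"
  obtains v' where "v' \<in> borel_measurable borel" "AE z in lebesgue. z \<in> S \<longrightarrow> v z = v' z"
proof -
  have "(\<lambda>z. indicator S z * v z) \<in> borel_measurable lebesgue"
    using v S by (simp add: borel_measurable_restrict_space_iff mult.commute[of _ "v _"])
  from completion_ex_borel_measurable_real[OF this]
  obtain v' where "v' \<in> borel_measurable lborel" and eq: "AE z in lborel. indicator S z * v z = v' z"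
    by blast
  moreover have "AE z in lebesgue. z \<in> S \<longrightarrow> v z = v' z"
    using AE_completion[OF eq] by eventually_elim auto
  ultimately show ?thesis using that by simp
qed

lemma AE_lebesgue_slices:
  fixes P :: "real \<times> real \<Rightarrow> bool"
  assumes "AE z in lebesgue. P z"
  shows "AE t in lborel. AE x in lebesgue. P (t, x)"
proof -
  have "AE z in lborel \<Otimes>\<^sub>M lborel. P z" using assms unfolding AE_completion_iff lborel_prod .
  from lborel_pair.AE_pair[OF this] show ?thesis by eventually_elim (rule AE_completion)
qed

lemma AE_lebesgue_on_iff:
  "S \<in> sets borel \<Longrightarrow> (AE t in lebesgue_on S. P t) \<longleftrightarrow> (AE t in lborel. t \<in> S \<longrightarrow> P t)"
  by (simp add: AE_restrict_space_iff AE_completion_iff)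

lemma has_wpd_translate:
  fixes f w :: "real \<Rightarrow> real"
  assumes f: "continuous_on {0<..} f" and w: "w \<in> borel_measurable borel"
    and int: "\<And>c d. 0 < c \<Longrightarrow> c < d \<Longrightarrow> set_integrable lborel {c..d} w"
    and prim: "\<And>c d. 0 < c \<Longrightarrow> c < d \<Longrightarrow> f d - f c = (LINT x:{c..d}|lborel. w x)"
  shows "has_wpd 1 {l<..} (\<lambda>p. f (p - l)) (\<lambda>p. w (p - l))"
proof (rule has_wpd_if_primitive)
  show "continuous_on {l<..} (\<lambda>p. f (p - l))"
    by (intro continuous_on_compose2[OF f]) (auto intro!: continuous_intros)
  have [measurable]: "w \<in> borel_measurable borel" by (rule w)
  show "set_borel_measurable borel {l<..} (\<lambda>p. w (p - l))"
    unfolding set_borel_measurable_def by measurable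
  fix c d assume cd: "l < c" "c < d"
  have eq: "indicator {c..d} x *\<^sub>R w (x - l) = indicator {c - l..d - l} (- l + 1 * x) *\<^sub>R w (- l + 1 * x)" for x
    by (auto simp: indicator_def)
  show "set_integrable lborel {c..d} (\<lambda>p. w (p - l))"
    using int[of "c - l" "d - l"] cd unfolding set_integrable_def eq
    by (intro lborel_integrable_real_affine) auto
  show "f (d - l) - f (c - l) = (LINT p:{c..d}|lborel. w (p - l))"
    using prim[of "c - l" "d - l"] cd
      lborel_integral_real_affine[of 1 "\<lambda>x. indicator {c - l..d - l} x *\<^sub>R w x" "- l"]
    unfolding set_lebesgue_integral_def eq by simp
qed

text \<open>Tonelli with the substitution on slices: at each time whose x-energy \<open>I t\<close>
  is finite the weighted k-energy equals \<open>I t\<close>, and \<open>I\<close> is integrable.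
  Local integrability follows from the weighted square, as the weight is continuous and positive on
  compact subsets.\<close>

lemma
  fixes v :: "real \<times> real \<Rightarrow> real"
  assumes lam: "0 \<le> lam" and vb: "v \<in> borel_measurable borel"
    and v2: "integrable lborel (\<lambda>z. indicator ({0<..<T} \<times> {0<..}) z * (v z)\<^sup>2)"
  shows x_of_k_L2: "integrable (lebesgue_on ({0<..<T} \<times> {0<..}))
      (\<lambda>z. (snd z)\<^sup>2 * sqrt (1 + lam\<^sup>2 * (snd z)\<^sup>2) * (v (fst z, x_of_k lam (snd z)) * x_of_k_deriv lam (snd z))\<^sup>2)"
    and x_of_k_Lp_loc: "(\<lambda>z. v (fst z, x_of_k lam (snd z)) * x_of_k_deriv lam (snd z)) \<in> Lp_loc ({0<..<T} \<times> {0<..}) 1"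
    and x_of_k_borel: "(\<lambda>z. v (fst z, x_of_k lam (snd z)) * x_of_k_deriv lam (snd z)) \<in> borel_measurable borel"
proof -
  let ?U = "{0<..<T} \<times> {0::real<..}"
  let ?D = "\<lambda>z. v (fst z, x_of_k lam (snd z)) * x_of_k_deriv lam (snd z)"
  let ?w = "\<lambda>k::real. k\<^sup>2 * sqrt (1 + lam\<^sup>2 * k\<^sup>2)"
  have U: "?U \<in> sets borel" by (intro borel_Times) auto
  have [measurable]: "v \<in> borel_measurable (borel \<Otimes>\<^sub>M borel)" using vb by (simp add: borel_prod)
  have [measurable]: "x_of_k lam \<in> borel_measurable borel"
    unfolding x_of_k_def[abs_def] by measurable
  have [measurable]: "x_of_k_deriv lam \<in> borel_measurable borel"
    unfolding x_of_k_deriv_def[abs_def] by measurable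
  have "?D \<in> borel_measurable (borel \<Otimes>\<^sub>M borel)" by measurable
  then show Dm: "?D \<in> borel_measurable borel" by (simp add: borel_prod)
  have [measurable]: "?D \<in> borel_measurable (lborel \<Otimes>\<^sub>M lborel)" using Dm by (simp add: lborel_prod)
  let ?H = "\<lambda>z. ?w (snd z) * (?D z)\<^sup>2"
  have Hm: "?H \<in> borel_measurable (borel \<Otimes>\<^sub>M borel)" by measurable
  then have Hs: "set_borel_measurable borel ?U ?H"
    using U unfolding set_borel_measurable_def by (simp add: borel_prod)
  define I where "I t = (\<integral>x. indicator ?U (t, x) * (v (t, x))\<^sup>2 \<partial>lborel)" for t
  have v2': "integrable (lborel \<Otimes>\<^sub>M lborel) (\<lambda>z. indicator ?U z * (v z)\<^sup>2)"
    using v2 by (simp add: lborel_prod)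
  have slice: "integrable lborel (\<lambda>k. indicator ?U (t, k) * ?H (t, k)) \<and>
      (\<integral>k. norm (indicator ?U (t, k) * ?H (t, k)) \<partial>lborel) = I t"
    if int: "integrable lborel (\<lambda>x. indicator ?U (t, x) * (v (t, x))\<^sup>2)" for t
  proof (cases "t \<in> {0<..<T}")
    case True
    have ind: "indicator ?U (t, x) = (indicator {0<..} x :: real)" for x using True by (simp add: indicator_times)
    note image = x_of_k_image[OF lam]
    have S: "{0::real<..} \<in> sets borel" "{0::real<..} \<subseteq> {0<..}" "x_of_k lam ` {0<..} \<in> sets borel"
      unfolding image by auto
    have fm: "set_borel_measurable borel {0<..} (\<lambda>x. (v (t, x))\<^sup>2)"
      unfolding set_borel_measurable_def by measurable
    have fi: "set_integrable lborel {0<..} (\<lambda>x. (v (t, x))\<^sup>2)"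
      using int by (simp add: set_integrable_def ind)
    have eq: "indicator ?U (t, k) * ?H (t, k)
        = indicator {0<..} k *\<^sub>R (\<bar>x_of_k_deriv lam k\<bar> * (v (t, x_of_k lam k))\<^sup>2)" for k
    proof (cases "0 < k")
      case k: True
      have "?H (t, k) = (v (t, x_of_k lam k))\<^sup>2 * ((x_of_k_deriv lam k)\<^sup>2 * ?w k)"
        by (simp add: power_mult_distrib mult_ac)
      also have "\<dots> = \<bar>x_of_k_deriv lam k\<bar> * (v (t, x_of_k lam k))\<^sup>2"
        unfolding x_of_k_deriv_weight(2)[OF lam k] by (rule mult.commute)
      finally show ?thesis by (simp only: ind) simp
    qed (simp only: ind, simp)
    have nn: "norm (indicator ?U (t, k) * ?H (t, k)) = indicator ?U (t, k) * ?H (t, k)" for k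
      by (simp add: indicator_def)
    have "set_integrable lborel {0<..} (\<lambda>k. \<bar>x_of_k_deriv lam k\<bar> * (v (t, x_of_k lam k))\<^sup>2)"
      using x_of_k_set_integrable[OF lam S, of "\<lambda>x. (v (t, x))\<^sup>2"] fm fi unfolding image by blast
    moreover have "(LINT k:{0<..}|lborel. \<bar>x_of_k_deriv lam k\<bar> * (v (t, x_of_k lam k))\<^sup>2)
        = (LINT x:{0<..}|lborel. (v (t, x))\<^sup>2)"
      using x_of_k_integral[OF lam S, of "\<lambda>x. (v (t, x))\<^sup>2"] fm fi unfolding image by blast
    ultimately show ?thesis
      unfolding nn unfolding eq I_def by (simp add: set_integrable_def set_lebesgue_integral_def ind)
  next
    case False
    then have "indicator ?U (t, x) = (0 :: real)" for x by (simp add: indicator_times)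
    then show ?thesis by (simp add: I_def)
  qed
  have AEi: "AE t in lborel. integrable lborel (\<lambda>x. indicator ?U (t, x) * (v (t, x))\<^sup>2)"
    using lborel_pair.AE_integrable_fst'[OF v2'] by simp
  have Im: "integrable lborel I" unfolding I_def using lborel_pair.integrable_fst'[OF v2'] by simp
  have [measurable]: "(\<lambda>z. indicator ?U z * ?H z) \<in> borel_measurable (lborel \<Otimes>\<^sub>M lborel)"
    using Hs by (simp add: set_borel_measurable_def lborel_prod)
  have "integrable (lborel \<Otimes>\<^sub>M lborel) (\<lambda>z. indicator ?U z * ?H z)"
  proof (rule lborel_pair.Fubini_integrable)
    show "integrable lborel (\<lambda>t. \<integral>k. norm (indicator ?U (t, k) * ?H (t, k)) \<partial>lborel)"
    proof (rule integrable_cong_AE_imp[OF Im])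
      show "(\<lambda>t. \<integral>k. norm (indicator ?U (t, k) * ?H (t, k)) \<partial>lborel) \<in> borel_measurable lborel"
        by (rule lborel.borel_measurable_lebesgue_integral) measurable
      show "AE t in lborel. I t = (\<integral>k. norm (indicator ?U (t, k) * ?H (t, k)) \<partial>lborel)"
        using AEi by eventually_elim (use slice in force)
    qed
    show "AE t in lborel. integrable lborel (\<lambda>k. indicator ?U (t, k) * ?H (t, k))"
      using AEi by eventually_elim (use slice in force)
  qed measurable
  then have "set_integrable lborel ?U ?H" by (simp add: set_integrable_def lborel_prod)
  then show Hi: "integrable (lebesgue_on ?U) ?H" using integrable_lebesgue_on_iff[OF U Hs] by simp
  have HL: "?H \<in> Lp_loc ?U 1" by (rule integrable_imp_Lp_loc_1[OF Hi]) (use U in auto)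
  have wpos: "0 < ?w k" if "0 < k" for k using that one_plus_pos[of lam k] by simp
  have "?w (snd z) \<noteq> 0" if "z \<in> ?U" for z using wpos[of "snd z"] that by (cases z) auto
  then have "continuous_on ?U (\<lambda>z. 1 / ?w (snd z))" by (intro continuous_intros) auto
  then have wL: "(\<lambda>z. 1 / ?w (snd z)) \<in> Lp_loc ?U 1" by (rule continuous_imp_Lp_loc_1)
  show "?D \<in> Lp_loc ?U 1"
    unfolding Lp_loc_1_iff
  proof safe
    fix K assume K: "compact K" "K \<subseteq> ?U"
    show "integrable (lebesgue_on K) ?D"
    proof (rule Bochner_Integration.integrable_bound)
      show "integrable (lebesgue_on K) (\<lambda>z. ?H z + 1 / ?w (snd z))"
        using HL wL K by (intro Bochner_Integration.integrable_add) (auto simp: Lp_loc_1_iff)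
      show "?D \<in> borel_measurable (lebesgue_on K)" by (rule borel_measurable_lebesgue_on_if_borel[OF Dm])
      \<comment> \<open>Expanding \<open>(w * \<bar>d\<bar> - 1)\<^sup>2 \<ge> 0\<close> bounds
        \<open>\<bar>d\<bar>\<close> by its weighted square plus the locally integrable
        \<open>1 / w\<close>.\<close>
      have amgm: "\<bar>d\<bar> \<le> w * d\<^sup>2 + 1 / w" if "0 < w" for d w :: real
      proof -
        have "0 \<le> (w * \<bar>d\<bar> - 1)\<^sup>2" by simp
        then have "2 * (w * \<bar>d\<bar>) \<le> w\<^sup>2 * d\<^sup>2 + 1" by (simp add: power2_eq_square algebra_simps)
        moreover have "0 \<le> w * \<bar>d\<bar>" using that by simp
        ultimately have "w * \<bar>d\<bar> \<le> w\<^sup>2 * d\<^sup>2 + 1" by linarith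
        also have "\<dots> = w * (w * d\<^sup>2 + 1 / w)" using that by (simp add: power2_eq_square algebra_simps)
        finally have "w * \<bar>d\<bar> \<le> w * (w * d\<^sup>2 + 1 / w)" .
        then show ?thesis using that by simp
      qed
      show "AE z in lebesgue_on K. norm (?D z) \<le> norm (?H z + 1 / ?w (snd z))"
      proof (rule AE_I2)
        fix z assume "z \<in> space (lebesgue_on K)"
        then have "0 < snd z" using K(2) by (cases z) (auto simp: space_restrict_space)
        from amgm[OF wpos[OF this], of "?D z"] show "norm (?D z) \<le> norm (?H z + 1 / ?w (snd z))" by simp
      qed
    qed
  qed
qed

theorem proposition5p1:
  fixes lam T \<delta> :: real
    and u0 g :: "real \<Rightarrow> real"
    and u :: "real \<times> real \<Rightarrow> real"
  assumes "0 \<le> lam" and "0 < T"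
    and "hyp_H lam \<delta> u0 g"
    and "constructed_weak_solution lam T \<delta> u0 g u"
  shows
    "\<comment> \<open>(i)\<close>
     (\<exists>C. AE t in lebesgue_on {0<..<T}. \<forall>q. q \<in> {1..3} \<or> (lam = 0 \<and> q = \<delta>) \<longrightarrow>
        (\<lambda>k. k ^ 3 * W_star lam u (t, k))
          \<in> Lp (density (lebesgue_on {0<..}) (\<lambda>k. ennreal (1 / (1 + lam\<^sup>2 * k\<^sup>2)))) q \<and>
        lp_norm (density (lebesgue_on {0<..}) (\<lambda>k. ennreal (1 / (1 + lam\<^sup>2 * k\<^sup>2)))) q
          (\<lambda>k. k ^ 3 * W_star lam u (t, k)) \<le> C q)
     \<and> (\<exists>D. has_wpd (0, 1) ({0<..<T} \<times> {0<..}) (\<lambda>(t, k). k ^ 3 * W_star lam u (t, k)) D \<and>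
          (AE t in lebesgue_on {0<..<T}.
             has_wpd 1 {0<..} (\<lambda>k. k ^ 3 * W_star lam u (t, k)) (\<lambda>k. D (t, k))) \<and>
          D \<in> Lp (density (lebesgue_on ({0<..<T} \<times> {0<..}))
                   (\<lambda>(t, k). ennreal (k\<^sup>2 * sqrt (1 + lam\<^sup>2 * k\<^sup>2)))) 2)
     \<comment> \<open>(ii)\<close>
     \<and> (\<lambda>(t, p). wpd (0, 1) (QT T) u (t, p - lam)) \<in> Lp (lebesgue_on ({0<..<T} \<times> {lam<..})) 2
     \<and> (AE t in lebesgue_on {0<..<T}.
          distr_is_function {lam<..}
            (\<lambda>\<phi>. f_star lam g u t \<phi> - reg_distr {lam<..} (h_fun lam g) \<phi>)
            (\<lambda>p. wpd (0, 1) (QT T) u (t, p - lam)))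
     \<and> (\<forall>t\<in>{0<..<T}. is_distribution {lam<..} (f_star lam g u t))
     \<and> is_distribution {lam<..} (f0_star lam g u0)"
proof -
  let ?Q = "{0<..<T} \<times> {0::real<..}"
  let ?M = "density (lebesgue_on {0<..}) (\<lambda>k. ennreal (1 / (1 + lam\<^sup>2 * k\<^sup>2)))"
  let ?F = "\<lambda>t k. k ^ 3 * W_star lam u (t, k)"
  obtain S s :: "real \<Rightarrow> real" where "smooth_step S s"
    by (rule smooth_step_exists) (auto simp: smooth_step_def)
  then interpret smooth_step S s .
  note lam = assms(1)
  note constructed = assms(4)[unfolded constructed_weak_solution_def]
  note vL2 = constructed[THEN conjunct2, THEN conjunct1]
    and Linf = constructed[THEN conjunct2, THEN conjunct2, THEN conjunct1]
    and ucont = constructed[THEN conjunct2, THEN conjunct2, THEN conjunct2, THEN conjunct2, THEN conjunct1]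
  have diff: "weakly_diff (0, 1) (QT T) u"
    using constructed[THEN conjunct1] unfolding weak_solution_def by (elim conjE)
  have Q: "QT T = ?Q" by (simp add: QT_def)
  have Qb: "?Q \<in> sets borel" by (intro borel_Times) auto
  have Ib: "{0<..<T} \<in> sets borel" by simp
  have ucont: "continuous_on ?Q u" by (rule continuous_on_subset[OF ucont]) auto
  have uslice: "continuous_on {0<..} (\<lambda>x. u (t, x))" if "t \<in> {0<..<T}" for t
    using that by (intro continuous_on_compose2[OF ucont]) (auto intro!: continuous_intros)
  have usm: "set_borel_measurable borel {0<..} (\<lambda>x. u (t, x))" if "t \<in> {0<..<T}" for t
    using uslice[OF that] by (intro set_borel_measurable_if_continuous) auto

  define v where "v = wpd (0, 1) (QT T) u"
  \<comment> \<open>\<open>wpd\<close> is a choice; \<open>weakly_diff\<close> guarantees that it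
    picks an actual weak derivative.\<close>
  from diff have wd: "has_wpd (0, 1) ?Q u v" unfolding v_def wpd_def Q weakly_diff_def by (rule someI_ex)
  have vL2: "v \<in> Lp (lebesgue_on ?Q) 2" using vL2 by (simp only: v_def Q)
  then have "v \<in> borel_measurable (lebesgue_on ?Q)" by (simp add: Lp_def)
  \<comment> \<open>The k-derivative in (i) is built from this Borel version; (ii) is stated for
    \<open>wpd\<close> and has to switch back.\<close>
  then obtain v' where v' [measurable]: "v' \<in> borel_measurable borel"
    and eq: "AE z in lebesgue. z \<in> ?Q \<longrightarrow> v z = v' z"
    by (rule Borel_representative[OF Qb])
  have v'Q: "set_borel_measurable borel ?Q f" if "f \<in> borel_measurable borel" for f :: "real \<times> real \<Rightarrow> real"
    using that Qb unfolding set_borel_measurable_def by simp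
  have wd': "has_wpd (0, 1) ?Q u v'" using Qb by (intro has_wpd_cong_AE[OF wd eq]) auto
  have v2: "integrable lborel (\<lambda>z. indicator ?Q z * (v' z)\<^sup>2)"
  proof -
    have "integrable (lebesgue_on ?Q) (\<lambda>z. (v' z)\<^sup>2)"
    proof (rule integrable_lebesgue_on_cong_AE)
      show "AE z in lebesgue. z \<in> ?Q \<longrightarrow> (v z)\<^sup>2 = (v' z)\<^sup>2" using eq by eventually_elim simp
    qed (use vL2 Qb in \<open>auto simp: Lp_2_iff\<close>)
    moreover have "(\<lambda>z. (v' z)\<^sup>2) \<in> borel_measurable borel" by measurable
    ultimately show ?thesis
      using integrable_lebesgue_on_iff[OF Qb v'Q] by (simp add: set_integrable_def)
  qed
  have prim: "AE t in lborel. t \<in> {0<..<T} \<longrightarrow> (\<forall>c d. 0 < c \<longrightarrow> c < d \<longrightarrow>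
      set_integrable lborel {c..d} (\<lambda>x. v' (t, x)) \<and> u (t, d) - u (t, c) = (LINT x:{c..d}|lborel. v' (t, x)))"
    by (rule AE_primitive_slices[OF ucont wd' assms(2) v'Q[OF v']])
  have v't: "(\<lambda>x. v' (t, x)) \<in> borel_measurable borel" for t
  proof -
    have [measurable]: "v' \<in> borel_measurable (borel \<Otimes>\<^sub>M borel)" using v' by (simp add: borel_prod)
    show ?thesis by measurable
  qed

  have Fx: "?F t k = u (t, x_of_k lam k)" if "0 < k" for t k
    using that by (simp add: W_star_def)
  \<comment> \<open>The chain rule applied to the Borel representative; \<open>D\<close> is Borel on
    the plane and thus has Borel slices.\<close>
  define D where "D = (\<lambda>z. v' (fst z, x_of_k lam (snd z)) * x_of_k_deriv lam (snd z))"
  note D = x_of_k_L2[OF lam v' v2, folded D_def[THEN fun_cong]] x_of_k_Lp_loc[OF lam v' v2, folded D_def]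
    x_of_k_borel[OF lam v' v2, folded D_def]

  \<comment> \<open>\<open>Linf_Lp\<close> supplies a constant for each exponent separately; they
    are collected into a function \<open>C\<close> of the exponent.\<close>
  have "\<forall>p\<in>{p. p \<in> {1..3} \<or> (lam = 0 \<and> p = \<delta>)}. \<exists>C. AE t in lborel. t \<in> {0<..<T} \<longrightarrow>
      (\<lambda>x. u (t, x)) \<in> Lp (nu lam) p \<and> lp_norm (nu lam) p (\<lambda>x. u (t, x)) \<le> C"
  proof
    fix p assume "p \<in> {p. p \<in> {1..3} \<or> (lam = 0 \<and> p = \<delta>)}"
    with Linf have "u \<in> Linf_Lp lam T p" by blast
    then show "\<exists>C. AE t in lborel. t \<in> {0<..<T} \<longrightarrow>
        (\<lambda>x. u (t, x)) \<in> Lp (nu lam) p \<and> lp_norm (nu lam) p (\<lambda>x. u (t, x)) \<le> C"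
      unfolding Linf_Lp_def mem_Collect_eq AE_lebesgue_on_iff[OF Ib] by (elim conjE)
  qed
  from bchoice[OF this] obtain C where C: "\<And>p. p \<in> {1..3} \<or> (lam = 0 \<and> p = \<delta>) \<Longrightarrow>
      AE t in lborel. t \<in> {0<..<T} \<longrightarrow>
      (\<lambda>x. u (t, x)) \<in> Lp (nu lam) p \<and> lp_norm (nu lam) p (\<lambda>x. u (t, x)) \<le> C p"
    by blast
  \<comment> \<open>\<open>C p\<close> is a bound outside a null set depending on \<open>p\<close>,
    and there are uncountably many \<open>p\<close>. \<open>C'\<close> therefore uses only
    \<open>C 1\<close> and \<open>C 3\<close> on [1,3], and keeps \<open>C\<close> itself for an
    exponent outside that range.\<close>
  define C' where "C' q = (if q \<in> {1..3} then (C 1 + C 3 powr 3) powr (1 / q) else C q)" for q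
  \<comment> \<open>Stated as an implication so that the null sets of the three exponents can be
    merged without splitting on \<open>lam\<close>.\<close>
  have "AE t in lborel. t \<in> {0<..<T} \<longrightarrow> (lam = 0 \<longrightarrow>
      (\<lambda>x. u (t, x)) \<in> Lp (nu lam) \<delta> \<and> lp_norm (nu lam) \<delta> (\<lambda>x. u (t, x)) \<le> C \<delta>)"
    using C[of \<delta>] by (cases "lam = 0") auto
  moreover note C[of 1, simplified] C[of 3, simplified]
  ultimately have "AE t in lborel. t \<in> {0<..<T} \<longrightarrow> (\<forall>q. q \<in> {1..3} \<or> (lam = 0 \<and> q = \<delta>) \<longrightarrow>
        ?F t \<in> Lp ?M q \<and> lp_norm ?M q (?F t) \<le> C' q)"
  proof eventually_elim
    case (elim t)
    show ?case
    proof (intro impI allI)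
      fix q assume t: "t \<in> {0<..<T}" and q: "q \<in> {1..3} \<or> (lam = 0 \<and> q = \<delta>)"
      have uq: "(\<lambda>x. u (t, x)) \<in> Lp (nu lam) q \<and> lp_norm (nu lam) q (\<lambda>x. u (t, x)) \<le> C' q"
      proof (cases "q \<in> {1..3}")
        case True
        with elim t show ?thesis
          using Lp_interpolation[of "\<lambda>x. u (t, x)" "nu lam" 1 3 q]
            lp_norm_interpolation[of "\<lambda>x. u (t, x)" "nu lam" "C 1" "C 3" q]
          by (simp add: C'_def)
      next
        case False
        with elim t q show ?thesis by (auto simp: C'_def)
      qed
      then show "?F t \<in> Lp ?M q \<and> lp_norm ?M q (?F t) \<le> C' q"
        using Lp_x_of_k[OF lam usm[OF t], of q "?F t"] lp_norm_x_of_k[OF lam usm[OF t], of q "?F t"] Fx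
        by simp
    qed
  qed
  then have i1: "\<exists>C. AE t in lebesgue_on {0<..<T}. \<forall>q. q \<in> {1..3} \<or> (lam = 0 \<and> q = \<delta>) \<longrightarrow>
        ?F t \<in> Lp ?M q \<and> lp_norm ?M q (?F t) \<le> C q"
    using AE_lebesgue_on_iff[OF Ib] by auto

  have slice: "AE t in lborel. t \<in> {0<..<T} \<longrightarrow> has_wpd 1 {0<..} (?F t) (\<lambda>k. D (t, k))"
    using prim
  proof eventually_elim
    case (elim t)
    show ?case
    proof
      assume t: "t \<in> {0<..<T}"
      have w: "set_borel_measurable borel {0<..} (\<lambda>x. v' (t, x))"
        using v't[of t] unfolding set_borel_measurable_def by simp
      note px = primitive_x_of_k[OF lam w, of "\<lambda>x. u (t, x)"]
      show "has_wpd 1 {0<..} (?F t) (\<lambda>k. D (t, k))"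
      proof (rule has_wpd_if_primitive)
        have "continuous_on {0<..} (\<lambda>k. u (t, x_of_k lam k))"
          by (rule continuous_on_compose2[OF uslice[OF t] x_of_k_continuous]) (use x_of_k_pos[OF lam] in auto)
        then show "continuous_on {0<..} (?F t)" 
          by (rule continuous_on_eq) (use Fx in auto)
        have [measurable]: "D \<in> borel_measurable (borel \<Otimes>\<^sub>M borel)" using D(3) by (simp add: borel_prod)
        show "set_borel_measurable borel {0<..} (\<lambda>k. D (t, k))"
          unfolding set_borel_measurable_def by measurable
        show "set_integrable lborel {c..d} (\<lambda>k. D (t, k))" if "0 < c" "c < d" for c d
          using px(1)[OF _ _ that] elim t by (simp add: D_def)
        show "?F t d - ?F t c = (LINT k:{c..d}|lborel. D (t, k))" if "0 < c" "c < d" for c d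
          using px(2)[OF _ _ that] elim t that Fx[of c t] Fx[of d t] by (simp add: D_def)
      qed
    qed
  qed
  have Fcont: "continuous_on ?Q (\<lambda>(t, k). ?F t k)"
  proof -
    have "continuous_on ?Q (\<lambda>z. (fst z, x_of_k lam (snd z)))"
      by (intro continuous_intros continuous_on_compose2[OF x_of_k_continuous]) auto
    moreover have "(\<lambda>z. (fst z, x_of_k lam (snd z))) ` ?Q \<subseteq> ?Q"
    proof (rule image_subsetI)
      fix z assume "z \<in> ?Q"
      then show "(fst z, x_of_k lam (snd z)) \<in> ?Q" by (simp add: mem_Times_iff x_of_k_pos[OF lam])
    qed
    ultimately have "continuous_on ?Q (\<lambda>z. u (fst z, x_of_k lam (snd z)))"
      by (rule continuous_on_compose2[OF ucont])
    then show ?thesis by (rule continuous_on_eq) (use Fx in auto)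
  qed
  \<comment> \<open>The derivative in the plane is rebuilt from the slices, so the same
    \<open>D\<close> serves both claims about weak derivatives.\<close>
  have i2: "has_wpd (0, 1) ?Q (\<lambda>(t, k). ?F t k) D"
  proof (rule has_wpd_if_slices)
    show "AE t in lborel. t \<in> {0<..<T} \<longrightarrow>
        has_wpd 1 {0<..} (\<lambda>x. case (t, x) of (t, k) \<Rightarrow> ?F t k) (\<lambda>x. D (t, x))"
      using slice by simp
  qed (use D(2,3) v'Q Fcont Qb in \<open>auto intro: continuous_imp_Lp_loc_1 set_borel_measurable_if_continuous\<close>)
  have i3: "AE t in lebesgue_on {0<..<T}. has_wpd 1 {0<..} (?F t) (\<lambda>k. D (t, k))"
    using slice AE_lebesgue_on_iff[OF Ib] by blast
  have i4: "D \<in> Lp (density (lebesgue_on ?Q) (\<lambda>(t, k). ennreal (k\<^sup>2 * sqrt (1 + lam\<^sup>2 * k\<^sup>2)))) 2"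
  proof -
    let ?w = "\<lambda>z :: real \<times> real. (snd z)\<^sup>2 * sqrt (1 + lam\<^sup>2 * (snd z)\<^sup>2)"
    have "?w \<in> borel_measurable borel" by (intro borel_measurable_continuous_onI continuous_intros)
    then have wm: "?w \<in> borel_measurable (lebesgue_on ?Q)" by (rule borel_measurable_lebesgue_on_if_borel)
    have Dm: "D \<in> borel_measurable (lebesgue_on ?Q)" by (rule borel_measurable_lebesgue_on_if_borel[OF D(3)])
    then have D2: "(\<lambda>z. (D z)\<^sup>2) \<in> borel_measurable (lebesgue_on ?Q)" by measurable
    have "integrable (density (lebesgue_on ?Q) (\<lambda>z. ennreal (?w z))) (\<lambda>z. (D z)\<^sup>2)"
      using integrable_density[OF D2 wm] D(1) by simp
    then have "D \<in> Lp (density (lebesgue_on ?Q) (\<lambda>z. ennreal (?w z))) 2"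
      using Dm by (simp add: Lp_2_iff)
    then show ?thesis by (simp add: case_prod_beta')
  qed

  have ii1: "(\<lambda>(t, p). v (t, p - lam)) \<in> Lp (lebesgue_on ({0<..<T} \<times> {lam<..})) 2"
  proof -
    have "(\<lambda>z. v ((0, - lam) + z)) \<in> Lp (lebesgue_on {z. (0, - lam) + z \<in> ?Q}) 2"
      using Qb by (intro Lp_lebesgue_on_plus[OF vL2]) auto
    moreover have "{z. (0, - lam) + z \<in> ?Q} = {0<..<T} \<times> {lam<..}" by auto
    moreover have "(\<lambda>z. v ((0, - lam) + z)) = (\<lambda>(t, p). v (t, p - lam))" by (auto simp: fun_eq_iff)
    ultimately show ?thesis by simp
  qed
  have ii2: "AE t in lborel. t \<in> {0<..<T} \<longrightarrow> distr_is_function {lam<..}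
      (\<lambda>\<phi>. f_star lam g u t \<phi> - reg_distr {lam<..} (h_fun lam g) \<phi>) (\<lambda>p. v (t, p - lam))"
    \<comment> \<open>Two null sets of times are discarded: where the primitive identity for
      \<open>v'\<close> fails, and where \<open>v\<close> and \<open>v'\<close> differ on more than
      a null set in x.\<close>
    using prim AE_lebesgue_slices[OF eq]
  proof eventually_elim
    case (elim t)
    show ?case
    proof
      assume t: "t \<in> {0<..<T}"
      have "has_wpd 1 {lam<..} (\<lambda>p. u (t, p - lam)) (\<lambda>p. v' (t, p - lam))"
        by (rule has_wpd_translate[OF uslice[OF t] v't]) (use elim(1) t in auto)
      moreover have "AE p in lebesgue. p \<in> {lam<..} \<longrightarrow> v' (t, p - lam) = v (t, p - lam)"
        using AE_lebesgue_plus[OF elim(2), of "- lam"] by eventually_elim (use t in auto)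
      ultimately have "has_wpd 1 {lam<..} (\<lambda>p. u (t, p - lam)) (\<lambda>p. v (t, p - lam))"
        by (rule has_wpd_cong_AE) auto
      \<comment> \<open>Subtracting \<open>h\<close> leaves the distributional derivative of
        \<open>u(t, p - lam)\<close> in p, which is the pairing in \<open>has_wpd\<close> with the
        sign moved to the other side.\<close>
      then show "distr_is_function {lam<..}
          (\<lambda>\<phi>. f_star lam g u t \<phi> - reg_distr {lam<..} (h_fun lam g) \<phi>) (\<lambda>p. v (t, p - lam))"
        by (simp add: distr_is_function_def has_wpd_def f_star_def induced_distr_def distr_deriv_def reg_distr_def)
    qed
  qed
  have hL: "h_fun lam g \<in> Lp_loc {lam<..} 1"
    using assms(3) by (intro continuous_imp_Lp_loc_1 h_fun_continuous[OF lam]) (auto simp: hyp_H_def)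
  have distr: "is_distribution {lam<..} (induced_distr lam g w)" if "w \<in> Lp_loc {0<..} 1" for w
  proof -
    have "(\<lambda>p. w (p - lam)) \<in> Lp_loc {lam<..} 1"
      using Lp_loc_plus[OF that, of "- lam"] by (simp add: greaterThan_def)
    from is_distribution_add_deriv[OF _ hL this] show ?thesis unfolding induced_distr_def[abs_def] by simp
  qed
  \<comment> \<open>Continuity of \<open>u(t,.)\<close> at each positive time gives local
    integrability, so this holds for every \<open>t\<close> and not just almost every one.\<close>
  have ii3: "is_distribution {lam<..} (f_star lam g u t)" if "t \<in> {0<..<T}" for t
    unfolding f_star_def by (intro distr continuous_imp_Lp_loc_1 uslice that)
  have ii4: "is_distribution {lam<..} (f0_star lam g u0)"
    unfolding f0_star_def by (rule distr[OF hyp_H_Lp_loc[OF lam assms(3)]])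

  show ?thesis
    using i1 i2 i3 i4 ii1 ii2 ii3 ii4 unfolding v_def AE_lebesgue_on_iff[OF Ib] by blast
qed

end
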